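(* Let $\pi\colon G\to\mathcal{B}(X)$ be a bounded continuous representation of an amenable locally compact group $G$ on a Banach space $X$. Suppose $1<p<\infty$. (1) There exist a Banach space $Y$ in the class $\mathcal{U}(p;X)$, an isometric representation $\widehat{\pi}\colon G\to\mathcal{B}(Y)$ and two bounded operators $J\colon X\to Y$ and $Q\colon Y\to X^{**}$ such that $\|J\|\|Q\|\leq\|\pi\|^2$ and $$\kappa_X\pi(t)=Q\widehat{\pi}(t)J\qquad\text{for all } t\in G.$$ (2) For any $x\in X$, the map $t\mapsto\widehat{\pi}(t)J(x)$ from $G$ into $Y$ is continuous. Moreover, if $X$ is a Riesz-normed space, then $Y$ is a Riesz-normed space as well and the representation $\widehat{\pi}$ can be chosen such that $\widehat{\pi}(t)$ is a positive operator on $Y$ for any $t\in G$.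
   Context: Banach spaces are complex. A representation $\pi\colon G\to\mathcal{B}(X)$ is a map with $\pi(st)=\pi(s)\pi(t)$ for all $s,t$ and $\pi(e)=\mathrm{Id}_X$. It is continuous if $t\mapsto\pi(t)x$ is continuous for every $x\in X$; bounded if $\|\pi\|:=\sup_{t\in G}\|\pi(t)\|<\infty$; isometric if each $\pi(t)$ is an isometry (no continuity of $\widehat{\pi}$ is asserted). $\kappa_X\colon X\hookrightarrow X^{**}$ is the canonical embedding. Given Banach spaces $(X_j)_{j\in I}$ and an ultrafilter $\mathcal{U}$ on $I$, the ultraproduct $(X_j)^{\mathcal{U}}$ is the quotient of $\ell^\infty(I;X_j)$ (bounded families, sup norm) by the subspace of families with $\lim_{\mathcal{U}}\|x_j\|=0$. $\mathcal{U}(p;X)$ is the class of Banach spaces which are ultraproducts of families $(L^p(\Omega_j;X))_{j\in I}$ of Bochner spaces for arbitrary measure spaces $\Omega_j$. A complex Banach space $X$ is the complexification of a real Banach space $X_{\mathbb{R}}$ if $X_{\mathbb{R}}$ is a closed real subspace of $X$, $X=X_{\mathbb{R}}\oplus iX_{\mathbb{R}}$, and $\max\{\|x_1\|,\|x_2\|\}\leq\|x_1+ix_2\|$ for $x_1,x_2\in X_{\mathbb{R}}$. $X$ is an ordered Banach space if it is the complexification of a real Banach space $X_{\mathbb{R}}$ with a partial order compatible with the vector space structure whose positive cone $\mathcal{C}=\{x\in X_{\mathbb{R}}: x\ge 0\}$ is closed and satisfies $\mathcal{C}\cap(-\mathcal{C})=\{0\}$. An operator $T$ is positive if $T(x)\geq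 0$ for all $x\geq 0$. An ordered Banach space $X$ is absolutely monotone if $-y\leq x\leq y$ implies $\|x\|\leq\|y\|$ ($x,y\in X_{\mathbb{R}}$); it is Riesz-normed if moreover for all $x\in X_{\mathbb{R}}$ and $\epsilon>0$ there is $y\in X_{\mathbb{R}}$ with $-y\leq x\leq y$ and $\|y\|\leq(1+\epsilon)\|x\|$. If $X$ is ordered, $L^p(\Omega;X)$ is ordered as the complexification of $L^p(\Omega;X_{\mathbb{R}})$ with $f\geq 0$ iff $f(\omega)\geq 0$ a.e. For Riesz-normed $X_j$, the ultraproduct $(X_j)^{\mathcal{U}}$ is ordered as the complexification of the real subspace of elements having a representative with all $x_j\in X_{j,\mathbb{R}}$, where $z\geq 0$ means that $z$ has a representative with all $x_j\geq 0$; the ordered structure on $Y$ is this one. *)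

theory Defs
  imports "HOL-Analysis.Analysis" "HOL-Algebra.Module" "HOL-Algebra.AbelCoset"
begin

section \<open>Complex Banach spaces\<close>

text \<open>
  Spaces are records with an explicit carrier, because bidual spaces, \<open>L\<^sup>p\<close>-spaces and
  ultraproducts depend on terms and hence are not types.  A complex vector space is a
  module of HOL-Algebra over the field of complex numbers; the fields \<open>mult\<close> and \<open>one\<close>,
  which \<open>module\<close> inherits from \<open>ring\<close>, play no role.
\<close>

definition complex_field :: "complex ring" where
  "complex_field = \<lparr>carrier = UNIV, mult = (*), one = 1, zero = 0, add = (+)\<rparr>"

record 'v nspace = "(complex, 'v) module" +
  nrm :: "'v \<Rightarrow> real"

definition mk_nspace ::
    "'v set \<Rightarrow> 'v \<Rightarrow> ('v \<Rightarrow> 'v \<Rightarrow> 'v) \<Rightarrow> (complex \<Rightarrow> 'v \<Rightarrow> 'v) \<Rightarrow> ('v \<Rightarrow> real) \<Rightarrow> 'v nspace" where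
  "mk_nspace A z pl sm n =
     \<lparr>carrier = A, mult = undefined, one = undefined, zero = z, add = pl, smult = sm, nrm = n\<rparr>"

text \<open>The distance is totalised by 0, since \<^locale>\<open>Metric_space\<close> demands nonnegativity
  and symmetry also for arguments outside the carrier.\<close>

definition ndist :: "('v, 'm) nspace_scheme \<Rightarrow> 'v \<Rightarrow> 'v \<Rightarrow> real" where
  "ndist X x y = (if x \<in> carrier X \<and> y \<in> carrier X then nrm X (x \<ominus>\<^bsub>X\<^esub> y) else 0)"

definition ntopology :: "('v, 'm) nspace_scheme \<Rightarrow> 'v topology" where
  "ntopology X = Metric_space.mtopology (carrier X) (ndist X)"

locale complex_normed_space = Module.module complex_field X
  for X :: "('v, 'm) nspace_scheme" (structure) +
  assumes nrm_eq_0_iff: "x \<in> carrier X \<Longrightarrow> nrm X x = 0 \<longleftrightarrow> x = \<zero>"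
    and nrm_add: "\<lbrakk>x \<in> carrier X; y \<in> carrier X\<rbrakk> \<Longrightarrow> nrm X (x \<oplus> y) \<le> nrm X x + nrm X y"
    and nrm_smult: "x \<in> carrier X \<Longrightarrow> nrm X (a \<odot> x) = cmod a * nrm X x"

locale complex_banach_space = complex_normed_space +
  assumes complete: "Metric_space.mcomplete (carrier X) (ndist X)"

section \<open>Bounded operators and biduals\<close>

definition bounded_op ::
    "('v, 'm) nspace_scheme \<Rightarrow> ('u, 'n) nspace_scheme \<Rightarrow> ('v \<Rightarrow> 'u) \<Rightarrow> bool" where
  "bounded_op X Y T \<longleftrightarrow>
     T \<in> carrier X \<rightarrow> carrier Y \<and>
     (\<forall>x\<in>carrier X. \<forall>y\<in>carrier X. T (x \<oplus>\<^bsub>X\<^esub> y) = T x \<oplus>\<^bsub>Y\<^esub> T y) \<and>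
     (\<forall>a. \<forall>x\<in>carrier X. T (a \<odot>\<^bsub>X\<^esub> x) = a \<odot>\<^bsub>Y\<^esub> T x) \<and>
     (\<exists>K. \<forall>x\<in>carrier X. nrm Y (T x) \<le> K * nrm X x)"

definition op_norm ::
    "('v, 'm) nspace_scheme \<Rightarrow> ('u, 'n) nspace_scheme \<Rightarrow> ('v \<Rightarrow> 'u) \<Rightarrow> real" where
  "op_norm X Y T = (SUP x\<in>{x \<in> carrier X. nrm X x \<le> 1}. nrm Y (T x))"

definition complex_space :: "complex nspace" where
  "complex_space = mk_nspace UNIV 0 (+) (*) cmod"

text \<open>Functionals are made extensional, so that they are determined by their values on the
  carrier.\<close>

definition dual :: "('v, 'm) nspace_scheme \<Rightarrow> ('v \<Rightarrow> complex) nspace" where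
  "dual X = mk_nspace
     {\<phi>. \<phi> \<in> extensional (carrier X) \<and> bounded_op X complex_space \<phi>}
     (\<lambda>x\<in>carrier X. 0)
     (\<lambda>\<phi> \<psi>. \<lambda>x\<in>carrier X. \<phi> x + \<psi> x)
     (\<lambda>a \<phi>. \<lambda>x\<in>carrier X. a * \<phi> x)
     (op_norm X complex_space)"

abbreviation bidual :: "('v, 'm) nspace_scheme \<Rightarrow> (('v \<Rightarrow> complex) \<Rightarrow> complex) nspace" where
  "bidual X \<equiv> dual (dual X)"

definition canonical_embedding ::
    "('v, 'm) nspace_scheme \<Rightarrow> 'v \<Rightarrow> ('v \<Rightarrow> complex) \<Rightarrow> complex" where
  "canonical_embedding X x = (\<lambda>\<phi>\<in>carrier (dual X). \<phi> x)"

section \<open>Ordered Banach spaces\<close>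

record 'v onspace = "'v nspace" +
  real_part :: "'v set"
  vle :: "'v \<Rightarrow> 'v \<Rightarrow> bool"  (infix \<open>\<preceq>\<index>\<close> 50)

definition pos_cone :: "('v, 'm) onspace_scheme \<Rightarrow> 'v set" where
  "pos_cone X = {x \<in> real_part X. \<zero>\<^bsub>X\<^esub> \<preceq>\<^bsub>X\<^esub> x}"

locale complexification = complex_banach_space X
  for X :: "('v, 'm) onspace_scheme" (structure) +
  assumes real_part_closed: "closedin (ntopology X) (real_part X)"
    and real_part_zero: "\<zero> \<in> real_part X"
    and real_part_add: "\<lbrakk>x \<in> real_part X; y \<in> real_part X\<rbrakk> \<Longrightarrow> x \<oplus> y \<in> real_part X"
    and real_part_smult: "x \<in> real_part X \<Longrightarrow> complex_of_real a \<odot> x \<in> real_part X"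
    and decomposition:
      "x \<in> carrier X \<Longrightarrow> \<exists>!z. z \<in> real_part X \<times> real_part X \<and> x = fst z \<oplus> \<i> \<odot> snd z"
    and nrm_complexification: "\<lbrakk>x1 \<in> real_part X; x2 \<in> real_part X\<rbrakk> \<Longrightarrow>
      max (nrm X x1) (nrm X x2) \<le> nrm X (x1 \<oplus> \<i> \<odot> x2)"

locale ordered_banach_space = complexification +
  assumes partial_order: "partial_order_on (real_part X)
      {(x, y). x \<in> real_part X \<and> y \<in> real_part X \<and> x \<preceq> y}"
    and add_mono: "\<lbrakk>x \<in> real_part X; y \<in> real_part X; z \<in> real_part X; x \<preceq> y\<rbrakk> \<Longrightarrow>
      x \<oplus> z \<preceq> y \<oplus> z"
    and smult_mono: "\<lbrakk>x \<in> real_part X; y \<in> real_part X; x \<preceq> y; 0 \<le> a\<rbrakk> \<Longrightarrow>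
      complex_of_real a \<odot> x \<preceq> complex_of_real a \<odot> y"
    and cone_closed: "closedin (ntopology X) (pos_cone X)"
    and cone_proper: "pos_cone X \<inter> {\<ominus> x | x. x \<in> pos_cone X} = {\<zero>}"

locale absolutely_monotone = ordered_banach_space +
  assumes absolutely_monotone:
    "\<lbrakk>x \<in> real_part X; y \<in> real_part X; \<ominus> y \<preceq> x; x \<preceq> y\<rbrakk> \<Longrightarrow> nrm X x \<le> nrm X y"

locale riesz_normed = absolutely_monotone +
  assumes riesz: "\<lbrakk>x \<in> real_part X; 0 < \<epsilon>\<rbrakk> \<Longrightarrow>
    \<exists>y\<in>real_part X. \<ominus> y \<preceq> x \<and> x \<preceq> y \<and> nrm X y \<le> (1 + \<epsilon>) * nrm X x"

definition positive_op ::
    "('v, 'm) onspace_scheme \<Rightarrow> ('u, 'n) onspace_scheme \<Rightarrow> ('v \<Rightarrow> 'u) \<Rightarrow> bool" where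
  "positive_op X Y T \<longleftrightarrow> (\<forall>x\<in>pos_cone X. T x \<in> pos_cone Y)"

definition ordered_by :: "'v nspace \<Rightarrow> 'v set \<Rightarrow> 'v set \<Rightarrow> 'v onspace" where
  "ordered_by E R C = nspace.extend E
     (onspace.fields R (\<lambda>x y. x \<in> R \<and> y \<in> R \<and> y \<ominus>\<^bsub>E\<^esub> x \<in> C))"

section \<open>Bochner spaces and ultraproducts\<close>

text \<open>Elements of the quotient of \<open>E\<close> by \<open>N\<close> are cosets, with the quotient (semi)norm.  In
  \<open>smult\<close>, adding \<open>N\<close> matters only for the scalar 0.\<close>

definition quotient_space :: "('v, 'm) nspace_scheme \<Rightarrow> 'v set \<Rightarrow> 'v set nspace" where
  "quotient_space E N = mk_nspace
     (a_rcosets\<^bsub>E\<^esub> N)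
     N
     (\<lambda>A B. A <+>\<^bsub>E\<^esub> B)
     (\<lambda>a A. N <+>\<^bsub>E\<^esub> ((\<lambda>x. a \<odot>\<^bsub>E\<^esub> x) ` A))
     (\<lambda>A. INF x\<in>A. nrm E x)"

text \<open>Strong (Bochner) measurability: pointwise limit of measurable functions with finitely
  many values.  Every function that is only almost everywhere such a limit agrees almost
  everywhere with a function of this kind, so the classes are the usual ones.\<close>

definition strongly_measurable ::
    "'w measure \<Rightarrow> ('v, 'm) nspace_scheme \<Rightarrow> ('w \<Rightarrow> 'v) \<Rightarrow> bool" where
  "strongly_measurable \<Omega> X f \<longleftrightarrow> f \<in> space \<Omega> \<rightarrow> carrier X \<and>
     (\<exists>s. (\<forall>n. simple_function \<Omega> (s n) \<and> s n \<in> space \<Omega> \<rightarrow> carrier X) \<and>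
          (\<forall>\<omega>\<in>space \<Omega>. (\<lambda>n. ndist X (s n \<omega>) (f \<omega>)) \<longlonglongrightarrow> 0))"

text \<open>Functions are defined on the whole type; their values outside \<open>space \<Omega>\<close> are irrelevant, since
  functions that agree almost everywhere on \<open>space \<Omega>\<close> are identified below.\<close>

definition Lp_functions :: "real \<Rightarrow> 'w measure \<Rightarrow> ('v, 'm) nspace_scheme \<Rightarrow> ('w \<Rightarrow> 'v) nspace" where
  "Lp_functions p \<Omega> X = mk_nspace
     {f. (\<forall>\<omega>. f \<omega> \<in> carrier X) \<and> strongly_measurable \<Omega> X f \<and>
         integrable \<Omega> (\<lambda>\<omega>. nrm X (f \<omega>) powr p)}
     (\<lambda>\<omega>. \<zero>\<^bsub>X\<^esub>)
     (\<lambda>f g \<omega>. f \<omega> \<oplus>\<^bsub>X\<^esub> g \<omega>)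
     (\<lambda>a f \<omega>. a \<odot>\<^bsub>X\<^esub> f \<omega>)
     (\<lambda>f. (\<integral>\<omega>. nrm X (f \<omega>) powr p \<partial>\<Omega>) powr (1 / p))"

text \<open>The order of \<open>Lp\<close> and of \<open>ultraproduct\<close> is only meaningful if the given spaces are
  ordered Banach spaces (respectively Riesz-normed).\<close>

definition Lp :: "real \<Rightarrow> 'w measure \<Rightarrow> ('v, 'm) onspace_scheme \<Rightarrow> ('w \<Rightarrow> 'v) set onspace" where
  "Lp p \<Omega> X =
     (let E = quotient_space (Lp_functions p \<Omega> X)
                {f \<in> carrier (Lp_functions p \<Omega> X). AE \<omega> in \<Omega>. f \<omega> = \<zero>\<^bsub>X\<^esub>}
      in ordered_by E
           {A \<in> carrier E. \<exists>f\<in>A. AE \<omega> in \<Omega>. f \<omega> \<in> real_part X}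
           {A \<in> carrier E. \<exists>f\<in>A. AE \<omega> in \<Omega>. f \<omega> \<in> pos_cone X})"

text \<open>The index set of a family is a whole type \<open>'i\<close>; a smaller index set amounts to an
  ultrafilter containing it.\<close>

definition ultrafilter :: "'i filter \<Rightarrow> bool" where
  "ultrafilter U \<longleftrightarrow> U \<noteq> bot \<and> (\<forall>P. eventually P U \<or> eventually (\<lambda>j. \<not> P j) U)"

definition bounded_families :: "('i \<Rightarrow> ('v, 'm) nspace_scheme) \<Rightarrow> ('i \<Rightarrow> 'v) nspace" where
  "bounded_families X = mk_nspace
     {x. (\<forall>j. x j \<in> carrier (X j)) \<and> bdd_above (range (\<lambda>j. nrm (X j) (x j)))}
     (\<lambda>j. \<zero>\<^bsub>X j\<^esub>)
     (\<lambda>x y j. x j \<oplus>\<^bsub>X j\<^esub> y j)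
     (\<lambda>a x j. a \<odot>\<^bsub>X j\<^esub> x j)
     (\<lambda>x. SUP j. nrm (X j) (x j))"

definition ultraproduct ::
    "'i filter \<Rightarrow> ('i \<Rightarrow> ('v, 'm) onspace_scheme) \<Rightarrow> ('i \<Rightarrow> 'v) set onspace" where
  "ultraproduct U X =
     (let E = quotient_space (bounded_families X)
                {x \<in> carrier (bounded_families X). ((\<lambda>j. nrm (X j) (x j)) \<longlongrightarrow> 0) U}
      in ordered_by E
           {z \<in> carrier E. \<exists>x\<in>z. \<forall>j. x j \<in> real_part (X j)}
           {z \<in> carrier E. \<exists>x\<in>z. \<forall>j. x j \<in> pos_cone (X j)})"

text \<open>The members of the class \<open>\<U>(p; X)\<close> with index set \<open>'i\<close> and with measure spaces that are
  subsets of \<open>'w\<close>.\<close>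

definition ultra_Lp_class ::
    "real \<Rightarrow> ('v, 'm) onspace_scheme \<Rightarrow> ('i \<Rightarrow> ('w \<Rightarrow> 'v) set) set onspace set" where
  "ultra_Lp_class p X = {ultraproduct U (\<lambda>j. Lp p (\<Omega> j) X) | U \<Omega>. ultrafilter U}"

section \<open>Amenable locally compact groups and their representations\<close>

text \<open>Groups are written additively, as in the library class \<^class>\<open>topological_group_add\<close>; they
  are not assumed to be commutative.  A left Haar measure is a nonzero left-invariant Radon
  measure.\<close>

definition left_haar_measure :: "'g::{topological_group_add, t2_space} measure \<Rightarrow> bool" where
  "left_haar_measure \<mu> \<longleftrightarrow>
     sets \<mu> = sets borel \<and> emeasure \<mu> UNIV \<noteq> 0 \<and>
     (\<forall>K. compact K \<longrightarrow> emeasure \<mu> K < \<infinity>) \<and>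
     (\<forall>A\<in>sets borel. emeasure \<mu> A = (INF V\<in>{V. open V \<and> A \<subseteq> V}. emeasure \<mu> V)) \<and>
     (\<forall>V. open V \<longrightarrow> emeasure \<mu> V = (SUP K\<in>{K. compact K \<and> K \<subseteq> V}. emeasure \<mu> K)) \<and>
     (\<forall>s. \<forall>A\<in>sets borel. emeasure \<mu> ((+) s ` A) = emeasure \<mu> A)"

definition ess_bounded :: "'g measure \<Rightarrow> ('g \<Rightarrow> complex) set" where
  "ess_bounded \<mu> = {f \<in> borel_measurable \<mu>. \<exists>c. AE x in \<mu>. cmod (f x) \<le> c}"

text \<open>A left-invariant mean on \<open>L\<^sup>\<infinity>\<close>: a linear functional \<open>m\<close> with \<open>m 1 = \<parallel>m\<parallel> = 1\<close> that is
  invariant under left translations.  The bound by the essential supremum makes \<open>m\<close> well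
  defined on classes modulo null functions.\<close>

definition left_invariant_mean ::
    "'g::group_add measure \<Rightarrow> (('g \<Rightarrow> complex) \<Rightarrow> complex) \<Rightarrow> bool" where
  "left_invariant_mean \<mu> m \<longleftrightarrow>
     (\<forall>f\<in>ess_bounded \<mu>. \<forall>g\<in>ess_bounded \<mu>. m (\<lambda>x. f x + g x) = m f + m g) \<and>
     (\<forall>a. \<forall>f\<in>ess_bounded \<mu>. m (\<lambda>x. a * f x) = a * m f) \<and>
     m (\<lambda>x. 1) = 1 \<and>
     (\<forall>f\<in>ess_bounded \<mu>. \<forall>c. (AE x in \<mu>. cmod (f x) \<le> c) \<longrightarrow> cmod (m f) \<le> c) \<and>
     (\<forall>s. \<forall>f\<in>ess_bounded \<mu>. m (\<lambda>x. f (- s + x)) = m f)"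

definition amenable_lc_group :: "'g::{topological_group_add, t2_space} itself \<Rightarrow> bool" where
  "amenable_lc_group _ \<longleftrightarrow>
     locally compact (UNIV :: 'g set) \<and>
     (\<exists>(\<mu> :: 'g measure) m. left_haar_measure \<mu> \<and> left_invariant_mean \<mu> m)"

definition group_rep ::
    "('v, 'm) nspace_scheme \<Rightarrow> ('g::group_add \<Rightarrow> 'v \<Rightarrow> 'v) \<Rightarrow> bool" where
  "group_rep X \<pi> \<longleftrightarrow>
     (\<forall>t. bounded_op X X (\<pi> t)) \<and>
     (\<forall>s t. \<forall>x\<in>carrier X. \<pi> (s + t) x = \<pi> s (\<pi> t x)) \<and>
     (\<forall>x\<in>carrier X. \<pi> 0 x = x)"

definition continuous_rep ::
    "('v, 'm) nspace_scheme \<Rightarrow> ('g::topological_space \<Rightarrow> 'v \<Rightarrow> 'v) \<Rightarrow> bool" where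
  "continuous_rep X \<pi> \<longleftrightarrow> (\<forall>x\<in>carrier X. continuous_map euclidean (ntopology X) (\<lambda>t. \<pi> t x))"

definition bounded_rep :: "('v, 'm) nspace_scheme \<Rightarrow> ('g \<Rightarrow> 'v \<Rightarrow> 'v) \<Rightarrow> bool" where
  "bounded_rep X \<pi> \<longleftrightarrow> bdd_above (range (\<lambda>t. op_norm X X (\<pi> t)))"

definition rep_norm :: "('v, 'm) nspace_scheme \<Rightarrow> ('g \<Rightarrow> 'v \<Rightarrow> 'v) \<Rightarrow> real" where
  "rep_norm X \<pi> = (SUP t. op_norm X X (\<pi> t))"

definition isometric_rep :: "('v, 'm) nspace_scheme \<Rightarrow> ('g \<Rightarrow> 'v \<Rightarrow> 'v) \<Rightarrow> bool" where
  "isometric_rep X \<pi> \<longleftrightarrow> (\<forall>t. \<forall>x\<in>carrier X. nrm X (\<pi> t x) = nrm X x)"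

end

theory Submission
  imports Defs
begin

text \<open>
  The mean yields, by Day's convexity argument, nonnegative weights \<open>h\<close> of mass 1 that are
  asymptotically invariant in \<open>L\<^sup>1(G)\<close> along an ultrafilter (Reiter's condition).  Translations
  act isometrically and positively on \<open>L\<^sup>p(G; X)\<close>, hence on its ultrapower \<open>Y\<close>.  The embedding
  \<open>J\<close> spreads \<open>x\<close> over its orbit, weighted by \<open>h powr (1 / p)\<close>; the asymptotic
  invariance of the weights makes it intertwine \<open>\<pi>\<close> with the translations exactly.  As
  \<open>Q \<circ> J\<close> is the canonical embedding, \<open>Q (\<pi>' t (J x)) = Q (J (\<pi> t x))\<close> is the image of \<open>\<pi> t x\<close>,
  and \<open>\<pi>' t (J x) = J (\<pi> t x)\<close> is continuous in \<open>t\<close> although \<open>\<pi>'\<close> need not be.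
\<close>

section \<open>Ultrafilters\<close>

text \<open>Neither \<open>X\<close> nor the group is assumed separable, so an orbit need not be
  strongly measurable on the whole group. This is why the weights are simple functions of compact
  support: on a compact set the orbit is a uniform limit of simple functions, and a simple factor
  preserves this.

  The exponent enters twice. Taking the \<open>p\<close>-th root turns invariance of the weights in
  L1 into closeness in Lp, and \<open>k powr (p - 1)\<close> is the unit vector of the dual space
  that pairs with \<open>k\<close> to total mass 1. Applying \<open>\<pi> (- s)\<close> in
  \<open>J\<close> costs one factor \<open>rep_norm X \<pi>\<close>, applying \<open>\<pi> s\<close>
  in \<open>Q\<close> another; this is the square in the bound. \<open>Q\<close> reaches the bidual
  because bounded scalars converge along an ultrafilter, while bounded families in \<open>X\<close>
  need not.

  An index is a set of group elements with a natural number. The number is the tolerance, and it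
  also makes the ultrafilter countably incomplete. The resulting saturation yields completeness of
  \<open>Y\<close> and closedness of its cone, and lets \<open>Y\<close> have dominating elements
  although in Lp they are only constructed for step functions.\<close>

lemma ultrafilterD:
  "ultrafilter U \<Longrightarrow> \<not> eventually P U \<Longrightarrow> eventually (\<lambda>j. \<not> P j) U"
  "ultrafilter U \<Longrightarrow> U \<noteq> bot"
  by (auto simp: ultrafilter_def)

text \<open>Zorn's lemma on the proper filters below \<open>F\<close>. The infimum of a chain is
  proper, because an event that holds eventually along it already does so along a member of the
  chain. A minimal proper filter decides every \<open>P\<close>: intersecting it with
  \<open>P\<close> either leaves nothing, so the complement is eventual, or leaves the filter
  unchanged.\<close>

lemma exists_ultrafilter_le:
  fixes F :: "'i filter"
  assumes "F \<noteq> bot"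
  obtains U where "ultrafilter U" "U \<le> F"
proof -
  define A where "A = {G. G \<noteq> bot \<and> G \<le> F}"
  have "\<exists>m\<in>A. \<forall>a\<in>A. a \<le> m \<longrightarrow> a = m"
  proof (rule predicate_Zorn[of A "\<lambda>x y. y \<le> x"])
    show "partial_order_on A (relation_of (\<lambda>x y. y \<le> x) A)"
      by (auto simp: partial_order_on_def preorder_on_def refl_on_def relation_of_def
          intro!: transI antisymI)
  next
    fix C assume C: "C \<in> Chains (relation_of (\<lambda>x y. y \<le> x) A)"
    show "\<exists>u\<in>A. \<forall>a\<in>C. u \<le> a"
    proof (cases "C = {}")
      case True
      then show ?thesis using assms by (auto simp: A_def)
    next
      case False
      have CA: "C \<subseteq> A" using C by (auto simp: Chains_def relation_of_def)
      have tot: "a \<le> b \<or> b \<le> a" if "a \<in> C" "b \<in> C" for a b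
        using C that by (auto simp: Chains_def relation_of_def)
      have "\<exists>b\<in>C. b \<le> inf a a'" if "a \<in> C" "a' \<in> C" for a a'
        using tot[OF that] that by (metis inf.absorb1 inf.absorb2 order_refl)
      then have "eventually P (Inf C) \<longleftrightarrow> (\<exists>b\<in>C. eventually P b)" for P
        by (intro eventually_Inf_base False) auto
      then have "Inf C \<noteq> bot"
        using CA by (auto simp: trivial_limit_def A_def)
      moreover have "Inf C \<le> F"
        using False CA by (metis (no_types, lifting) A_def Inf_lower2 all_not_in_conv mem_Collect_eq subsetD)
      ultimately show ?thesis by (auto simp: A_def intro!: bexI[of _ "Inf C"] Inf_lower)
    qed
  qed
  then obtain U where U: "U \<in> A" and min: "\<And>G. G \<in> A \<Longrightarrow> G \<le> U \<Longrightarrow> G = U" by blast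
  have "eventually P U \<or> eventually (\<lambda>j. \<not> P j) U" for P
  proof (cases "inf U (principal {j. P j}) = bot")
    case True
    then show ?thesis by (simp add: trivial_limit_def eventually_inf_principal)
  next
    case False
    have "inf U (principal {j. P j}) \<le> F"
      using U by (auto simp: A_def intro: le_infI1)
    then have "inf U (principal {j. P j}) = U"
      using False by (intro min) (auto simp: A_def)
    moreover have "eventually P (inf U (principal {j. P j}))"
      by (simp add: eventually_inf_principal)
    ultimately have "eventually P U" by simp
    then show ?thesis ..
  qed
  then show thesis using U that by (auto simp: ultrafilter_def A_def)
qed

text \<open>The image filter has a cluster point in \<open>K\<close> by compactness. Along an
  ultrafilter a cluster point is a limit: if a neighbourhood were not eventually entered, its
  complement would be, and the two could not meet.\<close>

lemma ultrafilter_compact_tendsto: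
  fixes f :: "'i \<Rightarrow> 'a::topological_space"
  assumes U: "ultrafilter U" and K: "compact K" and f: "\<forall>\<^sub>F j in U. f j \<in> K"
  obtains l where "l \<in> K" "(f \<longlongrightarrow> l) U"
proof -
  have "filtermap f U \<noteq> bot" "\<forall>\<^sub>F x in filtermap f U. x \<in> K"
    using ultrafilterD(2)[OF U] f by (auto simp: filtermap_bot_iff eventually_filtermap)
  then obtain l where l: "l \<in> K" "inf (nhds l) (filtermap f U) \<noteq> bot"
    using K unfolding compact_filter by blast
  have "\<forall>\<^sub>F j in U. f j \<in> S" if "open S" "l \<in> S" for S
  proof (rule ccontr)
    assume "\<not> (\<forall>\<^sub>F j in U. f j \<in> S)"
    then have "\<forall>\<^sub>F x in filtermap f U. x \<notin> S"
      using ultrafilterD(1)[OF U] by (auto simp: eventually_filtermap)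
    moreover have "\<forall>\<^sub>F x in nhds l. x \<in> S" using that by (rule eventually_nhds_in_open)
    ultimately have "\<forall>\<^sub>F x in inf (nhds l) (filtermap f U). False"
      unfolding eventually_inf by blast
    then show False using l by (simp add: trivial_limit_def)
  qed
  then show thesis using that l(1) by (auto simp: tendsto_def)
qed

text \<open>This makes \<open>Lim U\<close> a genuine limit for every bounded family; the norms of
  families and the scalar pairings behind \<open>Q\<close> are passed to the limit in this
  form.\<close>

lemma ultrafilter_bounded_tendsto:
  fixes f :: "'i \<Rightarrow> 'a::heine_borel"
  assumes U: "ultrafilter U" and f: "bounded (range f)"
  shows "(f \<longlongrightarrow> Lim U f) U"
proof -
  have "\<forall>\<^sub>F j in U. f j \<in> closure (range f)"
    using closure_subset[of "range f"] by (intro always_eventually) blast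
  then obtain l where "(f \<longlongrightarrow> l) U"
    using ultrafilter_compact_tendsto[OF U, of "closure (range f)" f] f by (auto simp: compact_closure)
  then show ?thesis using tendsto_Lim ultrafilterD(2)[OF U] by metis
qed

section \<open>Dominated linear functionals\<close>

text \<open>Homogeneity is required for \<open>a > 0\<close> only; the value 0 at zero then follows
  by doubling.\<close>

definition sublinear_on :: "('a \<Rightarrow> real) set \<Rightarrow> (('a \<Rightarrow> real) \<Rightarrow> real) \<Rightarrow> bool" where
  "sublinear_on V q \<longleftrightarrow>
     (\<forall>u\<in>V. \<forall>v\<in>V. q (\<lambda>x. u x + v x) \<le> q u + q v) \<and>
     (\<forall>u\<in>V. \<forall>a>0. q (\<lambda>x. a * u x) = a * q u)"

text \<open>Vector spaces are sets of functions here: the space to which Hahn-Banach is applied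
  consists of functions on \<open>'g \<times> 'g\<close> and depends on a finite set and a measure,
  hence is not a type.\<close>

locale function_space =
  fixes V :: "('a \<Rightarrow> real) set"
  assumes zero: "(\<lambda>x. 0) \<in> V"
    and add: "u \<in> V \<Longrightarrow> v \<in> V \<Longrightarrow> (\<lambda>x. u x + v x) \<in> V"
    and scale: "u \<in> V \<Longrightarrow> (\<lambda>x. a * u x) \<in> V"
begin

lemma neg: assumes "u \<in> V" shows "(\<lambda>x. - u x) \<in> V"
  using scale[OF assms, of "-1"] by simp

lemma sublinear_add:
  "sublinear_on V q \<Longrightarrow> u \<in> V \<Longrightarrow> v \<in> V \<Longrightarrow> q (\<lambda>x. u x + v x) \<le> q u + q v"
  unfolding sublinear_on_def by blast

lemma sublinear_scale:
  "sublinear_on V q \<Longrightarrow> u \<in> V \<Longrightarrow> a > 0 \<Longrightarrow> q (\<lambda>x. a * u x) = a * q u"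
  unfolding sublinear_on_def by blast

lemma sublinear_zero: assumes "sublinear_on V q" shows "q (\<lambda>x. 0) = 0"
  using sublinear_scale[OF assms zero, of 2] by simp

lemma sublinear_neg: assumes "sublinear_on V q" "u \<in> V" shows "- q (\<lambda>x. - u x) \<le> q u"
proof -
  have "q (\<lambda>x. u x + (- u x)) \<le> q u + q (\<lambda>x. - u x)"
    by (rule sublinear_add[OF assms neg[OF assms(2)]])
  then show ?thesis using sublinear_zero[OF assms(1)] by simp
qed

text \<open>A minimal sublinear functional is linear: it cannot lie strictly above the sublinear functional
  \<open>v \<mapsto> inf\<^sub>a q (v + a y) - a q y\<close>.\<close>

lemma minimal_sublinear_linear:
  assumes q: "sublinear_on V q"
    and min: "\<And>r. sublinear_on V r \<Longrightarrow> (\<And>v. v \<in> V \<Longrightarrow> r v \<le> q v) \<Longrightarrow> (\<And>v. v \<in> V \<Longrightarrow> r v = q v)"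
    and y: "y \<in> V"
  shows "q (\<lambda>x. - y x) = - q y"
proof -
  note qadd = sublinear_add[OF q] and qsc = sublinear_scale[OF q]
  have qsc0: "q (\<lambda>x. a * u x) = a * q u" if "u \<in> V" "a \<ge> 0" for a u
    using qsc[OF that(1), of a] that sublinear_zero[OF q] by (cases "a = 0") auto
  define g where "g v a = q (\<lambda>x. v x + a * y x) - a * q y" for v a
  define r where "r v = (INF a\<in>{0..}. g v a)" for v
  have inV: "(\<lambda>x. v x + a * y x) \<in> V" if "v \<in> V" for v a
    using that y by (intro add scale)
  \<comment> \<open>The lower bound \<open>- q (- v)\<close> does not depend on \<open>a\<close>, so
    the infimum defining \<open>r\<close> is finite.\<close>
  have lb: "- q (\<lambda>x. - v x) \<le> g v a" if v: "v \<in> V" and a: "a \<ge> 0" for v a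
  proof -
    have "q (\<lambda>x. a * y x) \<le> q (\<lambda>x. v x + a * y x) + q (\<lambda>x. - v x)"
      using qadd[OF inV[OF v, of a] neg[OF v]] by simp
    then show ?thesis using qsc0[OF y a] by (simp add: g_def)
  qed
  have bdd: "bdd_below (g v ` {0..})" if "v \<in> V" for v
    using lb[OF that] by (intro bdd_belowI2[of _ "- q (\<lambda>x. - v x)"]) auto
  have r_le: "r v \<le> g v a" if "v \<in> V" "a \<ge> 0" for v a
    unfolding r_def using bdd[OF that(1)] that(2) by (intro cINF_lower) auto
  have r_ge: "c \<le> r v" if "\<And>a. a \<ge> 0 \<Longrightarrow> c \<le> g v a" for c v
    unfolding r_def using that by (intro cINF_greatest) auto
  have rq: "r v \<le> q v" if "v \<in> V" for v
    using r_le[OF that, of 0] by (simp add: g_def)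
  have "sublinear_on V r"
    unfolding sublinear_on_def
  proof (intro conjI ballI allI impI)
    fix u v assume u: "u \<in> V" and v: "v \<in> V"
    \<comment> \<open>The parameters add up: \<open>a\<close> for \<open>u\<close> and
      \<open>b\<close> for \<open>v\<close> give the competitor \<open>a + b\<close> for the
      sum.\<close>
    have le: "r (\<lambda>x. u x + v x) \<le> g u a + g v b" if "a \<ge> 0" "b \<ge> 0" for a b
    proof -
      have "r (\<lambda>x. u x + v x) \<le> g (\<lambda>x. u x + v x) (a + b)"
        using that u v by (intro r_le add) auto
      also have "\<dots> \<le> g u a + g v b"
        using qadd[OF inV[OF u, of a] inV[OF v, of b]]
        by (simp add: g_def algebra_simps)
      finally show ?thesis .
    qed
    have "r (\<lambda>x. u x + v x) - g u a \<le> r v" if "a \<ge> 0" for a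
      by (rule r_ge) (use le[OF that] in \<open>simp add: algebra_simps\<close>)
    from this have "r (\<lambda>x. u x + v x) - r v \<le> r u"
      by (intro r_ge) (simp add: algebra_simps)
    then show "r (\<lambda>x. u x + v x) \<le> r u + r v" by simp
  next
    fix u and a :: real assume u: "u \<in> V" and a: "a > 0"
    \<comment> \<open>Scaling \<open>u\<close> by \<open>a\<close> rescales the parameter:
      \<open>b\<close> for \<open>a * u\<close> corresponds to \<open>b / a\<close> for
      \<open>u\<close>.\<close>
    have gsc: "g (\<lambda>x. a * u x) b = a * g u (b / a)" for b
    proof -
      have "q (\<lambda>x. a * (u x + b / a * y x)) = a * q (\<lambda>x. u x + b / a * y x)"
        using u a by (intro qsc inV)
      moreover have "(\<lambda>x. a * (u x + b / a * y x)) = (\<lambda>x. a * u x + b * y x)"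
        using a by (auto simp: field_simps)
      ultimately show ?thesis using a by (simp add: g_def field_simps)
    qed
    show "r (\<lambda>x. a * u x) = a * r u"
    proof (rule antisym)
      have "r (\<lambda>x. a * u x) / a \<le> r u"
      proof (rule r_ge)
        fix b :: real assume "b \<ge> 0"
        then show "r (\<lambda>x. a * u x) / a \<le> g u b"
          using r_le[OF scale[OF u], of "a * b" a] a by (simp add: gsc field_simps)
      qed
      then show "r (\<lambda>x. a * u x) \<le> a * r u" using a by (simp add: field_simps)
      show "a * r u \<le> r (\<lambda>x. a * u x)"
        using r_le[OF u] a by (intro r_ge) (auto simp: gsc)
    qed
  qed
  \<comment> \<open>At \<open>- y\<close> the choice \<open>a = 1\<close> gives
    \<open>r (- y) \<le> q 0 - q y = - q y\<close>, while minimality gives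
    \<open>r = q\<close>.\<close>
  from min[OF this rq neg[OF y]] have "r (\<lambda>x. - y x) = q (\<lambda>x. - y x)" by simp
  moreover have "r (\<lambda>x. - y x) \<le> - q y"
    using r_le[OF neg[OF y], of 1] sublinear_zero[OF q] by (simp add: g_def)
  moreover have "- q (\<lambda>x. - y x) \<le> q y" by (rule sublinear_neg[OF q y])
  ultimately show ?thesis by simp
qed

text \<open>A minimal sublinear functional below \<open>p\<close> exists by Zorn's lemma and is odd
  by \<open>minimal_sublinear_linear\<close>; oddness turns subadditivity into additivity. No values
  are prescribed on a subspace: an application encodes what it wants in \<open>p\<close>.\<close>

lemma dominated_linear_functional:
  assumes p: "sublinear_on V p"
  obtains l where "\<And>u v. u \<in> V \<Longrightarrow> v \<in> V \<Longrightarrow> l (\<lambda>x. u x + v x) = l u + l v"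
    and "\<And>u. u \<in> V \<Longrightarrow> l (\<lambda>x. - u x) = - l u"
    and "\<And>u. u \<in> V \<Longrightarrow> l u \<le> (p u :: real)"
proof -
  \<comment> \<open>Extensionality makes the pointwise order on \<open>V\<close> antisymmetric, as
    Zorn's lemma requires.\<close>
  define A where "A = {q \<in> extensional V. sublinear_on V q \<and> (\<forall>v\<in>V. q v \<le> p v)}"
  define P where "P q r \<longleftrightarrow> (\<forall>v\<in>V. r v \<le> q v)" for q r :: "('a \<Rightarrow> real) \<Rightarrow> real"
  have restr: "sublinear_on V (restrict q V)" if "sublinear_on V q" for q
    unfolding sublinear_on_def
  proof (intro conjI ballI allI impI)
    fix u v assume uv: "u \<in> V" "v \<in> V"
    show "restrict q V (\<lambda>x. u x + v x) \<le> restrict q V u + restrict q V v"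
      using sublinear_add[OF that uv] add[OF uv] uv by simp
  next
    fix u and a :: real assume ua: "u \<in> V" "0 < a"
    show "restrict q V (\<lambda>x. a * u x) = a * restrict q V u"
      using sublinear_scale[OF that ua] scale[OF ua(1), of a] ua by simp
  qed
  have "\<exists>m\<in>A. \<forall>a\<in>A. P m a \<longrightarrow> a = m"
  proof (rule predicate_Zorn)
    show "partial_order_on A (relation_of P A)"
      by (auto simp: partial_order_on_def preorder_on_def refl_on_def relation_of_def P_def A_def
          intro!: transI antisymI extensionalityI[of _ V] intro: order_trans antisym)
  next
    fix C assume C: "C \<in> Chains (relation_of P A)"
    show "\<exists>u\<in>A. \<forall>a\<in>C. P a u"
    proof (cases "C = {}")
      case True
      have "restrict p V \<in> A" using restr[OF p] by (simp add: A_def)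
      then show ?thesis using True by auto
    next
      case False
      have CA: "C \<subseteq> A" using C by (auto simp: Chains_def relation_of_def)
      have tot: "P a b \<or> P b a" if "a \<in> C" "b \<in> C" for a b
        using C that by (auto simp: Chains_def relation_of_def)
      define r where "r v = (INF q\<in>C. q v)" for v
      have sub: "sublinear_on V q" "\<And>v. v \<in> V \<Longrightarrow> q v \<le> p v" if "q \<in> C" for q
        using that CA by (auto simp: A_def)
      \<comment> \<open>Every member of the chain satisfies
        \<open>q v \<ge> - q (- v) \<ge> - p (- v)\<close>, so the pointwise infimum is
        finite.\<close>
      have bdd: "bdd_below ((\<lambda>q. q v) ` C)" if "v \<in> V" for v
        using sublinear_neg[OF sub(1) that] sub(2)[OF _ neg[OF that]]
        by (intro bdd_belowI2[of _ "- p (\<lambda>x. - v x)"]) (smt (verit))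
      have r_le: "r v \<le> q v" if "v \<in> V" "q \<in> C" for v q
        unfolding r_def using bdd that by (intro cINF_lower) auto
      have r_ge: "c \<le> r v" if "\<And>q. q \<in> C \<Longrightarrow> c \<le> q v" for c v
        unfolding r_def using that False by (intro cINF_greatest) auto
      have "sublinear_on V r"
        unfolding sublinear_on_def
      proof (intro conjI ballI allI impI)
        fix u v assume u: "u \<in> V" and v: "v \<in> V"
        have le: "r (\<lambda>x. u x + v x) \<le> a u + b v" if ab: "a \<in> C" "b \<in> C" for a b
        proof -
          \<comment> \<open>Of two members of the chain, the smaller one can be used for both
            summands.\<close>
          have "\<exists>q\<in>C. q u \<le> a u \<and> q v \<le> b v"
            using tot[OF ab] ab u v unfolding P_def by (metis order_refl)
          then obtain q where "q \<in> C" "q u \<le> a u" "q v \<le> b v" by blast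
          moreover have "q (\<lambda>x. u x + v x) \<le> q u + q v"
            by (rule sublinear_add[OF sub(1)[OF \<open>q \<in> C\<close>] u v])
          ultimately show ?thesis using r_le[OF add[OF u v] \<open>q \<in> C\<close>] by linarith
        qed
        have "r (\<lambda>x. u x + v x) - a u \<le> r v" if "a \<in> C" for a
          by (rule r_ge) (use le[OF that] in \<open>simp add: algebra_simps\<close>)
        from this have "r (\<lambda>x. u x + v x) - r v \<le> r u"
          by (intro r_ge) (simp add: algebra_simps)
        then show "r (\<lambda>x. u x + v x) \<le> r u + r v" by simp
      next
        fix u and a :: real assume u: "u \<in> V" and a: "a > 0"
        have sc: "q (\<lambda>x. a * u x) = a * q u" if "q \<in> C" for q
          by (rule sublinear_scale[OF sub(1)[OF that] u a])
        show "r (\<lambda>x. a * u x) = a * r u"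
        proof (rule antisym)
          have "r (\<lambda>x. a * u x) / a \<le> r u"
          proof (rule r_ge)
            fix q assume "q \<in> C"
            then show "r (\<lambda>x. a * u x) / a \<le> q u"
              using r_le[OF scale[OF u], of q a] a by (simp add: sc field_simps)
          qed
          then show "r (\<lambda>x. a * u x) \<le> a * r u" using a by (simp add: field_simps)
          show "a * r u \<le> r (\<lambda>x. a * u x)"
            using r_le[OF u] a by (intro r_ge) (auto simp: sc)
        qed
      qed
      moreover have "r v \<le> p v" if "v \<in> V" for v
        using False r_le[OF that] sub(2)[OF _ that] by (meson all_not_in_conv order_trans)
      ultimately have "restrict r V \<in> A" using restr by (simp add: A_def)
      moreover have "P a (restrict r V)" if "a \<in> C" for a
        using r_le that by (auto simp: P_def)
      ultimately show ?thesis by blast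
    qed
  qed
  then obtain l where l: "l \<in> A" and lmin: "\<And>a. a \<in> A \<Longrightarrow> P l a \<Longrightarrow> a = l" by blast
  have lsub: "sublinear_on V l" and lp: "\<And>v. v \<in> V \<Longrightarrow> l v \<le> p v" using l by (auto simp: A_def)
  have min: "r v = l v" if r: "sublinear_on V r" "\<And>v. v \<in> V \<Longrightarrow> r v \<le> l v" and v: "v \<in> V" for r v
  proof -
    have "restrict r V \<in> A" using restr[OF r(1)] r(2) lp by (fastforce simp: A_def)
    moreover have "P l (restrict r V)" using r(2) by (simp add: P_def)
    ultimately have "restrict r V = l" by (rule lmin)
    then show ?thesis using v by auto
  qed
  have lneg: "l (\<lambda>x. - u x) = - l u" if "u \<in> V" for u
    using minimal_sublinear_linear[OF lsub _ that] min by blast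
  have "l (\<lambda>x. u x + v x) = l u + l v" if u: "u \<in> V" and v: "v \<in> V" for u v
  proof (rule antisym)
    show "l (\<lambda>x. u x + v x) \<le> l u + l v" by (rule sublinear_add[OF lsub u v])
    \<comment> \<open>The reverse inequality is subadditivity at \<open>- u\<close> and
      \<open>- v\<close>.\<close>
    have "l (\<lambda>x. - u x + - v x) \<le> l (\<lambda>x. - u x) + l (\<lambda>x. - v x)"
      by (rule sublinear_add[OF lsub neg[OF u] neg[OF v]])
    moreover have "l (\<lambda>x. - u x + - v x) = - l (\<lambda>x. u x + v x)"
      using lneg[OF add[OF u v]] by (simp add: add.commute)
    ultimately show "l u + l v \<le> l (\<lambda>x. u x + v x)" using lneg u v by simp
  qed
  then show thesis using that lneg lp by blast
qed

end

section \<open>Seminormed complex vector spaces and their quotients\<close>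

lemma complex_field_simps [simp]:
  "carrier complex_field = UNIV" "\<zero>\<^bsub>complex_field\<^esub> = 0" "\<one>\<^bsub>complex_field\<^esub> = 1"
  "a \<oplus>\<^bsub>complex_field\<^esub> b = a + b" "a \<otimes>\<^bsub>complex_field\<^esub> b = a * b"
  by (simp_all add: complex_field_def)

lemma cring_complex_field: "cring complex_field"
proof (rule cringI)
  show "abelian_group complex_field"
    by (rule abelian_groupI) (auto intro: exI[of _ "- x" for x])
  show "comm_monoid complex_field"
    by (rule comm_monoidI) auto
qed (auto simp: algebra_simps)

lemma mk_nspace_simps [simp]:
  "carrier (mk_nspace A z pl sm n) = A" "\<zero>\<^bsub>mk_nspace A z pl sm n\<^esub> = z"
  "x \<oplus>\<^bsub>mk_nspace A z pl sm n\<^esub> y = pl x y" "a \<odot>\<^bsub>mk_nspace A z pl sm n\<^esub> x = sm a x"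
  "nrm (mk_nspace A z pl sm n) = n"
  by (simp_all add: mk_nspace_def)

lemma ordered_by_simps [simp]:
  "carrier (ordered_by E R C) = carrier E" "\<zero>\<^bsub>ordered_by E R C\<^esub> = \<zero>\<^bsub>E\<^esub>"
  "x \<oplus>\<^bsub>ordered_by E R C\<^esub> y = x \<oplus>\<^bsub>E\<^esub> y" "a \<odot>\<^bsub>ordered_by E R C\<^esub> x = a \<odot>\<^bsub>E\<^esub> x"
  "nrm (ordered_by E R C) = nrm E" "real_part (ordered_by E R C) = R"
  "x \<preceq>\<^bsub>ordered_by E R C\<^esub> y \<longleftrightarrow> x \<in> R \<and> y \<in> R \<and> y \<ominus>\<^bsub>E\<^esub> x \<in> C"
  by (simp_all add: ordered_by_def nspace.defs onspace.defs)



lemma ordered_by_minus [simp]: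
  "\<ominus>\<^bsub>ordered_by E R C\<^esub> x = \<ominus>\<^bsub>E\<^esub> x" "x \<ominus>\<^bsub>ordered_by E R C\<^esub> y = x \<ominus>\<^bsub>E\<^esub> y"
  by (simp_all add: a_inv_def a_minus_def m_inv_def)

text \<open>Additive inverses come from the scalar -1, since
  \<open>(- 1 + 1) \<odot> x = 0 \<odot> x\<close>; the premise \<open>null\<close> takes the place
  of an axiom about inverses.\<close>

lemma complex_moduleI:
  fixes X (structure)
  assumes "\<And>x y. x \<in> carrier X \<Longrightarrow> y \<in> carrier X \<Longrightarrow> x \<oplus> y \<in> carrier X"
    and "\<And>x y z. x \<in> carrier X \<Longrightarrow> y \<in> carrier X \<Longrightarrow> z \<in> carrier X \<Longrightarrow> x \<oplus> y \<oplus> z = x \<oplus> (y \<oplus> z)"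
    and "\<And>x y. x \<in> carrier X \<Longrightarrow> y \<in> carrier X \<Longrightarrow> x \<oplus> y = y \<oplus> x"
    and "\<zero> \<in> carrier X"
    and zero: "\<And>x. x \<in> carrier X \<Longrightarrow> \<zero> \<oplus> x = x"
    and smult_closed: "\<And>a x. x \<in> carrier X \<Longrightarrow> a \<odot> x \<in> carrier X"
    and smult_l: "\<And>a b x. x \<in> carrier X \<Longrightarrow> (a + b) \<odot> x = a \<odot> x \<oplus> b \<odot> x"
    and "\<And>a x y. x \<in> carrier X \<Longrightarrow> y \<in> carrier X \<Longrightarrow> a \<odot> (x \<oplus> y) = a \<odot> x \<oplus> a \<odot> y"
    and "\<And>a b x. x \<in> carrier X \<Longrightarrow> (a * b) \<odot> x = a \<odot> (b \<odot> x)"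
    and one: "\<And>x. x \<in> carrier X \<Longrightarrow> 1 \<odot> x = x"
    and null: "\<And>x. x \<in> carrier X \<Longrightarrow> 0 \<odot> x = \<zero>"
  shows "Module.module complex_field X"
proof (rule moduleI[OF cring_complex_field])
  have "\<exists>y\<in>carrier X. y \<oplus> x = \<zero>" if "x \<in> carrier X" for x
    using smult_l[OF that, of "-1" 1] one[OF that] null[OF that] smult_closed[OF that, of "-1"] by auto
  then show "abelian_group X"
    by (intro abelian_groupI assms)
qed (use assms in simp_all)

text \<open>The seminorm is a parameter separate from the field \<open>nrm\<close>, because on
  bounded families the recorded norm is the supremum while the quotient is governed by the limit
  along the ultrafilter.\<close>

locale complex_seminormed_module = Module.module complex_field X
  for X :: "(complex, 'v, 'm) module_scheme" (structure) and \<nu> :: "'v \<Rightarrow> real" +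
  assumes seminorm_add: "\<lbrakk>x \<in> carrier X; y \<in> carrier X\<rbrakk> \<Longrightarrow> \<nu> (x \<oplus> y) \<le> \<nu> x + \<nu> y"
    and seminorm_smult: "x \<in> carrier X \<Longrightarrow> \<nu> (a \<odot> x) = cmod a * \<nu> x"
begin

lemma scale_closed [simp, intro]: "x \<in> carrier X \<Longrightarrow> a \<odot> x \<in> carrier X"
  by (rule smult_closed) simp_all

lemma scale_add_left: "x \<in> carrier X \<Longrightarrow> (a + b) \<odot> x = a \<odot> x \<oplus> b \<odot> x"
  using smult_l_distr[of a b x] by simp

lemma scale_add_right:
  "\<lbrakk>x \<in> carrier X; y \<in> carrier X\<rbrakk> \<Longrightarrow> a \<odot> (x \<oplus> y) = a \<odot> x \<oplus> a \<odot> y"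
  using smult_r_distr[of a x y] by simp

lemma scale_scale: "x \<in> carrier X \<Longrightarrow> a \<odot> (b \<odot> x) = (a * b) \<odot> x"
  using smult_assoc1[of a b x] by simp

lemma scale_one [simp]: "x \<in> carrier X \<Longrightarrow> 1 \<odot> x = x"
  using smult_one[of x] by simp

lemma scale_zero [simp]: "x \<in> carrier X \<Longrightarrow> 0 \<odot> x = \<zero>"
  using smult_l_null[of x] by simp

lemma scale_null [simp]: "a \<odot> \<zero> = \<zero>"
  using smult_r_null[of a] by simp

lemma scale_uminus: "x \<in> carrier X \<Longrightarrow> (- a) \<odot> x = \<ominus> (a \<odot> x)"
  by (metis M.add.inv_equality M.a_comm add.right_inverse scale_add_left scale_closed scale_zero)

lemma uminus_eq_scale: "x \<in> carrier X \<Longrightarrow> \<ominus> x = (- 1) \<odot> x"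
  by (simp add: scale_uminus)

lemma scale_minus_right:
  "\<lbrakk>x \<in> carrier X; y \<in> carrier X\<rbrakk> \<Longrightarrow> a \<odot> (x \<ominus> y) = a \<odot> x \<ominus> a \<odot> y"
  by (simp add: a_minus_def uminus_eq_scale scale_add_right scale_scale mult.commute)

lemma scale_minus_left: "x \<in> carrier X \<Longrightarrow> (a - b) \<odot> x = a \<odot> x \<ominus> b \<odot> x"
  using scale_add_left[of x a "- b"] by (simp add: a_minus_def scale_uminus)

lemma seminorm_zero [simp]: "\<nu> \<zero> = 0"
  using seminorm_smult[of \<zero> 0] by simp

lemma seminorm_uminus [simp]: "x \<in> carrier X \<Longrightarrow> \<nu> (\<ominus> x) = \<nu> x"
  by (simp add: uminus_eq_scale seminorm_smult)

lemma seminorm_nonneg [simp]: "x \<in> carrier X \<Longrightarrow> 0 \<le> \<nu> x"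
  using seminorm_add[of x "\<ominus> x"] by (simp add: M.r_neg)

lemma seminorm_minus_le: "\<lbrakk>x \<in> carrier X; y \<in> carrier X\<rbrakk> \<Longrightarrow> \<nu> (x \<ominus> y) \<le> \<nu> x + \<nu> y"
  using seminorm_add[of x "\<ominus> y"] by (simp add: a_minus_def)

lemma seminorm_minus_commute: "\<lbrakk>x \<in> carrier X; y \<in> carrier X\<rbrakk> \<Longrightarrow> \<nu> (x \<ominus> y) = \<nu> (y \<ominus> x)"
  using seminorm_uminus[of "x \<ominus> y"] by (simp add: a_minus_def M.minus_add M.a_comm)

lemma minus_trans:
  "\<lbrakk>x \<in> carrier X; y \<in> carrier X; z \<in> carrier X\<rbrakk> \<Longrightarrow> (x \<ominus> y) \<oplus> (y \<ominus> z) = x \<ominus> z"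
  by (simp add: a_minus_def M.a_assoc M.r_neg1 M.r_neg2)

lemma seminorm_triangle:
  "\<lbrakk>x \<in> carrier X; y \<in> carrier X; z \<in> carrier X\<rbrakk> \<Longrightarrow> \<nu> (x \<ominus> z) \<le> \<nu> (x \<ominus> y) + \<nu> (y \<ominus> z)"
  using seminorm_add[of "x \<ominus> y" "y \<ominus> z"] by (simp add: minus_trans)

lemma minus_zero_right [simp]: "x \<in> carrier X \<Longrightarrow> x \<ominus> \<zero> = x"
  by (simp add: a_minus_def)

lemma minus_add_cancel: "\<lbrakk>x \<in> carrier X; y \<in> carrier X\<rbrakk> \<Longrightarrow> (x \<ominus> y) \<oplus> y = x"
  by (simp add: a_minus_def M.a_assoc M.l_neg)

lemma seminorm_le_add: "\<lbrakk>x \<in> carrier X; y \<in> carrier X\<rbrakk> \<Longrightarrow> \<nu> x \<le> \<nu> y + \<nu> (x \<ominus> y)"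
  using seminorm_add[of "x \<ominus> y" y] by (simp add: minus_add_cancel)

lemma seminorm_diff_le: "\<lbrakk>x \<in> carrier X; y \<in> carrier X\<rbrakk> \<Longrightarrow> \<bar>\<nu> x - \<nu> y\<bar> \<le> \<nu> (x \<ominus> y)"
  using seminorm_le_add[of x y] seminorm_le_add[of y x] seminorm_minus_commute[of x y] by simp

lemma add_minus_add:
  "\<lbrakk>x \<in> carrier X; y \<in> carrier X; x' \<in> carrier X; y' \<in> carrier X\<rbrakk> \<Longrightarrow>
    (x \<oplus> y) \<ominus> (x' \<oplus> y') = (x \<ominus> x') \<oplus> (y \<ominus> y')"
  by (simp add: a_minus_def M.minus_add M.a_ac)

lemma add_add_minus: "\<lbrakk>x \<in> carrier X; y \<in> carrier X\<rbrakk> \<Longrightarrow> (x \<oplus> y) \<oplus> (x \<ominus> y) = x \<oplus> x"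
  by (simp add: a_minus_def M.a_assoc M.a_lcomm[of y x] M.r_neg)

lemma add_minus_minus:
  assumes "x \<in> carrier X" "y \<in> carrier X"
  shows "(x \<oplus> y) \<ominus> (x \<ominus> y) = y \<oplus> y"
  using add_minus_add[of x y x "\<ominus> y"] assms by (simp add: a_minus_def M.r_neg)

lemma seminorm_null_diff:
  assumes "x \<in> carrier X" "y \<in> carrier X" "\<nu> (x \<ominus> y) = 0"
  shows "\<nu> x = \<nu> y"
  using seminorm_diff_le[OF assms(1,2)] assms(3) by simp

section \<open>Cosets of the kernel of a seminorm\<close>

definition null :: "'v set" where "null = {x \<in> carrier X. \<nu> x = 0}"

lemma null_abelian_subgroup: "abelian_subgroup null X"
proof (rule abelian_subgroupI3[OF additive_subgroupI M.abelian_group_axioms])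
  show "subgroup null (add_monoid X)"
  proof (rule M.add.subgroupI)
    fix x y assume "x \<in> null" "y \<in> null"
    then show "x \<oplus> y \<in> null" using seminorm_add[of x y]
      by (auto simp: null_def intro: antisym)
  qed (auto simp: null_def intro: exI[of _ \<zero>])
qed

abbreviation cls :: "'v \<Rightarrow> 'v set" where "cls x \<equiv> null +> x"

lemma mem_cls: "x \<in> carrier X \<Longrightarrow> y \<in> cls x \<longleftrightarrow> y \<in> carrier X \<and> \<nu> (y \<ominus> x) = 0"
  using abelian_subgroup.a_rcos_module[OF null_abelian_subgroup, of x y]
    abelian_subgroup.a_elemrcos_carrier[OF null_abelian_subgroup, of x y]
  by (auto simp: null_def a_minus_def)

lemma cls_eq_iff:
  assumes "x \<in> carrier X" "y \<in> carrier X"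
  shows "cls x = cls y \<longleftrightarrow> \<nu> (x \<ominus> y) = 0"
proof
  assume "cls x = cls y"
  then show "\<nu> (x \<ominus> y) = 0" using assms by (metis M.r_neg a_minus_def mem_cls seminorm_zero)
next
  assume 0: "\<nu> (x \<ominus> y) = 0"
  have "\<nu> (z \<ominus> x) = 0 \<longleftrightarrow> \<nu> (z \<ominus> y) = 0" if "z \<in> carrier X" for z
    using seminorm_triangle[of z x y] seminorm_triangle[of z y x] 0
      seminorm_nonneg[of "z \<ominus> x"] seminorm_nonneg[of "z \<ominus> y"] seminorm_minus_commute[of x y] assms that
    by auto
  then show "cls x = cls y" using assms by (auto simp: mem_cls)
qed

lemma cls_self: "x \<in> carrier X \<Longrightarrow> x \<in> cls x"
  by (simp add: mem_cls M.r_neg a_minus_def)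

lemma cls_cong: "\<lbrakk>x \<in> carrier X; y \<in> cls x\<rbrakk> \<Longrightarrow> cls y = cls x"
  by (simp add: mem_cls cls_eq_iff)

lemma cls_zero: "cls \<zero> = null"
  using mem_cls[of \<zero>] by (auto simp: null_def a_minus_def)

lemma cls_add:
  "\<lbrakk>x \<in> carrier X; y \<in> carrier X\<rbrakk> \<Longrightarrow> cls x <+>\<^bsub>X\<^esub> cls y = cls (x \<oplus> y)"
  by (rule abelian_subgroup.a_rcos_sum[OF null_abelian_subgroup])

lemma cls_scale:
  assumes x: "x \<in> carrier X"
  shows "null <+>\<^bsub>X\<^esub> ((\<lambda>y. a \<odot> y) ` cls x) = cls (a \<odot> x)"
proof (intro subset_antisym subsetI)
  fix z assume "z \<in> null <+>\<^bsub>X\<^esub> ((\<lambda>y. a \<odot> y) ` cls x)"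
  then obtain n y where n: "n \<in> null" and y: "y \<in> cls x" and z: "z = n \<oplus> a \<odot> y"
    by (auto simp: set_add_def')
  have yc: "y \<in> carrier X" "\<nu> (y \<ominus> x) = 0" using y x by (simp_all add: mem_cls)
  have nc: "n \<in> carrier X" "\<nu> n = 0" using n by (auto simp: null_def)
  have "z \<ominus> a \<odot> x = n \<oplus> a \<odot> (y \<ominus> x)"
    using x yc nc unfolding z scale_minus_right[OF yc(1) x] by (simp add: a_minus_def M.a_assoc)
  then have "\<nu> (z \<ominus> a \<odot> x) \<le> 0"
    using seminorm_add[of n "a \<odot> (y \<ominus> x)"] seminorm_smult[of "y \<ominus> x" a] x yc nc by simp
  moreover have zc: "z \<in> carrier X" using nc yc by (simp add: z)
  ultimately have "\<nu> (z \<ominus> a \<odot> x) = 0"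
    by (intro antisym seminorm_nonneg M.minus_closed scale_closed x)
  then show "z \<in> cls (a \<odot> x)" using zc x by (simp add: mem_cls)
next
  fix z assume "z \<in> cls (a \<odot> x)"
  then have zc: "z \<in> carrier X" "\<nu> (z \<ominus> a \<odot> x) = 0" using x by (auto simp: mem_cls)
  then have "z = (z \<ominus> a \<odot> x) \<oplus> a \<odot> x" using x by (simp add: minus_add_cancel)
  \<comment> \<open>The error is itself null, so the summand from \<open>null\<close> absorbs it.
    This covers \<open>a = 0\<close>, where the image of the coset is a single point.\<close>
  moreover have "z \<ominus> a \<odot> x \<in> null" using zc x by (simp add: null_def)
  ultimately show "z \<in> null <+>\<^bsub>X\<^esub> ((\<lambda>y. a \<odot> y) ` cls x)"
    unfolding set_add_def' using cls_self[OF x] by blast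
qed

end

lemma complex_normed_spaceI:
  assumes "complex_seminormed_module X (nrm X)"
    and "\<And>x. x \<in> carrier X \<Longrightarrow> nrm X x = 0 \<Longrightarrow> x = \<zero>\<^bsub>X\<^esub>"
  shows "complex_normed_space X"
proof -
  interpret complex_seminormed_module X "nrm X" by fact
  show ?thesis
    by unfold_locales (use assms(2) seminorm_add seminorm_smult in auto)
qed

sublocale complex_normed_space \<subseteq> complex_seminormed_module X "nrm X"
  by unfold_locales (auto simp: nrm_add nrm_smult)

text \<open>The norm of \<open>quotient_space\<close> is an infimum of \<open>nrm X\<close> over a
  coset; \<open>INF_nrm\<close> identifies it with \<open>\<nu>\<close>, after which the laws of the
  quotient are those of the seminorm. The instances are Lp, where the infimum is over equal numbers,
  and bounded families, where it is not.\<close>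

locale seminorm_quotient = complex_seminormed_module X \<nu>
  for X :: "('v, 'm) nspace_scheme" (structure) and \<nu> :: "'v \<Rightarrow> real" +
  assumes INF_nrm: "x \<in> carrier X \<Longrightarrow> (INF y\<in>null +> x. nrm X y) = \<nu> x"
begin

abbreviation Q :: "'v set nspace" where "Q \<equiv> quotient_space X null"

lemma quotient_carrier: "carrier Q = cls ` carrier X"
  by (auto simp: quotient_space_def A_RCOSETS_def' )

lemma quotient_carrierE:
  assumes "A \<in> carrier Q" obtains x where "x \<in> carrier X" "A = cls x"
  using assms by (auto simp: quotient_carrier)

lemma quotient_simps:
  "\<zero>\<^bsub>Q\<^esub> = cls \<zero>"
  "\<lbrakk>x \<in> carrier X; y \<in> carrier X\<rbrakk> \<Longrightarrow> cls x \<oplus>\<^bsub>Q\<^esub> cls y = cls (x \<oplus> y)"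
  "x \<in> carrier X \<Longrightarrow> a \<odot>\<^bsub>Q\<^esub> cls x = cls (a \<odot> x)"
  "x \<in> carrier X \<Longrightarrow> nrm Q (cls x) = \<nu> x"
  "x \<in> carrier X \<Longrightarrow> cls x \<in> carrier Q"
  by (simp_all add: cls_add cls_scale INF_nrm cls_zero quotient_carrier) (simp_all add: quotient_space_def cls_add cls_scale INF_nrm cls_zero)

lemma quotient_normed: "complex_normed_space Q"
proof (rule complex_normed_spaceI)
  have "Module.module complex_field Q"
    by (rule complex_moduleI)
      (auto elim!: quotient_carrierE simp: quotient_simps M.a_ac scale_add_left scale_add_right scale_scale)
  then show "complex_seminormed_module Q (nrm Q)"
    unfolding complex_seminormed_module_def complex_seminormed_module_axioms_def
    by (auto elim!: quotient_carrierE simp: quotient_simps seminorm_add seminorm_smult)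
next
  fix A assume "A \<in> carrier Q" "nrm Q A = 0"
  then show "A = \<zero>\<^bsub>Q\<^esub>"
    by (elim quotient_carrierE) (simp add: quotient_simps cls_eq_iff)
qed

lemma quotient_minus:
  assumes "x \<in> carrier X" "y \<in> carrier X"
  shows "\<ominus>\<^bsub>Q\<^esub> cls x = cls (\<ominus> x)" "cls x \<ominus>\<^bsub>Q\<^esub> cls y = cls (x \<ominus> y)"
proof -
  interpret Q: complex_normed_space Q by (rule quotient_normed)
  have *: "\<ominus>\<^bsub>Q\<^esub> cls x = cls (\<ominus> x)" if "x \<in> carrier X" for x
    using that by (simp add: Q.uminus_eq_scale uminus_eq_scale quotient_simps)
  then show "\<ominus>\<^bsub>Q\<^esub> cls x = cls (\<ominus> x)" using assms by simp
  show "cls x \<ominus>\<^bsub>Q\<^esub> cls y = cls (x \<ominus> y)"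
    using assms by (simp add: a_minus_def * quotient_simps)
qed

end

section \<open>Metric notions in normed spaces\<close>

lemma (in complex_normed_space) Metric_space_ndist: "Metric_space (carrier X) (ndist X)"
proof
  fix x y z assume "x \<in> carrier X" "y \<in> carrier X" "z \<in> carrier X"
  then show "ndist X x z \<le> ndist X x y + ndist X y z"
    by (simp add: ndist_def seminorm_triangle)
next
  fix x y assume xy: "x \<in> carrier X" "y \<in> carrier X"
  have "x \<ominus> y = \<zero> \<longleftrightarrow> x = y"
    using xy by (metis M.r_neg M.minus_equality M.minus_minus M.a_inv_closed a_minus_def)
  then show "ndist X x y = 0 \<longleftrightarrow> x = y"
    using xy by (simp add: ndist_def nrm_eq_0_iff)
qed (auto simp: ndist_def seminorm_minus_commute)

lemma (in complex_normed_space) closedin_ntopologyI: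
  assumes "S \<subseteq> carrier X"
    and "\<And>\<sigma> l. (\<And>n. \<sigma> n \<in> S) \<Longrightarrow> l \<in> carrier X \<Longrightarrow> (\<lambda>n. nrm X (\<sigma> n \<ominus> l)) \<longlonglongrightarrow> 0 \<Longrightarrow> l \<in> S"
  shows "closedin (ntopology X) S"
proof -
  interpret Metric_space "carrier X" "ndist X" by (rule Metric_space_ndist)
  show ?thesis
    unfolding ntopology_def metric_closedin_iff_sequentially_closed
  proof (intro conjI allI impI)
    fix \<sigma> l assume *: "range \<sigma> \<subseteq> S \<and> limitin mtopology \<sigma> l sequentially"
    then have l: "l \<in> carrier X" "(\<lambda>n. ndist X (\<sigma> n) l) \<longlonglongrightarrow> 0"
      by (simp_all add: limitin_metric_dist_null)
    have S: "\<sigma> n \<in> S" for n using * by blast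
    have "(\<lambda>n. ndist X (\<sigma> n) l) = (\<lambda>n. nrm X (\<sigma> n \<ominus> l))"
      using S l(1) assms(1) by (intro ext) (simp add: ndist_def subset_iff)
    then show "l \<in> S" using S l by (intro assms(2)[of \<sigma> l]) simp_all
  qed (fact assms(1))
qed

lemma (in complex_normed_space) mcompleteI:
  assumes "\<And>\<sigma>. (\<And>n. \<sigma> n \<in> carrier X) \<Longrightarrow>
      (\<And>\<epsilon>. 0 < \<epsilon> \<Longrightarrow> \<exists>N. \<forall>m\<ge>N. \<forall>n\<ge>N. nrm X (\<sigma> m \<ominus> \<sigma> n) < \<epsilon>) \<Longrightarrow>
      \<exists>l\<in>carrier X. (\<lambda>n. nrm X (\<sigma> n \<ominus> l)) \<longlonglongrightarrow> 0"
  shows "Metric_space.mcomplete (carrier X) (ndist X)"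
proof -
  interpret Metric_space "carrier X" "ndist X" by (rule Metric_space_ndist)
  show ?thesis
    unfolding mcomplete_def
  proof (intro allI impI)
    fix \<sigma> assume C: "MCauchy \<sigma>"
    have c: "\<sigma> n \<in> carrier X" for n using C by (auto simp: MCauchy_def)
    have "\<exists>N. \<forall>m\<ge>N. \<forall>n\<ge>N. nrm X (\<sigma> m \<ominus> \<sigma> n) < \<epsilon>" if "0 < \<epsilon>" for \<epsilon>
      using C that c unfolding MCauchy_def ndist_def by simp
    then obtain l where l: "l \<in> carrier X" "(\<lambda>n. nrm X (\<sigma> n \<ominus> l)) \<longlonglongrightarrow> 0"
      using assms[of \<sigma>] c by blast
    then have "limitin mtopology \<sigma> l sequentially"
      using c by (simp add: limitin_metric_dist_null ndist_def)
    then show "\<exists>l. limitin mtopology \<sigma> l sequentially" ..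
  qed
qed

lemma (in complex_normed_space) continuous_map_ntopology_iff:
  fixes f :: "'t::topological_space \<Rightarrow> 'v"
  assumes "\<And>t. f t \<in> carrier X"
  shows "continuous_map euclidean (ntopology X) f \<longleftrightarrow>
    (\<forall>t. \<forall>\<epsilon>>0. \<forall>\<^sub>F s in nhds t. nrm X (f s \<ominus> f t) < \<epsilon>)"
proof -
  interpret Metric_space "carrier X" "ndist X" by (rule Metric_space_ndist)
  show ?thesis
    unfolding ntopology_def continuous_map_to_metric eventually_nhds
    using assms by (simp add: ndist_def seminorm_minus_commute)
qed

section \<open>Bounded operators\<close>

lemma bounded_opD:
  assumes "bounded_op X Y T"
  shows "x \<in> carrier X \<Longrightarrow> T x \<in> carrier Y"
    and "\<lbrakk>x \<in> carrier X; y \<in> carrier X\<rbrakk> \<Longrightarrow> T (x \<oplus>\<^bsub>X\<^esub> y) = T x \<oplus>\<^bsub>Y\<^esub> T y"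
    and "x \<in> carrier X \<Longrightarrow> T (a \<odot>\<^bsub>X\<^esub> x) = a \<odot>\<^bsub>Y\<^esub> T x"
  using assms by (auto simp: bounded_op_def)

context complex_normed_space begin

text \<open>\<open>Y\<close> is represented by homogeneity of its norm, so that the scalar field
  \<open>complex_space\<close> can be inserted without first being shown to be a normed
  space.\<close>

lemma op_norm_bound:
  assumes T: "bounded_op X Y T"
    and Y: "\<And>a y. y \<in> carrier Y \<Longrightarrow> nrm Y (a \<odot>\<^bsub>Y\<^esub> y) = cmod a * nrm Y y"
    and x: "x \<in> carrier X"
  shows "nrm Y (T x) \<le> op_norm X Y T * nrm X x"
proof -
  obtain K where K: "\<And>x. x \<in> carrier X \<Longrightarrow> nrm Y (T x) \<le> K * nrm X x"
    using T unfolding bounded_op_def by blast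
  have bdd: "bdd_above ((\<lambda>x. nrm Y (T x)) ` {x \<in> carrier X. nrm X x \<le> 1})"
  proof (rule bdd_aboveI2)
    fix x assume x: "x \<in> {x \<in> carrier X. nrm X x \<le> 1}"
    then have "nrm Y (T x) \<le> \<bar>K\<bar> * nrm X x"
      using K[of x] by (smt (verit) mem_Collect_eq mult_right_mono seminorm_nonneg)
    also have "\<dots> \<le> \<bar>K\<bar>" using x by (simp add: mult_left_le)
    finally show "nrm Y (T x) \<le> \<bar>K\<bar>" .
  qed
  show ?thesis
  proof (cases "nrm X x = 0")
    case True
    \<comment> \<open>A vector of norm 0 cannot be normalised; there the bound by \<open>K\<close>
      already gives the claim.\<close>
    then show ?thesis using K[OF x] by simp
  next
    case False
    then have pos: "nrm X x > 0" using seminorm_nonneg[OF x] by simp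
    define u where "u = complex_of_real (1 / nrm X x) \<odot> x"
    have u: "u \<in> carrier X" "nrm X u \<le> 1" using x pos by (simp_all add: u_def nrm_smult norm_divide)
    have "nrm Y (T u) \<le> op_norm X Y T"
      unfolding op_norm_def using bdd u by (intro cSUP_upper) auto
    moreover have "nrm Y (T u) = nrm Y (T x) / nrm X x"
      using x pos bounded_opD[OF T] Y by (simp add: u_def norm_divide)
    ultimately show ?thesis using pos by (simp add: field_simps)
  qed
qed

lemma op_norm_le:
  assumes "\<And>x. x \<in> carrier X \<Longrightarrow> nrm Y (T x) \<le> K * nrm X x" "0 \<le> K"
  shows "op_norm X Y T \<le> K"
  unfolding op_norm_def
proof (rule cSUP_least)
  have "\<zero> \<in> {x \<in> carrier X. nrm X x \<le> 1}" by simp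
  then show "{x \<in> carrier X. nrm X x \<le> 1} \<noteq> {}" by blast
  fix x assume "x \<in> {x \<in> carrier X. nrm X x \<le> 1}"
  then show "nrm Y (T x) \<le> K" using assms(1)[of x] assms(2)
    by (smt (verit, best) mem_Collect_eq mult_left_le)
qed

lemma op_norm_nonneg:
  assumes "bounded_op X Y T" "\<And>a y. y \<in> carrier Y \<Longrightarrow> nrm Y (a \<odot>\<^bsub>Y\<^esub> y) = cmod a * nrm Y y"
    and "\<And>y. y \<in> carrier Y \<Longrightarrow> 0 \<le> nrm Y y"
  shows "0 \<le> op_norm X Y T"
proof -
  obtain K where K: "\<And>x. x \<in> carrier X \<Longrightarrow> nrm Y (T x) \<le> K * nrm X x"
    using assms(1) unfolding bounded_op_def by blast
  have "\<zero> \<in> {x \<in> carrier X. nrm X x \<le> 1}" by simp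
  moreover have "bdd_above ((\<lambda>x. nrm Y (T x)) ` {x \<in> carrier X. nrm X x \<le> 1})"
  proof (rule bdd_aboveI2)
    fix x assume x: "x \<in> {x \<in> carrier X. nrm X x \<le> 1}"
    then have "nrm Y (T x) \<le> \<bar>K\<bar> * nrm X x"
      using K[of x] by (smt (verit) mem_Collect_eq mult_right_mono seminorm_nonneg)
    also have "\<dots> \<le> \<bar>K\<bar>" using x by (simp add: mult_left_le)
    finally show "nrm Y (T x) \<le> \<bar>K\<bar>" .
  qed
  ultimately have "nrm Y (T \<zero>) \<le> op_norm X Y T"
    unfolding op_norm_def by (intro cSUP_upper)
  then show ?thesis using assms(3)[OF bounded_opD(1)[OF assms(1)], of \<zero>] by simp
qed

end

section \<open>Normed spaces with a cone\<close>

lemma ordered_by_normed: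
  assumes "complex_normed_space E"
  shows "complex_normed_space (ordered_by E R C)"
proof -
  interpret complex_normed_space E by fact
  have "Module.module complex_field (ordered_by E R C)"
    by (rule complex_moduleI) (auto simp: M.a_ac scale_add_left scale_add_right scale_scale)
  then have "complex_seminormed_module (ordered_by E R C) (nrm (ordered_by E R C))"
    unfolding complex_seminormed_module_def complex_seminormed_module_axioms_def
    by (auto simp: seminorm_add seminorm_smult)
  then show ?thesis by (rule complex_normed_spaceI) (simp add: nrm_eq_0_iff)
qed

lemma pos_cone_ordered_by:
  assumes "complex_normed_space E" "C \<subseteq> R" "R \<subseteq> carrier E" "\<zero>\<^bsub>E\<^esub> \<in> R"
  shows "pos_cone (ordered_by E R C) = C"
proof -
  interpret complex_normed_space E by fact
  show ?thesis using assms(2-) by (auto simp: pos_cone_def subset_iff)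
qed

text \<open>The part of a Riesz-normed space that passes to Lp and to ultraproducts value by value.
  \<open>cone_monotone\<close> is absolute monotonicity in terms of the cone: apply it to
  \<open>y \<oplus> x\<close> and \<open>y \<ominus> x\<close>. Completeness, closedness and
  domination are kept apart because they call for approximation.\<close>

locale cone_normed_space = complex_normed_space X
  for X :: "('v, 'm) onspace_scheme" (structure) +
  assumes real_subset: "real_part X \<subseteq> carrier X"
    and real_zero: "\<zero> \<in> real_part X"
    and real_add: "\<lbrakk>x \<in> real_part X; y \<in> real_part X\<rbrakk> \<Longrightarrow> x \<oplus> y \<in> real_part X"
    and real_scale: "x \<in> real_part X \<Longrightarrow> complex_of_real a \<odot> x \<in> real_part X"
    and real_decomposition:
      "x \<in> carrier X \<Longrightarrow> \<exists>u\<in>real_part X. \<exists>v\<in>real_part X. x = u \<oplus> \<i> \<odot> v"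
    and real_nrm: "\<lbrakk>u \<in> real_part X; v \<in> real_part X\<rbrakk> \<Longrightarrow>
      max (nrm X u) (nrm X v) \<le> nrm X (u \<oplus> \<i> \<odot> v)"
    and cone_zero: "\<zero> \<in> pos_cone X"
    and cone_add: "\<lbrakk>x \<in> pos_cone X; y \<in> pos_cone X\<rbrakk> \<Longrightarrow> x \<oplus> y \<in> pos_cone X"
    and cone_scale: "\<lbrakk>x \<in> pos_cone X; 0 \<le> a\<rbrakk> \<Longrightarrow> complex_of_real a \<odot> x \<in> pos_cone X"
    and cone_monotone: "\<lbrakk>x \<in> pos_cone X; y \<in> pos_cone X\<rbrakk> \<Longrightarrow> nrm X (x \<ominus> y) \<le> nrm X (x \<oplus> y)"
    and vle_iff: "\<lbrakk>x \<in> real_part X; y \<in> real_part X\<rbrakk> \<Longrightarrow> x \<preceq> y \<longleftrightarrow> y \<ominus> x \<in> pos_cone X"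
begin

lemma real_carrier [simp]: "x \<in> real_part X \<Longrightarrow> x \<in> carrier X"
  using real_subset by blast

lemma cone_real: "x \<in> pos_cone X \<Longrightarrow> x \<in> real_part X"
  by (simp add: pos_cone_def)

lemma cone_carrier [simp]: "x \<in> pos_cone X \<Longrightarrow> x \<in> carrier X"
  using cone_real by simp

lemma real_uminus: "x \<in> real_part X \<Longrightarrow> \<ominus> x \<in> real_part X"
  using real_scale[of x "-1"] by (simp add: uminus_eq_scale)

lemma real_minus: "\<lbrakk>x \<in> real_part X; y \<in> real_part X\<rbrakk> \<Longrightarrow> x \<ominus> y \<in> real_part X"
  by (simp add: a_minus_def real_add real_uminus)

text \<open>Directness of the sum is contained in \<open>real_nrm\<close>: if
  \<open>a \<oplus> \<i> \<odot> b\<close> vanishes for real \<open>a\<close> and \<open>b\<close>,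
  both norms are 0.\<close>

lemma decomposition_unique:
  assumes "u \<in> real_part X" "v \<in> real_part X" "u' \<in> real_part X" "v' \<in> real_part X"
    and eq: "u \<oplus> \<i> \<odot> v = u' \<oplus> \<i> \<odot> v'"
  shows "u = u' \<and> v = v'"
proof -
  have "(u \<ominus> u') \<oplus> \<i> \<odot> (v \<ominus> v') = (u \<oplus> \<i> \<odot> v) \<ominus> (u' \<oplus> \<i> \<odot> v')"
    using assms(1-4) by (simp add: scale_minus_right add_minus_add)
  also have "\<dots> = \<zero>" using assms by (simp add: a_minus_def M.r_neg)
  finally have "max (nrm X (u \<ominus> u')) (nrm X (v \<ominus> v')) \<le> 0"
    using real_nrm[of "u \<ominus> u'" "v \<ominus> v'"] assms(1-4) by (simp add: real_minus)
  then have "nrm X (u \<ominus> u') = 0" "nrm X (v \<ominus> v') = 0"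
    using assms(1-4) by (auto intro: antisym)
  then have "u \<ominus> u' = \<zero>" "v \<ominus> v' = \<zero>" using assms(1-4) by (auto simp: nrm_eq_0_iff)
  then show ?thesis using assms(1-4) by (metis M.l_zero minus_add_cancel real_carrier)
qed

text \<open>Monotonicity for the pair \<open>x\<close>, \<open>\<ominus> x\<close> compares the norm
  of \<open>2 \<odot> x\<close> with that of zero.\<close>

lemma cone_proper_eq:
  assumes "x \<in> pos_cone X" "\<ominus> x \<in> pos_cone X"
  shows "x = \<zero>"
proof -
  have "nrm X (x \<ominus> (\<ominus> x)) \<le> nrm X (x \<oplus> (\<ominus> x))" using assms by (rule cone_monotone)
  moreover have "x \<ominus> (\<ominus> x) = 2 \<odot> x"
    using assms scale_add_left[of x 1 1] by (simp add: a_minus_def)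
  ultimately have "nrm X x \<le> 0" using assms by (simp add: M.r_neg nrm_smult)
  then show ?thesis using assms nrm_eq_0_iff[of x] seminorm_nonneg[of x] by (auto intro: antisym)
qed

lemma order_interval_iff:
  assumes "x \<in> real_part X" "y \<in> real_part X"
  shows "\<ominus> y \<preceq> x \<longleftrightarrow> y \<oplus> x \<in> pos_cone X"
  using assms by (simp add: vle_iff real_uminus a_minus_def M.a_comm)

lemma riesz_normedI:
  assumes "Metric_space.mcomplete (carrier X) (ndist X)"
    and "closedin (ntopology X) (real_part X)"
    and "closedin (ntopology X) (pos_cone X)"
    and riesz: "\<And>x \<epsilon>. \<lbrakk>x \<in> real_part X; 0 < \<epsilon>\<rbrakk> \<Longrightarrow>
      \<exists>y\<in>real_part X. \<ominus> y \<preceq> x \<and> x \<preceq> y \<and> nrm X y \<le> (1 + \<epsilon>) * nrm X x"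
  shows "riesz_normed X"
proof unfold_locales
  show "\<exists>!z. z \<in> real_part X \<times> real_part X \<and> x = fst z \<oplus> \<i> \<odot> snd z" if "x \<in> carrier X" for x
  proof -
    obtain u v where uv: "u \<in> real_part X" "v \<in> real_part X" "x = u \<oplus> \<i> \<odot> v"
      using real_decomposition[OF \<open>x \<in> carrier X\<close>] by blast
    show ?thesis
    proof (rule ex1I[of _ "(u, v)"])
      fix z assume "z \<in> real_part X \<times> real_part X \<and> x = fst z \<oplus> \<i> \<odot> snd z"
      then show "z = (u, v)" using decomposition_unique[of u v "fst z" "snd z"] uv
        by (cases z) auto
    qed (use uv in auto)
  qed
  show "max (nrm X x1) (nrm X x2) \<le> nrm X (x1 \<oplus> \<i> \<odot> x2)"
    if "x1 \<in> real_part X" "x2 \<in> real_part X" for x1 x2 using real_nrm that .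
  show "partial_order_on (real_part X)
      {(x, y). x \<in> real_part X \<and> y \<in> real_part X \<and> x \<preceq> y}"
  proof -
    have "x \<preceq> x" if "x \<in> real_part X" for x
      using that by (simp add: vle_iff a_minus_def M.r_neg cone_zero)
    moreover have "x \<preceq> z"
      if "x \<in> real_part X" "y \<in> real_part X" "z \<in> real_part X" "x \<preceq> y" "y \<preceq> z" for x y z
      using that cone_add[of "z \<ominus> y" "y \<ominus> x"] by (simp add: vle_iff minus_trans)
    moreover have "x = y"
      if "x \<in> real_part X" "y \<in> real_part X" "x \<preceq> y" "y \<preceq> x" for x y
    proof -
      have "\<ominus> (x \<ominus> y) = y \<ominus> x" using that by (simp add: a_minus_def M.minus_add M.a_comm)
      then have "x \<ominus> y = \<zero>" using that by (intro cone_proper_eq) (simp_all add: vle_iff)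
      then show ?thesis using that by (metis M.l_zero minus_add_cancel real_carrier)
    qed
    ultimately show ?thesis
      unfolding partial_order_on_def preorder_on_def refl_on_def trans_on_def antisym_on_def
      by blast
  qed
  show "x \<oplus> z \<preceq> y \<oplus> z"
    if "x \<in> real_part X" "y \<in> real_part X" "z \<in> real_part X" "x \<preceq> y" for x y z
    using that by (simp add: vle_iff real_add add_minus_add) (simp add: a_minus_def M.r_neg)
  show "complex_of_real a \<odot> x \<preceq> complex_of_real a \<odot> y"
    if "x \<in> real_part X" "y \<in> real_part X" "x \<preceq> y" "0 \<le> a" for x y a
    using that cone_scale[of "y \<ominus> x" a] by (simp add: vle_iff real_scale scale_minus_right)
  show "pos_cone X \<inter> {\<ominus> x |x. x \<in> pos_cone X} = {\<zero>}"
  proof -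
    have "\<ominus> \<zero> = \<zero>" by (simp add: uminus_eq_scale)
    from this[symmetric] have "\<exists>x. \<zero> = \<ominus> x \<and> x \<in> pos_cone X" using cone_zero by blast
    moreover have "x = \<zero>" if "x \<in> pos_cone X" "x = \<ominus> y" "y \<in> pos_cone X" for x y
      using cone_proper_eq[of x] that by simp
    ultimately show ?thesis using cone_zero by blast
  qed
  show "nrm X x \<le> nrm X y"
    if xy: "x \<in> real_part X" "y \<in> real_part X" "\<ominus> y \<preceq> x" "x \<preceq> y" for x y
  proof -
    \<comment> \<open>Both \<open>y \<oplus> x\<close> and \<open>y \<ominus> x\<close> are
      positive; their difference and sum are \<open>2 \<odot> x\<close> and
      \<open>2 \<odot> y\<close>.\<close>
    have "nrm X ((y \<oplus> x) \<ominus> (y \<ominus> x)) \<le> nrm X ((y \<oplus> x) \<oplus> (y \<ominus> x))"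
      using xy by (intro cone_monotone) (simp_all add: order_interval_iff vle_iff)
    moreover have "(y \<oplus> x) \<ominus> (y \<ominus> x) = 2 \<odot> x" "(y \<oplus> x) \<oplus> (y \<ominus> x) = 2 \<odot> y"
      using xy scale_add_left[of x 1 1] scale_add_left[of y 1 1]
      by (simp_all add: add_add_minus add_minus_minus)
    ultimately show ?thesis using xy by (simp add: nrm_smult)
  qed
qed (use assms real_zero real_add real_scale in auto)

end

text \<open>The converse passage, by which a Riesz-normed \<open>X\<close> enters the cone
  formalism. Translating an inequality shows that the order is determined by the cone.\<close>

lemma (in riesz_normed) cone_normed_space: "cone_normed_space X"
proof -
  have sub: "real_part X \<subseteq> carrier X"
    using closedin_subset[OF real_part_closed] Metric_space.topspace_mtopology[OF Metric_space_ndist]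
    by (simp add: ntopology_def)
  then have carr [simp]: "x \<in> carrier X" if "x \<in> real_part X" for x using that by blast
  have um: "\<ominus> x \<in> real_part X" if "x \<in> real_part X" for x
    using real_part_smult[OF that, of "-1"] that by (simp add: uminus_eq_scale)
  have mi: "x \<ominus> y \<in> real_part X" if "x \<in> real_part X" "y \<in> real_part X" for x y
    using that um real_part_add by (simp add: a_minus_def)
  have vle: "x \<preceq> y \<longleftrightarrow> y \<ominus> x \<in> pos_cone X" if xy: "x \<in> real_part X" "y \<in> real_part X" for x y
  proof
    assume "x \<preceq> y"
    then have "x \<oplus> \<ominus> x \<preceq> y \<oplus> \<ominus> x" using xy um by (intro add_mono)
    then show "y \<ominus> x \<in> pos_cone X" using xy mi by (simp add: pos_cone_def a_minus_def M.r_neg)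
  next
    assume "y \<ominus> x \<in> pos_cone X"
    then have "\<zero> \<oplus> x \<preceq> (y \<ominus> x) \<oplus> x"
      using xy mi real_part_zero by (intro add_mono) (auto simp: pos_cone_def)
    then show "x \<preceq> y" using xy by (simp add: minus_add_cancel)
  qed
  have refl: "x \<preceq> x" if "x \<in> real_part X" for x
    using partial_order that by (auto simp: partial_order_on_def preorder_on_def refl_on_def)
  have trans: "x \<preceq> z"
    if "x \<in> real_part X" "y \<in> real_part X" "z \<in> real_part X" "x \<preceq> y" "y \<preceq> z" for x y z
    using partial_order that unfolding partial_order_on_def preorder_on_def trans_on_def by blast
  have cadd: "x \<oplus> y \<in> pos_cone X" if "x \<in> pos_cone X" "y \<in> pos_cone X" for x y
  proof -
    have r: "x \<in> real_part X" "y \<in> real_part X" "\<zero> \<preceq> x" "\<zero> \<preceq> y"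
      using that by (simp_all add: pos_cone_def)
    have "\<zero> \<oplus> y \<preceq> x \<oplus> y" using r real_part_zero by (intro add_mono)
    then have "y \<preceq> x \<oplus> y" using r by simp
    then have "\<zero> \<preceq> x \<oplus> y"
      using r by (intro trans[of \<zero> y "x \<oplus> y"] real_part_zero real_part_add)
    then show ?thesis using r by (simp add: pos_cone_def real_part_add)
  qed
  have cmul: "complex_of_real a \<odot> x \<in> pos_cone X" if "x \<in> pos_cone X" "0 \<le> a" for x a
    using that smult_mono[of \<zero> x a] by (simp add: pos_cone_def real_part_zero real_part_smult)
  show ?thesis
  proof unfold_locales
    show "nrm X (x \<ominus> y) \<le> nrm X (x \<oplus> y)" if xy: "x \<in> pos_cone X" "y \<in> pos_cone X" for x y
    proof (rule absolutely_monotone)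
      have r: "x \<in> real_part X" "y \<in> real_part X" using xy by (auto simp: pos_cone_def)
      show "x \<ominus> y \<in> real_part X" "x \<oplus> y \<in> real_part X" using r mi real_part_add by auto
      \<comment> \<open>The gaps in \<open>\<ominus> (x \<oplus> y) \<preceq> x \<ominus> y
        \<preceq> x \<oplus> y\<close> are \<open>x \<oplus> x\<close> and
        \<open>y \<oplus> y\<close>, both positive.\<close>
      have "(x \<ominus> y) \<ominus> (\<ominus> (x \<oplus> y)) = x \<oplus> x" "(x \<oplus> y) \<ominus> (x \<ominus> y) = y \<oplus> y"
        using r add_add_minus[of x y] add_minus_minus[of x y]
        by (simp_all add: a_minus_def M.a_comm[of "x \<oplus> \<ominus> y"])
      then show "\<ominus> (x \<oplus> y) \<preceq> x \<ominus> y" "x \<ominus> y \<preceq> x \<oplus> y"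
        using r xy cadd um mi real_part_add by (auto simp: vle)
    qed
    show "\<exists>u\<in>real_part X. \<exists>v\<in>real_part X. x = u \<oplus> \<i> \<odot> v" if "x \<in> carrier X" for x
      using ex1_implies_ex[OF decomposition[OF that]] unfolding mem_Times_iff by blast
    show "\<zero> \<in> pos_cone X" using refl real_part_zero by (simp add: pos_cone_def)
    show "max (nrm X u) (nrm X v) \<le> nrm X (u \<oplus> \<i> \<odot> v)"
      if "u \<in> real_part X" "v \<in> real_part X" for u v using nrm_complexification that .
  qed (fact sub real_part_zero real_part_add real_part_smult cadd cmul vle)+
qed

section \<open>Ultraproducts\<close>

text \<open>Countable saturation. At each index the conditions are met up to the largest
  \<open>k\<close> for which they are jointly satisfiable; since finitely many of them are
  eventually satisfiable and the cap \<open>r\<close> tends to infinity, this \<open>k\<close>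
  eventually exceeds any bound. \<open>D\<close> is a property wanted at every index, supplied by
  condition 0 or by the default \<open>d\<close>.\<close>

lemma exists_saturated_family:
  fixes P :: "nat \<Rightarrow> 'i \<Rightarrow> 'a \<Rightarrow> bool" and r :: "'i \<Rightarrow> nat"
  assumes r: "filterlim r at_top U"
    and P: "\<And>k. \<forall>\<^sub>F j in U. \<exists>a. \<forall>i\<le>k. P i j a"
    and D: "\<And>j a. P 0 j a \<Longrightarrow> D j a" "\<And>j. D j (d j)"
  obtains x where "\<And>j. D j (x j)" "\<And>k. \<forall>\<^sub>F j in U. P k j (x j)"
proof -
  \<comment> \<open>The cap \<open>k \<le> r j\<close> makes a greatest \<open>k\<close> exist even
    where all conditions are satisfiable at once.\<close>
  define G where "G j k \<longleftrightarrow> k \<le> r j \<and> (\<exists>a. \<forall>i\<le>k. P i j a)" for j and k :: nat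
  define K where "K j = (GREATEST k. G j k)" for j
  define x where "x j = (if \<exists>k. G j k then SOME a. \<forall>i\<le>K j. P i j a else d j)" for j
  have bound: "\<And>k. G j k \<Longrightarrow> k \<le> r j" for j by (simp add: G_def)
  have GK: "G j (K j)" if "G j k" for j k
    unfolding K_def using GreatestI_nat[of "G j", OF that bound] .
  have x: "\<forall>i\<le>K j. P i j (x j)" if "G j k" for j k
  proof -
    have "x j = (SOME a. \<forall>i\<le>K j. P i j a)" using that by (auto simp: x_def)
    moreover have "\<exists>a. \<forall>i\<le>K j. P i j a" using GK[OF that] by (simp add: G_def)
    ultimately show ?thesis using someI_ex[of "\<lambda>a. \<forall>i\<le>K j. P i j a"] by simp
  qed
  show thesis
  proof
    show "D j (x j)" for j
      using x[of j] D by (cases "\<exists>k. G j k") (auto simp: x_def)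
    fix k
    have "\<forall>\<^sub>F j in U. k \<le> r j" using r by (simp add: filterlim_at_top)
    then show "\<forall>\<^sub>F j in U. P k j (x j)" using P[of k]
    proof eventually_elim
      case (elim j)
      then have "G j k" by (simp add: G_def)
      moreover from this have "k \<le> K j"
        unfolding K_def using Greatest_le_nat[of "G j", OF _ bound] by blast
      ultimately show ?case using x by blast
    qed
  qed
qed

section \<open>The limit seminorm and the ultraproduct of normed spaces\<close>

locale ultraproduct_of_normed =
  fixes U :: "'i filter" and E :: "'i \<Rightarrow> 'v onspace" and Y
  defines "Y \<equiv> ultraproduct U E"
  assumes ultrafilter: "ultrafilter U"
    and normed: "\<And>j. complex_normed_space (E j)"
begin

sublocale E: complex_normed_space "E j" for j by (rule normed)

abbreviation B :: "('i \<Rightarrow> 'v) nspace" where "B \<equiv> bounded_families E"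

definition limnorm :: "('i \<Rightarrow> 'v) \<Rightarrow> real" where "limnorm x = Lim U (\<lambda>j. nrm (E j) (x j))"

lemma families_iff:
  "x \<in> carrier B \<longleftrightarrow> (\<forall>j. x j \<in> carrier (E j)) \<and> (\<exists>K. \<forall>j. nrm (E j) (x j) \<le> K)"
  by (auto simp: bounded_families_def bdd_above_def)

lemma familiesI:
  "(\<And>j. x j \<in> carrier (E j)) \<Longrightarrow> (\<And>j. nrm (E j) (x j) \<le> K) \<Longrightarrow> x \<in> carrier B"
  by (auto simp: families_iff)

lemma families_carrier [simp]: "x \<in> carrier B \<Longrightarrow> x j \<in> carrier (E j)"
  by (simp add: families_iff)

lemma families_bound:
  "x \<in> carrier B \<Longrightarrow> \<exists>K. \<forall>j. nrm (E j) (x j) \<le> K"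
  by (simp only: families_iff)

lemma families_dominated:
  assumes "y \<in> carrier B" "\<And>j. x j \<in> carrier (E j)" "\<And>j. nrm (E j) (x j) \<le> K * nrm (E j) (y j)" "0 \<le> K"
  shows "x \<in> carrier B"
proof -
  obtain C where C: "\<And>j. nrm (E j) (y j) \<le> C" using families_bound[OF assms(1)] by blast
  have "nrm (E j) (x j) \<le> K * C" for j
    using assms(3)[of j] mult_left_mono[OF C[of j] assms(4)] by linarith
  then show ?thesis using assms(2) by (intro familiesI)
qed

lemma families_simps [simp]:
  "\<zero>\<^bsub>B\<^esub> = (\<lambda>j. \<zero>\<^bsub>E j\<^esub>)" "x \<oplus>\<^bsub>B\<^esub> y = (\<lambda>j. x j \<oplus>\<^bsub>E j\<^esub> y j)" "a \<odot>\<^bsub>B\<^esub> x = (\<lambda>j. a \<odot>\<^bsub>E j\<^esub> x j)"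
  by (simp_all only: bounded_families_def mk_nspace_simps)

lemma limnorm_tendsto:
  assumes x: "x \<in> carrier B"
  shows "((\<lambda>j. nrm (E j) (x j)) \<longlongrightarrow> limnorm x) U"
proof -
  obtain K where K: "\<And>j. nrm (E j) (x j) \<le> K" using families_bound[OF x] by blast
  have "bounded (range (\<lambda>j. nrm (E j) (x j)))"
    using K x by (intro boundedI[of _ K]) auto
  then show ?thesis unfolding limnorm_def by (rule ultrafilter_bounded_tendsto[OF ultrafilter])
qed

lemma limnorm_eqI:
  assumes "((\<lambda>j. nrm (E j) (x j)) \<longlongrightarrow> l) U"
  shows "limnorm x = l"
  unfolding limnorm_def using assms ultrafilterD(2)[OF ultrafilter] by (intro tendsto_Lim)

lemma limnorm_leI:
  assumes "x \<in> carrier B" "\<forall>\<^sub>F j in U. nrm (E j) (x j) \<le> c"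
  shows "limnorm x \<le> c"
  using tendsto_upperbound[OF limnorm_tendsto[OF assms(1)] assms(2)] ultrafilterD(2)[OF ultrafilter]
  by simp

lemma limnorm_less_eventually:
  assumes "x \<in> carrier B" "limnorm x < c"
  shows "\<forall>\<^sub>F j in U. nrm (E j) (x j) < c"
  using order_tendstoD(2)[OF limnorm_tendsto[OF assms(1)] assms(2)] .

lemma limnorm_mono:
  assumes "x \<in> carrier B" "y \<in> carrier B" "\<And>j. nrm (E j) (x j) \<le> K * nrm (E j) (y j)"
  shows "limnorm x \<le> K * limnorm y"
  using assms ultrafilterD(2)[OF ultrafilter]
  by (intro tendsto_le[OF _ tendsto_mult_left[OF limnorm_tendsto[OF assms(2)]] limnorm_tendsto[OF assms(1)]]) auto

lemma families_add:
  assumes "x \<in> carrier B" "y \<in> carrier B" shows "(\<lambda>j. x j \<oplus>\<^bsub>E j\<^esub> y j) \<in> carrier B"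
proof -
  obtain K L where "\<And>j. nrm (E j) (x j) \<le> K" "\<And>j. nrm (E j) (y j) \<le> L"
    using families_bound[OF assms(1)] families_bound[OF assms(2)] by blast
  then have "nrm (E j) (x j \<oplus>\<^bsub>E j\<^esub> y j) \<le> K + L" for j
    using E.nrm_add[of "x j" j "y j"] assms by (smt (verit) families_carrier)
  then show ?thesis using assms by (intro familiesI) auto
qed

lemma families_scale:
  assumes "x \<in> carrier B" shows "(\<lambda>j. a \<odot>\<^bsub>E j\<^esub> x j) \<in> carrier B"
  using assms by (rule families_dominated[where K = "cmod a"]) (simp_all add: assms E.nrm_smult)

lemma families_seminormed: "complex_seminormed_module B limnorm"
proof -
  have "Module.module complex_field B"
    by (rule complex_moduleI)
      (auto simp: families_add families_scale E.M.a_ac E.scale_add_left E.scale_add_right E.scale_scale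
        intro: familiesI[of _ 0])
  moreover have "limnorm (\<lambda>j. x j \<oplus>\<^bsub>E j\<^esub> y j) \<le> limnorm x + limnorm y"
    if xy: "x \<in> carrier B" "y \<in> carrier B" for x y
    by (rule tendsto_le[OF _ tendsto_add[OF limnorm_tendsto[OF xy(1)] limnorm_tendsto[OF xy(2)]]
          limnorm_tendsto[OF families_add[OF xy]]])
      (use xy ultrafilterD(2)[OF ultrafilter] in \<open>auto intro!: always_eventually E.nrm_add\<close>)
  moreover have "limnorm (\<lambda>j. a \<odot>\<^bsub>E j\<^esub> x j) = cmod a * limnorm x" if "x \<in> carrier B" for x a
    using tendsto_mult_left[OF limnorm_tendsto[OF that], of "cmod a"] that
    by (intro limnorm_eqI) (simp add: E.nrm_smult)
  ultimately show ?thesis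
    unfolding complex_seminormed_module_def complex_seminormed_module_axioms_def by simp
qed

sublocale B: complex_seminormed_module B limnorm by (rule families_seminormed)

lemma families_uminus:
  assumes "x \<in> carrier B" shows "\<ominus>\<^bsub>B\<^esub> x = (\<lambda>j. \<ominus>\<^bsub>E j\<^esub> x j)"
  using B.uminus_eq_scale[OF assms] E.uminus_eq_scale assms by simp

lemma families_minus:
  assumes "x \<in> carrier B" "y \<in> carrier B" shows "x \<ominus>\<^bsub>B\<^esub> y = (\<lambda>j. x j \<ominus>\<^bsub>E j\<^esub> y j)"
  using families_uminus[OF assms(2)] by (simp add: a_minus_def)

lemma null_eq: "B.null = {x \<in> carrier B. ((\<lambda>j. nrm (E j) (x j)) \<longlongrightarrow> 0) U}"
  using limnorm_tendsto limnorm_eqI by (force simp: B.null_def)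

text \<open>The limit is a lower bound, being constant on the coset and at most the supremum. It is
  approached by replacing with zero the members whose norm is not below the limit plus
  \<open>e\<close>; they sit off a set of the ultrafilter, so the new family stays in the
  coset.\<close>

lemma INF_families_nrm:
  assumes x: "x \<in> carrier B"
  shows "(INF y\<in>B.cls x. nrm B y) = limnorm x"
proof (rule antisym)
  have nrmB: "nrm B y = (SUP j. nrm (E j) (y j))" for y
    by (simp only: bounded_families_def mk_nspace_simps)
  have bdd: "bdd_above (range (\<lambda>j. nrm (E j) (y j)))" if "y \<in> carrier B" for y
    using families_bound[OF that] by (auto simp: bdd_above_def)
  have le_nrm: "limnorm y \<le> nrm B y" if "y \<in> carrier B" for y
    unfolding nrmB using that bdd[OF that] by (intro limnorm_leI always_eventually allI cSUP_upper) auto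
  have ge: "limnorm x \<le> nrm B y" if "y \<in> B.cls x" for y
  proof -
    have "y \<in> carrier B" "limnorm y = limnorm x"
      using that x B.seminorm_null_diff by (auto simp: B.mem_cls)
    then show ?thesis using le_nrm by metis
  qed
  show "limnorm x \<le> (INF y\<in>B.cls x. nrm B y)"
    using ge B.cls_self[OF x] by (intro cINF_greatest) auto
  show "(INF y\<in>B.cls x. nrm B y) \<le> limnorm x"
  proof (rule field_le_epsilon)
    fix e :: real assume e: "0 < e"
    define y where "y j = (if nrm (E j) (x j) < limnorm x + e then x j else \<zero>\<^bsub>E j\<^esub>)" for j
    have pos: "0 \<le> limnorm x" using B.seminorm_nonneg[OF x] .
    have y_le: "nrm (E j) (y j) \<le> limnorm x + e" for j using pos e by (simp add: y_def)
    have "y j \<in> carrier (E j)" for j using x by (simp add: y_def)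
    then have y: "y \<in> carrier B" using y_le by (rule familiesI)
    have "\<forall>\<^sub>F j in U. nrm (E j) (x j) < limnorm x + e"
      using e by (intro limnorm_less_eventually[OF x]) simp
    then have "\<forall>\<^sub>F j in U. nrm (E j) (y j \<ominus>\<^bsub>E j\<^esub> x j) = 0"
      by eventually_elim (use x in \<open>simp add: y_def a_minus_def E.M.r_neg\<close>)
    then have "limnorm (\<lambda>j. y j \<ominus>\<^bsub>E j\<^esub> x j) = 0"
      by (intro limnorm_eqI tendsto_eventually)
    then have "y \<in> B.cls x" using x y by (simp add: B.mem_cls families_minus)
    then have "(INF y\<in>B.cls x. nrm B y) \<le> nrm B y"
      using ge by (intro cINF_lower bdd_belowI2)
    also have "\<dots> \<le> limnorm x + e" unfolding nrmB using y_le by (intro cSUP_least) auto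
    finally show "(INF y\<in>B.cls x. nrm B y) \<le> limnorm x + e" .
  qed
qed

sublocale B: seminorm_quotient B limnorm
  by unfold_locales (rule INF_families_nrm)

abbreviation cls :: "('i \<Rightarrow> 'v) \<Rightarrow> ('i \<Rightarrow> 'v) set" where "cls \<equiv> B.cls"

lemma Y_eq: "Y = ordered_by B.Q
    {z \<in> carrier B.Q. \<exists>x\<in>z. \<forall>j. x j \<in> real_part (E j)}
    {z \<in> carrier B.Q. \<exists>x\<in>z. \<forall>j. x j \<in> pos_cone (E j)}"
  by (simp add: Y_def ultraproduct_def Let_def null_eq)

lemma Y_normed: "complex_normed_space Y"
  unfolding Y_eq by (rule ordered_by_normed[OF B.quotient_normed])

sublocale Y: complex_normed_space Y by (rule Y_normed)

lemma Y_carrier: "carrier Y = cls ` carrier B"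
  by (simp add: Y_eq B.quotient_carrier)

lemma Y_carrierE: assumes "z \<in> carrier Y" obtains x where "x \<in> carrier B" "z = cls x"
  using assms by (auto simp: Y_carrier)

lemma Y_simps:
  "\<zero>\<^bsub>Y\<^esub> = cls (\<lambda>j. \<zero>\<^bsub>E j\<^esub>)"
  "\<lbrakk>x \<in> carrier B; y \<in> carrier B\<rbrakk> \<Longrightarrow> cls x \<oplus>\<^bsub>Y\<^esub> cls y = cls (\<lambda>j. x j \<oplus>\<^bsub>E j\<^esub> y j)"
  "\<lbrakk>x \<in> carrier B; y \<in> carrier B\<rbrakk> \<Longrightarrow> cls x \<ominus>\<^bsub>Y\<^esub> cls y = cls (\<lambda>j. x j \<ominus>\<^bsub>E j\<^esub> y j)"
  "x \<in> carrier B \<Longrightarrow> a \<odot>\<^bsub>Y\<^esub> cls x = cls (\<lambda>j. a \<odot>\<^bsub>E j\<^esub> x j)"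
  "x \<in> carrier B \<Longrightarrow> nrm Y (cls x) = limnorm x"
  "x \<in> carrier B \<Longrightarrow> cls x \<in> carrier Y"
  by (simp_all add: Y_eq B.quotient_simps B.quotient_minus families_minus)

lemma families_minus_closed:
  "\<lbrakk>x \<in> carrier B; y \<in> carrier B\<rbrakk> \<Longrightarrow> (\<lambda>j. x j \<ominus>\<^bsub>E j\<^esub> y j) \<in> carrier B"
  using B.M.minus_closed[of x y] by (simp add: families_minus)

lemma cls_eqI:
  assumes "x \<in> carrier B" "y \<in> carrier B"
    "((\<lambda>j. nrm (E j) (x j \<ominus>\<^bsub>E j\<^esub> y j)) \<longlongrightarrow> 0) U"
  shows "cls x = cls y"
  using assms limnorm_eqI[OF assms(3)] by (simp add: B.cls_eq_iff families_minus)

end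

text \<open>A rank tending to infinity makes the ultrafilter countably incomplete: the sets where
  \<open>rank\<close> is at least \<open>n\<close> belong to it and have empty intersection.
  Saturation rests on this.\<close>

locale ultraproduct_incomplete = ultraproduct_of_normed U E Y for U :: "'i filter" and E :: "'i \<Rightarrow> 'v onspace" and Y +
  fixes rank :: "'i \<Rightarrow> nat"
  assumes rank: "filterlim rank at_top U"
begin

text \<open>Both completeness and closedness come from saturation, which produces one family from
  countably many approximations; the spaces \<open>E j\<close> need not be complete.\<close>

lemma Y_complete: "Metric_space.mcomplete (carrier Y) (ndist Y)"
proof (rule Y.mcompleteI)
  fix \<sigma> :: "nat \<Rightarrow> _" assume \<sigma>: "\<And>n. \<sigma> n \<in> carrier Y"
    and C: "\<And>\<epsilon>. 0 < \<epsilon> \<Longrightarrow> \<exists>N. \<forall>m\<ge>N. \<forall>n\<ge>N. nrm Y (\<sigma> m \<ominus>\<^bsub>Y\<^esub> \<sigma> n) < \<epsilon>"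
  have "\<exists>x\<in>carrier B. \<sigma> n = cls x" for n using \<sigma>[of n] by (auto simp: Y_carrier)
  then obtain x where x: "\<And>n. x n \<in> carrier B" "\<And>n. \<sigma> n = cls (x n)" by metis
  have "\<exists>N. \<forall>m\<ge>N. \<forall>n\<ge>N. limnorm (\<lambda>j. x m j \<ominus>\<^bsub>E j\<^esub> x n j) < 1 / real (Suc k)" for k
    using C[of "1 / real (Suc k)"] x by (simp add: Y_simps families_minus_closed)
  then obtain N where N: "\<And>k m n. m \<ge> N k \<Longrightarrow> n \<ge> N k \<Longrightarrow>
      limnorm (\<lambda>j. x m j \<ominus>\<^bsub>E j\<^esub> x n j) < 1 / real (Suc k)" by metis
  obtain K where K: "\<And>j. nrm (E j) (x (N 0) j) \<le> K" using families_bound[OF x(1)] by blast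
  \<comment> \<open>Condition \<open>k\<close> asks for closeness to the member with number
    \<open>N k\<close>, from which on all members are within \<open>1 / Suc k\<close> of each
    other.\<close>
  define P where "P k j a \<longleftrightarrow> a \<in> carrier (E j) \<and> nrm (E j) (a \<ominus>\<^bsub>E j\<^esub> x (N k) j) < 1 / real (Suc k)"
    for k j a
  have K0: "0 \<le> K" using K[of undefined] E.seminorm_nonneg[OF families_carrier[OF x(1)]] order_trans by blast
  have 1: "\<forall>\<^sub>F j in U. \<exists>a. \<forall>i\<le>k. P i j a" for k
  proof -
    \<comment> \<open>One late member of the sequence satisfies all conditions up to
      \<open>k\<close> simultaneously.\<close>
    define m where "m = Max (N ` {..k})"
    have "N i \<le> m" if "i \<le> k" for i unfolding m_def using that by (intro Max_ge) auto
    then have "\<forall>\<^sub>F j in U. nrm (E j) (x m j \<ominus>\<^bsub>E j\<^esub> x (N i) j) < 1 / real (Suc i)" if "i \<le> k" for i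
      using that N[of i m "N i"] x by (intro limnorm_less_eventually families_minus_closed) auto
    then have "\<forall>\<^sub>F j in U. \<forall>i\<in>{..k}. nrm (E j) (x m j \<ominus>\<^bsub>E j\<^esub> x (N i) j) < 1 / real (Suc i)"
      by (intro eventually_ball_finite) auto
    then show ?thesis
    proof eventually_elim
      case (elim j)
      then have "\<forall>i\<le>k. P i j (x m j)" using x by (simp add: P_def)
      then show ?case ..
    qed
  qed
  \<comment> \<open>Condition 0 alone bounds the saturated family, with 1 for the distance to
    \<open>x (N 0)\<close>.\<close>
  have 2: "a \<in> carrier (E j) \<and> nrm (E j) a \<le> K + 1" if "P 0 j a" for j a
    using that E.seminorm_le_add[of a j "x (N 0) j"] K[of j] x by (simp add: P_def)
  obtain l where l: "\<And>j. l j \<in> carrier (E j) \<and> nrm (E j) (l j) \<le> K + 1"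
    and lP: "\<And>k. \<forall>\<^sub>F j in U. P k j (l j)"
    by (rule exists_saturated_family[OF rank 1, of "\<lambda>j a. a \<in> carrier (E j) \<and> nrm (E j) a \<le> K + 1"
          "\<lambda>j. \<zero>\<^bsub>E j\<^esub>"]) (use 2 K0 in auto)
  have lB: "l \<in> carrier B" using l by (intro familiesI) auto
  have dist: "limnorm (\<lambda>j. x (N k) j \<ominus>\<^bsub>E j\<^esub> l j) \<le> 1 / real (Suc k)" for k
    using lP[of k] lB x
    by (intro limnorm_leI families_minus_closed) (auto elim!: eventually_mono simp: P_def E.seminorm_minus_commute)
  have conv: "nrm Y (\<sigma> n \<ominus>\<^bsub>Y\<^esub> cls l) < 2 / real (Suc k)" if "n \<ge> N k" for n k
  proof -
    have "nrm Y (\<sigma> n \<ominus>\<^bsub>Y\<^esub> cls l) \<le> nrm Y (\<sigma> n \<ominus>\<^bsub>Y\<^esub> \<sigma> (N k)) + nrm Y (\<sigma> (N k) \<ominus>\<^bsub>Y\<^esub> cls l)"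
      using \<sigma> lB by (intro Y.seminorm_triangle) (auto simp: Y_simps)
    also have "\<dots> < 1 / real (Suc k) + 1 / real (Suc k)"
      using N[OF that order_refl] dist[of k] x lB by (simp add: Y_simps families_minus_closed)
    finally show ?thesis by simp
  qed
  have "(\<lambda>n. nrm Y (\<sigma> n \<ominus>\<^bsub>Y\<^esub> cls l)) \<longlonglongrightarrow> 0"
  proof (rule LIMSEQ_I)
    fix e :: real assume "0 < e"
    then obtain k where k: "2 / real (Suc k) < e"
      using reals_Archimedean[of "e / 2"] by (auto simp: field_simps)
    have "norm (nrm Y (\<sigma> n \<ominus>\<^bsub>Y\<^esub> cls l) - 0) < e" if "n \<ge> N k" for n
      using conv[OF that] k Y.seminorm_nonneg[of "\<sigma> n \<ominus>\<^bsub>Y\<^esub> cls l"] \<sigma> lB by (simp add: Y_simps)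
    then show "\<exists>no. \<forall>n\<ge>no. norm (nrm Y (\<sigma> n \<ominus>\<^bsub>Y\<^esub> cls l) - 0) < e" by blast
  qed
  then show "\<exists>l\<in>carrier Y. (\<lambda>n. nrm Y (\<sigma> n \<ominus>\<^bsub>Y\<^esub> l)) \<longlonglongrightarrow> 0"
    using lB by (intro bexI[of _ "cls l"]) (auto simp: Y_simps)
qed

text \<open>Serves both the real part and the positive cone. Zero in \<open>S j\<close> is the
  default at indices where nothing in \<open>S j\<close> is close to the limit.\<close>

lemma Y_closedin:
  assumes S: "\<And>j. S j \<subseteq> carrier (E j)" "\<And>j. \<zero>\<^bsub>E j\<^esub> \<in> S j"
  shows "closedin (ntopology Y) {cls x |x. x \<in> carrier B \<and> (\<forall>j. x j \<in> S j)}"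
proof (rule Y.closedin_ntopologyI)
  fix \<sigma> z assume \<sigma>: "\<And>n. \<sigma> n \<in> {cls x |x. x \<in> carrier B \<and> (\<forall>j. x j \<in> S j)}"
    and z: "z \<in> carrier Y" and lim: "(\<lambda>n. nrm Y (\<sigma> n \<ominus>\<^bsub>Y\<^esub> z)) \<longlonglongrightarrow> 0"
  have "\<exists>x. x \<in> carrier B \<and> (\<forall>j. x j \<in> S j) \<and> \<sigma> n = cls x" for n using \<sigma>[of n] by blast
  then obtain x where x: "\<And>n. x n \<in> carrier B" "\<And>n j. x n j \<in> S j" "\<And>n. \<sigma> n = cls (x n)" by metis
  obtain y where y: "y \<in> carrier B" "z = cls y" using z by (rule Y_carrierE)
  obtain K where K: "\<And>j. nrm (E j) (y j) \<le> K" using families_bound[OF y(1)] by blast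
  have K0: "0 \<le> K" using K[of undefined] E.seminorm_nonneg[OF families_carrier[OF y(1)]] order_trans by blast
  define P where "P k j a \<longleftrightarrow> a \<in> S j \<and> nrm (E j) (a \<ominus>\<^bsub>E j\<^esub> y j) < 1 / real (Suc k)" for k j a
  have 1: "\<forall>\<^sub>F j in U. \<exists>a. \<forall>i\<le>k. P i j a" for k
  proof -
    have "\<forall>\<^sub>F n in sequentially. nrm Y (\<sigma> n \<ominus>\<^bsub>Y\<^esub> z) < 1 / real (Suc k)"
      using order_tendstoD(2)[OF lim] by simp
    then obtain n where "nrm Y (\<sigma> n \<ominus>\<^bsub>Y\<^esub> z) < 1 / real (Suc k)"
      by (meson eventually_sequentially order_refl)
    then have "\<forall>\<^sub>F j in U. nrm (E j) (x n j \<ominus>\<^bsub>E j\<^esub> y j) < 1 / real (Suc k)"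
      using x y by (intro limnorm_less_eventually) (simp_all add: Y_simps families_minus_closed)
    then show ?thesis
    proof eventually_elim
      case (elim j)
      \<comment> \<open>A single member close to the limit also meets all the weaker
        tolerances.\<close>
      have "P i j (x n j)" if "i \<le> k" for i
      proof -
        have "1 / real (Suc k) \<le> 1 / real (Suc i)" using that by (simp add: frac_le)
        then show ?thesis using elim x by (auto simp: P_def)
      qed
      then show ?case by blast
    qed
  qed
  have 2: "a \<in> S j \<and> nrm (E j) a \<le> K + 1" if "P 0 j a" for j a
    using that E.seminorm_le_add[of a j "y j"] K[of j] y S(1)[of j] by (auto simp: P_def)
  obtain l where l: "\<And>j. l j \<in> S j \<and> nrm (E j) (l j) \<le> K + 1"
    and lP: "\<And>k. \<forall>\<^sub>F j in U. P k j (l j)"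
    by (rule exists_saturated_family[OF rank 1, of "\<lambda>j a. a \<in> S j \<and> nrm (E j) a \<le> K + 1"
          "\<lambda>j. \<zero>\<^bsub>E j\<^esub>"]) (use 2 K0 S in auto)
  have lB: "l \<in> carrier B" using l S by (intro familiesI[of _ "K + 1"]) auto
  have "limnorm (\<lambda>j. l j \<ominus>\<^bsub>E j\<^esub> y j) \<le> 1 / real (Suc k)" for k
    using lP[of k] lB y
    by (intro limnorm_leI families_minus_closed) (auto elim!: eventually_mono simp: P_def)
  moreover have "(\<lambda>k. 1 / real (Suc k)) \<longlonglongrightarrow> 0"
    using LIMSEQ_inverse_real_of_nat by (simp add: inverse_eq_divide)
  ultimately have "limnorm (\<lambda>j. l j \<ominus>\<^bsub>E j\<^esub> y j) \<le> 0"
    by (intro LIMSEQ_le_const) auto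
  then have "limnorm (\<lambda>j. l j \<ominus>\<^bsub>E j\<^esub> y j) = 0"
    using lB y by (intro antisym B.seminorm_nonneg families_minus_closed)
  then have "cls l = z" using lB y by (simp add: B.cls_eq_iff families_minus)
  then show "z \<in> {cls x |x. x \<in> carrier B \<and> (\<forall>j. x j \<in> S j)}" using l lB by blast
qed (auto simp: Y_carrier)

end

text \<open>Domination is demanded only near a given real element. This weaker form is what step
  functions in Lp provide, and the ultraproduct turns it back into domination, since errors tending
  to zero do not change a class.\<close>

locale ultraproduct_of_cones = ultraproduct_incomplete U E Y rank
  for U :: "'i filter" and E :: "'i \<Rightarrow> 'v onspace" and Y and rank +
  assumes cones: "\<And>j. cone_normed_space (E j)"
    and approx: "\<And>j x \<delta>. \<lbrakk>x \<in> real_part (E j); 0 < \<delta>\<rbrakk> \<Longrightarrow>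
      \<exists>x'\<in>real_part (E j). nrm (E j) (x' \<ominus>\<^bsub>E j\<^esub> x) < \<delta> \<and>
        (\<forall>\<epsilon>>0. \<exists>y\<in>real_part (E j). \<ominus>\<^bsub>E j\<^esub> y \<preceq>\<^bsub>E j\<^esub> x' \<and> x' \<preceq>\<^bsub>E j\<^esub> y \<and>
          nrm (E j) y \<le> (1 + \<epsilon>) * nrm (E j) x')"
begin

sublocale E: cone_normed_space "E j" for j by (rule cones)

lemma representatives_in:
  "{z \<in> carrier B.Q. \<exists>x\<in>z. \<forall>j. x j \<in> S j} = {cls x |x. x \<in> carrier B \<and> (\<forall>j. x j \<in> S j)}"
proof (intro subset_antisym subsetI)
  fix z assume "z \<in> {z \<in> carrier B.Q. \<exists>x\<in>z. \<forall>j. x j \<in> S j}"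
  then obtain x y where xy: "y \<in> carrier B" "z = cls y" "x \<in> cls y" "\<forall>j. x j \<in> S j"
    unfolding B.quotient_carrier by blast
  then have "x \<in> carrier B" "cls x = z" using B.cls_cong[of y x] B.mem_cls[of y x] by blast+
  then show "z \<in> {cls x |x. x \<in> carrier B \<and> (\<forall>j. x j \<in> S j)}" using xy(4) by blast
next
  fix z assume "z \<in> {cls x |x. x \<in> carrier B \<and> (\<forall>j. x j \<in> S j)}"
  then obtain x where "x \<in> carrier B" "\<forall>j. x j \<in> S j" "z = cls x" by blast
  then show "z \<in> {z \<in> carrier B.Q. \<exists>x\<in>z. \<forall>j. x j \<in> S j}"
    using B.cls_self[of x] unfolding B.quotient_carrier by blast
qed

lemma families_zero: "(\<lambda>j. \<zero>\<^bsub>E j\<^esub>) \<in> carrier B"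
  using B.M.zero_closed by simp

lemma Y_real_part: "real_part Y = {cls x |x. x \<in> carrier B \<and> (\<forall>j. x j \<in> real_part (E j))}"
  unfolding Y_eq ordered_by_simps representatives_in ..

lemma Y_pos_cone: "pos_cone Y = {cls x |x. x \<in> carrier B \<and> (\<forall>j. x j \<in> pos_cone (E j))}"
  unfolding Y_eq representatives_in
proof (rule pos_cone_ordered_by[OF B.quotient_normed])
  show "\<zero>\<^bsub>B.Q\<^esub> \<in> {cls x |x. x \<in> carrier B \<and> (\<forall>j. x j \<in> real_part (E j))}"
    using E.real_zero families_zero unfolding B.quotient_simps(1) families_simps by blast
qed (auto intro: E.cone_real B.quotient_simps(5))

lemma Y_realI: "x \<in> carrier B \<Longrightarrow> (\<And>j. x j \<in> real_part (E j)) \<Longrightarrow> cls x \<in> real_part Y"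
  by (auto simp: Y_real_part)

lemma Y_realE: assumes "z \<in> real_part Y"
  obtains x where "x \<in> carrier B" "\<And>j. x j \<in> real_part (E j)" "z = cls x"
  using assms by (auto simp: Y_real_part)

lemma Y_coneI: "x \<in> carrier B \<Longrightarrow> (\<And>j. x j \<in> pos_cone (E j)) \<Longrightarrow> cls x \<in> pos_cone Y"
  by (auto simp: Y_pos_cone)

lemma Y_coneE: assumes "z \<in> pos_cone Y"
  obtains x where "x \<in> carrier B" "\<And>j. x j \<in> pos_cone (E j)" "z = cls x"
  using assms by (auto simp: Y_pos_cone)

lemma Y_cones: "cone_normed_space Y"
proof unfold_locales
  show "real_part Y \<subseteq> carrier Y" by (auto simp: Y_real_part Y_simps)
  show "\<zero>\<^bsub>Y\<^esub> \<in> real_part Y" "\<zero>\<^bsub>Y\<^esub> \<in> pos_cone Y"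
    using families_zero by (auto simp: Y_simps E.real_zero E.cone_zero intro!: Y_realI Y_coneI)
  show "x \<oplus>\<^bsub>Y\<^esub> y \<in> real_part Y" if "x \<in> real_part Y" "y \<in> real_part Y" for x y
    using that by (auto elim!: Y_realE simp: Y_simps families_add E.real_add intro!: Y_realI)
  show "x \<oplus>\<^bsub>Y\<^esub> y \<in> pos_cone Y" if "x \<in> pos_cone Y" "y \<in> pos_cone Y" for x y
    using that by (auto elim!: Y_coneE simp: Y_simps families_add E.cone_add intro!: Y_coneI)
  show "complex_of_real a \<odot>\<^bsub>Y\<^esub> x \<in> real_part Y" if "x \<in> real_part Y" for x a
    using that by (auto elim!: Y_realE simp: Y_simps families_scale E.real_scale intro!: Y_realI)
  show "complex_of_real a \<odot>\<^bsub>Y\<^esub> x \<in> pos_cone Y" if "x \<in> pos_cone Y" "0 \<le> a" for x a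
    using that by (auto elim!: Y_coneE simp: Y_simps families_scale E.cone_scale intro!: Y_coneI)
  show "\<exists>u\<in>real_part Y. \<exists>v\<in>real_part Y. z = u \<oplus>\<^bsub>Y\<^esub> \<i> \<odot>\<^bsub>Y\<^esub> v" if "z \<in> carrier Y" for z
  proof -
    obtain x where x: "x \<in> carrier B" "z = cls x" using Y_carrierE[OF \<open>z \<in> carrier Y\<close>] by blast
    obtain u v where uv: "\<And>j. u j \<in> real_part (E j)" "\<And>j. v j \<in> real_part (E j)"
      "\<And>j. x j = u j \<oplus>\<^bsub>E j\<^esub> \<i> \<odot>\<^bsub>E j\<^esub> v j"
      using E.real_decomposition[OF families_carrier[OF x(1)]] by metis
    \<comment> \<open>The norm inequality bounds both components, so that the choices made index by
      index form bounded families.\<close>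
    have "nrm (E j) (u j) \<le> 1 * nrm (E j) (x j)" "nrm (E j) (v j) \<le> 1 * nrm (E j) (x j)" for j
      using E.real_nrm[OF uv(1,2), of j] uv(3)[of j] by auto
    then have B: "u \<in> carrier B" "v \<in> carrier B"
      using uv x by (auto intro: families_dominated[OF x(1), of _ 1])
    then have "z = cls u \<oplus>\<^bsub>Y\<^esub> \<i> \<odot>\<^bsub>Y\<^esub> cls v"
      using x(2) uv(3) by (simp add: Y_simps families_scale flip: uv(3))
    then show ?thesis using B uv by (blast intro: Y_realI)
  qed
  show "max (nrm Y u) (nrm Y v) \<le> nrm Y (u \<oplus>\<^bsub>Y\<^esub> \<i> \<odot>\<^bsub>Y\<^esub> v)"
    if uv: "u \<in> real_part Y" "v \<in> real_part Y" for u v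
  proof -
    obtain x y where x: "x \<in> carrier B" "\<And>j. x j \<in> real_part (E j)" "u = cls x"
      and y: "y \<in> carrier B" "\<And>j. y j \<in> real_part (E j)" "v = cls y"
      using uv by (metis Y_realE)
    let ?w = "\<lambda>j. x j \<oplus>\<^bsub>E j\<^esub> \<i> \<odot>\<^bsub>E j\<^esub> y j"
    have w: "?w \<in> carrier B" using x y by (intro families_add families_scale)
    have "limnorm x \<le> limnorm ?w" "limnorm y \<le> limnorm ?w"
      using E.real_nrm[OF x(2) y(2)] limnorm_mono[OF x(1) w, of 1] limnorm_mono[OF y(1) w, of 1]
      by auto
    then show ?thesis using x y w by (simp add: Y_simps families_scale)
  qed
  show "nrm Y (u \<ominus>\<^bsub>Y\<^esub> v) \<le> nrm Y (u \<oplus>\<^bsub>Y\<^esub> v)" if uv: "u \<in> pos_cone Y" "v \<in> pos_cone Y" for u v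
  proof -
    obtain x y where x: "x \<in> carrier B" "\<And>j. x j \<in> pos_cone (E j)" "u = cls x"
      and y: "y \<in> carrier B" "\<And>j. y j \<in> pos_cone (E j)" "v = cls y"
      using uv by (metis Y_coneE)
    have "limnorm (\<lambda>j. x j \<ominus>\<^bsub>E j\<^esub> y j) \<le> 1 * limnorm (\<lambda>j. x j \<oplus>\<^bsub>E j\<^esub> y j)"
      using E.cone_monotone[OF x(2) y(2)] x y
      by (intro limnorm_mono families_minus_closed families_add) auto
    then show ?thesis using x y by (simp add: Y_simps families_minus_closed families_add)
  qed
  show "u \<preceq>\<^bsub>Y\<^esub> v \<longleftrightarrow> v \<ominus>\<^bsub>Y\<^esub> u \<in> pos_cone Y" if "u \<in> real_part Y" "v \<in> real_part Y" for u v
  proof -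
    have "pos_cone Y = {z \<in> carrier B.Q. \<exists>x\<in>z. \<forall>j. x j \<in> pos_cone (E j)}"
      unfolding Y_pos_cone representatives_in ..
    then show ?thesis using that by (simp add: Y_eq)
  qed
qed

lemma Y_riesz_normed: "riesz_normed Y"
proof -
  interpret Y: cone_normed_space Y by (rule Y_cones)
  show ?thesis
  proof (rule Y.riesz_normedI[OF Y_complete])
    show "closedin (ntopology Y) (real_part Y)"
      unfolding Y_real_part by (rule Y_closedin[OF E.real_subset E.real_zero])
    show "closedin (ntopology Y) (pos_cone Y)"
      unfolding Y_pos_cone by (rule Y_closedin) (auto simp: E.cone_zero)
    fix z and \<epsilon> :: real assume z: "z \<in> real_part Y" and \<epsilon>: "0 < \<epsilon>"
    obtain x where x: "x \<in> carrier B" "\<And>j. x j \<in> real_part (E j)" "z = cls x"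
      using Y_realE[OF z] by blast
    \<comment> \<open>The tolerance \<open>1 / Suc (rank j)\<close> tends to zero along the
      ultrafilter, so \<open>x'\<close> represents \<open>z\<close> itself, while
      \<open>\<epsilon>\<close> is the same at all indices.\<close>
    have "\<exists>x' y. x' \<in> real_part (E j) \<and> nrm (E j) (x' \<ominus>\<^bsub>E j\<^esub> x j) < 1 / real (Suc (rank j)) \<and>
        y \<in> real_part (E j) \<and> \<ominus>\<^bsub>E j\<^esub> y \<preceq>\<^bsub>E j\<^esub> x' \<and> x' \<preceq>\<^bsub>E j\<^esub> y \<and>
          nrm (E j) y \<le> (1 + \<epsilon>) * nrm (E j) x'" for j
      using approx[OF x(2), of "1 / real (Suc (rank j))" j] \<epsilon> by fastforce
    then obtain x' y where x': "\<And>j. x' j \<in> real_part (E j)"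
        "\<And>j. nrm (E j) (x' j \<ominus>\<^bsub>E j\<^esub> x j) < 1 / real (Suc (rank j))"
      and y: "\<And>j. y j \<in> real_part (E j)" "\<And>j. \<ominus>\<^bsub>E j\<^esub> y j \<preceq>\<^bsub>E j\<^esub> x' j" "\<And>j. x' j \<preceq>\<^bsub>E j\<^esub> y j"
        "\<And>j. nrm (E j) (y j) \<le> (1 + \<epsilon>) * nrm (E j) (x' j)" by metis
    obtain K where K: "\<And>j. nrm (E j) (x j) \<le> K" using families_bound[OF x(1)] by blast
    have "nrm (E j) (x' j) \<le> K + 1" for j
    proof -
      have "1 / real (Suc (rank j)) \<le> 1" by simp
      then show ?thesis
        using E.seminorm_le_add[of "x' j" j "x j"] x'[of j] x(2)[of j] K[of j] by (smt (verit) E.real_carrier)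
    qed
    then have x'B: "x' \<in> carrier B" using x' by (intro familiesI[of _ "K + 1"]) auto
    have yB: "y \<in> carrier B" using \<epsilon> y(1) by (intro families_dominated[OF x'B _ y(4)]) auto
    have "((\<lambda>j. 1 / real (Suc (rank j))) \<longlongrightarrow> 0) U"
      using filterlim_compose[OF LIMSEQ_inverse_real_of_nat rank] by (simp add: inverse_eq_divide)
    then have "((\<lambda>j. nrm (E j) (x' j \<ominus>\<^bsub>E j\<^esub> x j)) \<longlongrightarrow> 0) U"
      by (rule tendsto_sandwich[OF _ _ tendsto_const, rotated 2])
        (use x' x in \<open>auto intro!: always_eventually less_imp_le\<close>)
    then have z': "z = cls x'" using cls_eqI[OF x'B x(1)] x(3) by simp
    have yR: "cls y \<in> real_part Y" using yB y by (intro Y_realI)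
    have "cls y \<ominus>\<^bsub>Y\<^esub> z \<in> pos_cone Y" "cls y \<oplus>\<^bsub>Y\<^esub> z \<in> pos_cone Y"
      using y x' yB x'B
      by (auto simp: z' Y_simps E.vle_iff E.order_interval_iff intro!: Y_coneI families_minus_closed families_add)
    moreover have "nrm Y (cls y) \<le> (1 + \<epsilon>) * nrm Y z"
      using limnorm_mono[OF yB x'B y(4)] yB x'B by (simp add: z' Y_simps)
    ultimately show "\<exists>y\<in>real_part Y. \<ominus>\<^bsub>Y\<^esub> y \<preceq>\<^bsub>Y\<^esub> z \<and> z \<preceq>\<^bsub>Y\<^esub> y \<and> nrm Y y \<le> (1 + \<epsilon>) * nrm Y z"
      using yR z by (intro bexI[of _ "cls y"]) (auto simp: Y.order_interval_iff Y.vle_iff)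
  qed
qed

end

section \<open>Bochner spaces\<close>

lemma powr_convex_nonneg:
  fixes a b s t p :: real
  assumes "0 \<le> a" "0 \<le> b" "0 \<le> s" "0 \<le> t" "s + t = 1" "1 \<le> p"
  shows "(s * a + t * b) powr p \<le> s * a powr p + t * b powr p"
proof -
  \<comment> \<open>Covers the boundary: when \<open>a\<close> or \<open>b\<close> vanishes, the
    claim reduces to \<open>c powr p \<le> c\<close> on the unit interval.\<close>
  have shrink: "(c * d) powr p \<le> c * d powr p" if "0 \<le> c" "c \<le> 1" "0 \<le> d" for c d :: real
  proof -
    have "c powr p \<le> c powr 1" using that assms(6) powr_mono'[of 1 p c] by (cases "c = 0") auto
    then show ?thesis using that by (simp add: powr_mult mult_right_mono)
  qed
  have "s = 1 - t" using assms(5) by simp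
  consider "a = 0" | "b = 0" | "a > 0" "b > 0" using assms by fastforce
  then show ?thesis
  proof cases
    case 3
    then show ?thesis
      using convex_onD[OF powr_convex[OF assms(6)], of t a b] assms(3-4) \<open>s = 1 - t\<close> by simp
  qed (use shrink[of t b] shrink[of s a] assms in auto)
qed

lemma add_powr_le:
  fixes a b p :: real
  assumes "0 \<le> a" "0 \<le> b" "0 \<le> p"
  shows "(a + b) powr p \<le> 2 powr p * (a powr p + b powr p)"
proof -
  have "(a + b) powr p \<le> (2 * max a b) powr p" using assms by (intro powr_mono2) auto
  also have "\<dots> = 2 powr p * max a b powr p" using assms by (simp add: powr_mult)
  also have "max a b powr p \<le> a powr p + b powr p" by (auto simp: max_def)
  finally show ?thesis by simp
qed

text \<open>Convexity of the power function is applied, with the norms \<open>A\<close> and \<open>B\<close> of the summands, to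
  \<open>(a + b) / (A + B) = A / (A + B) \<cdot> a / A + B / (A + B) \<cdot> b / B\<close>.\<close>

lemma minkowski:
  fixes f g :: "'w \<Rightarrow> real"
  assumes p: "1 \<le> p" and f: "integrable M (\<lambda>x. f x powr p)" "f \<in> borel_measurable M" "\<And>x. 0 \<le> f x"
    and g: "integrable M (\<lambda>x. g x powr p)" "g \<in> borel_measurable M" "\<And>x. 0 \<le> g x"
  shows "integrable M (\<lambda>x. (f x + g x) powr p)"
    and "(\<integral>x. (f x + g x) powr p \<partial>M) powr (1 / p) \<le>
      (\<integral>x. f x powr p \<partial>M) powr (1 / p) + (\<integral>x. g x powr p \<partial>M) powr (1 / p)"
proof -
  note [measurable] = f(2) g(2)
  show int: "integrable M (\<lambda>x. (f x + g x) powr p)"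
  proof (rule Bochner_Integration.integrable_bound)
    show "integrable M (\<lambda>x. 2 powr p * (f x powr p + g x powr p))" using f g by simp
    show "AE x in M. norm ((f x + g x) powr p) \<le> norm (2 powr p * (f x powr p + g x powr p))"
      using add_powr_le[OF f(3) g(3)] p by simp
  qed measurable
  define A where "A = (\<integral>x. f x powr p \<partial>M) powr (1 / p)"
  define B where "B = (\<integral>x. g x powr p \<partial>M) powr (1 / p)"
  have AB: "0 \<le> A" "0 \<le> B" by (simp_all add: A_def B_def)
  have Ap: "(\<integral>x. f x powr p \<partial>M) = A powr p" and Bp: "(\<integral>x. g x powr p \<partial>M) = B powr p"
    using p by (simp_all add: A_def B_def powr_powr)
  show "(\<integral>x. (f x + g x) powr p \<partial>M) powr (1 / p) \<le> A + B"
  proof (cases "A = 0 \<or> B = 0")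
    case True
    \<comment> \<open>A function of norm zero cannot be normalised, but it vanishes almost
      everywhere and drops out of the integral.\<close>
    have eq: "(\<integral>x. (u x + v x) powr p \<partial>M) = (\<integral>x. v x powr p \<partial>M)"
      if "(\<integral>x. u x powr p \<partial>M) = 0" "integrable M (\<lambda>x. u x powr p)" "u \<in> borel_measurable M"
        "v \<in> borel_measurable M" for u v :: "'w \<Rightarrow> real"
    proof -
      have "AE x in M. u x powr p = 0"
        using that by (subst (asm) integral_nonneg_eq_0_iff_AE) auto
      then show ?thesis using that(3,4) by (intro integral_cong_AE) auto
    qed
    show ?thesis
    proof (cases "A = 0")
      case True
      then have "(\<integral>x. (f x + g x) powr p \<partial>M) = (\<integral>x. g x powr p \<partial>M)"
        using f g Ap p by (intro eq) auto
      then show ?thesis using True by (simp add: B_def)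
    next
      case False
      then have "(\<integral>x. (g x + f x) powr p \<partial>M) = (\<integral>x. f x powr p \<partial>M)"
        using f g Bp p \<open>A = 0 \<or> B = 0\<close> by (intro eq) auto
      then show ?thesis using AB by (simp add: A_def add.commute)
    qed
  next
    case False
    then have pos: "A > 0" "B > 0" using AB by auto
    define s where "s = A / (A + B)"
    have s: "0 \<le> s" "0 \<le> 1 - s" "1 - s = B / (A + B)" using pos by (auto simp: s_def field_simps)
    have "(f x + g x) powr p \<le> (A + B) powr p * (s * (f x powr p / A powr p) + (1 - s) * (g x powr p / B powr p))"
      for x
    proof -
      have "f x + g x = (A + B) * (s * (f x / A) + (1 - s) * (g x / B))"
      proof -
        have "(A + B) * s = A" using pos by (simp add: s_def)
        moreover have "(A + B) * (1 - s) = B" using pos by (simp add: s(3))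
        moreover have "(A + B) * (s * (f x / A) + (1 - s) * (g x / B)) =
            ((A + B) * s) * (f x / A) + ((A + B) * (1 - s)) * (g x / B)" by (simp only: distrib_left mult.assoc)
        ultimately show ?thesis using pos by simp
      qed
      then have "(f x + g x) powr p = (A + B) powr p * (s * (f x / A) + (1 - s) * (g x / B)) powr p"
        using pos s f(3) g(3) by (simp add: powr_mult)
      also have "\<dots> \<le> (A + B) powr p * (s * (f x / A) powr p + (1 - s) * (g x / B) powr p)"
        using pos s f(3) g(3) p by (intro mult_left_mono powr_convex_nonneg) auto
      finally show ?thesis using pos f(3) g(3) by (simp add: powr_divide)
    qed
    then have "(\<integral>x. (f x + g x) powr p \<partial>M) \<le>
        (\<integral>x. (A + B) powr p * (s * (f x powr p / A powr p) + (1 - s) * (g x powr p / B powr p)) \<partial>M)"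
      using int f g by (intro integral_mono) auto
    also have "\<dots> = (A + B) powr p * (s * (A powr p / A powr p) + (1 - s) * (B powr p / B powr p))"
      using f g by (simp add: Ap Bp)
    also have "\<dots> = (A + B) powr p" using pos by simp
    finally have "(\<integral>x. (f x + g x) powr p \<partial>M) powr (1 / p) \<le> ((A + B) powr p) powr (1 / p)"
      using p by (intro powr_mono2) auto
    then show ?thesis using pos p by (simp add: powr_powr)
  qed
qed

text \<open>Hoelder's inequality with dual factor \<open>k powr (p - 1)\<close>, which has norm 1
  for the conjugate exponent because the integral of \<open>k powr p\<close> is 1. It follows from
  Young's inequality after dividing \<open>b\<close> by its norm.\<close>

lemma hoelder_normalized:
  fixes k b :: "'w \<Rightarrow> real"
  assumes p: "1 < p" and k: "integrable M (\<lambda>x. k x powr p)" "k \<in> borel_measurable M" "\<And>x. 0 \<le> k x"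
      "(\<integral>x. k x powr p \<partial>M) = 1"
    and b: "integrable M (\<lambda>x. b x powr p)" "b \<in> borel_measurable M" "\<And>x. 0 \<le> b x"
  shows "integrable M (\<lambda>x. k x powr (p - 1) * b x)"
    and "(\<integral>x. k x powr (p - 1) * b x \<partial>M) \<le> (\<integral>x. b x powr p \<partial>M) powr (1 / p)"
proof -
  note [measurable] = k(2) b(2)
  \<comment> \<open>The conjugate exponent; \<open>(p - 1) * q = p\<close> turns the
    \<open>q\<close>-th power of \<open>k powr (p - 1)\<close> into \<open>k powr p\<close>.\<close>
  define q where "q = p / (p - 1)"
  have q: "q > 1" "1 / q + 1 / p = 1" "(p - 1) * q = p" using p by (auto simp: q_def field_simps)
  have young: "k x powr (p - 1) * (b x / c) \<le> k x powr p / q + b x powr p / c powr p / p" if "c > 0" for c x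
    using Youngs_inequality[of q p "k x powr (p - 1)" "b x / c"] q p that k(3) b(3)
    by (simp add: powr_powr powr_divide)
  show int: "integrable M (\<lambda>x. k x powr (p - 1) * b x)"
  proof (rule Bochner_Integration.integrable_bound)
    show "integrable M (\<lambda>x. k x powr p / q + b x powr p / p)" using k b by simp
    show "AE x in M. norm (k x powr (p - 1) * b x) \<le> norm (k x powr p / q + b x powr p / p)"
      using young[of 1] b(3) q p by (simp add: abs_of_nonneg)
  qed measurable
  define c where "c = (\<integral>x. b x powr p \<partial>M) powr (1 / p)"
  have cp: "(\<integral>x. b x powr p \<partial>M) = c powr p" using p by (simp add: c_def powr_powr)
  show "(\<integral>x. k x powr (p - 1) * b x \<partial>M) \<le> c"
  proof (cases "c = 0")
    case True
    then have "AE x in M. b x powr p = 0"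
      using cp p b by (subst integral_nonneg_eq_0_iff_AE[symmetric]) auto
    then have "(\<integral>x. k x powr (p - 1) * b x \<partial>M) = (\<integral>x. 0 \<partial>M)"
      by (intro integral_cong_AE) auto
    then show ?thesis using True by simp
  next
    case False
    then have c: "c > 0" by (simp add: c_def less_le)
    have "(\<integral>x. k x powr (p - 1) * (b x / c) \<partial>M) \<le> (\<integral>x. k x powr p / q + b x powr p / c powr p / p \<partial>M)"
      using young[OF c] int k b by (intro integral_mono) auto
    also have "\<dots> = 1 / q + 1 / p" using k b c by (simp add: cp)
    finally have "(\<integral>x. k x powr (p - 1) * b x \<partial>M) / c \<le> 1" by (simp add: q)
    then show ?thesis using c by simp
  qed
qed

subsection \<open>Strong measurability\<close>

context complex_normed_space begin

lemma strongly_measurable_iff: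
  "strongly_measurable \<Omega> X f \<longleftrightarrow> f \<in> space \<Omega> \<rightarrow> carrier X \<and>
     (\<exists>s. (\<forall>n. simple_function \<Omega> (s n) \<and> s n \<in> space \<Omega> \<rightarrow> carrier X) \<and>
          (\<forall>\<omega>\<in>space \<Omega>. (\<lambda>n. nrm X (s n \<omega> \<ominus> f \<omega>)) \<longlonglongrightarrow> 0))"
proof -
  have eq: "(\<lambda>n. ndist X (s n \<omega>) (f \<omega>)) = (\<lambda>n. nrm X (s n \<omega> \<ominus> f \<omega>))"
    if "f \<in> space \<Omega> \<rightarrow> carrier X" "\<forall>n. s n \<in> space \<Omega> \<rightarrow> carrier X" "\<omega> \<in> space \<Omega>"
    for s :: "nat \<Rightarrow> _" and \<omega>
    using that by (auto simp: ndist_def fun_eq_iff)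
  show ?thesis
    unfolding strongly_measurable_def
    by (rule conj_cong[OF refl], rule ex_cong1, rule conj_cong[OF refl], rule ball_cong[OF refl])
      (subst eq, simp_all)
qed

lemma strongly_measurableE:
  assumes "strongly_measurable \<Omega> X f"
  obtains s where "\<And>n. simple_function \<Omega> (s n)" "\<And>n \<omega>. \<omega> \<in> space \<Omega> \<Longrightarrow> s n \<omega> \<in> carrier X"
    "\<And>\<omega>. \<omega> \<in> space \<Omega> \<Longrightarrow> (\<lambda>n. nrm X (s n \<omega> \<ominus> f \<omega>)) \<longlonglongrightarrow> 0"
  using assms unfolding strongly_measurable_iff by blast

lemma strongly_measurableI:
  assumes "\<And>\<omega>. \<omega> \<in> space \<Omega> \<Longrightarrow> f \<omega> \<in> carrier X" "\<And>n. simple_function \<Omega> (s n)"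
    "\<And>n \<omega>. \<omega> \<in> space \<Omega> \<Longrightarrow> s n \<omega> \<in> carrier X"
    "\<And>\<omega>. \<omega> \<in> space \<Omega> \<Longrightarrow> (\<lambda>n. nrm X (s n \<omega> \<ominus> f \<omega>)) \<longlonglongrightarrow> 0"
  shows "strongly_measurable \<Omega> X f"
  unfolding strongly_measurable_iff using assms by blast

lemma strongly_measurable_simple:
  assumes "simple_function \<Omega> s" "\<And>\<omega>. \<omega> \<in> space \<Omega> \<Longrightarrow> s \<omega> \<in> carrier X"
  shows "strongly_measurable \<Omega> X s"
  using assms by (intro strongly_measurableI[of \<Omega> s "\<lambda>_. s"]) (auto simp: a_minus_def M.r_neg)

lemma strongly_measurable_nrm:
  assumes f: "strongly_measurable \<Omega> X f"
  shows "(\<lambda>\<omega>. nrm X (f \<omega>)) \<in> borel_measurable \<Omega>"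
proof -
  have fc: "f \<omega> \<in> carrier X" if "\<omega> \<in> space \<Omega>" for \<omega>
    using f that by (auto simp: strongly_measurable_iff)
  obtain s where s: "\<And>n. simple_function \<Omega> (s n)" "\<And>n \<omega>. \<omega> \<in> space \<Omega> \<Longrightarrow> s n \<omega> \<in> carrier X"
    "\<And>\<omega>. \<omega> \<in> space \<Omega> \<Longrightarrow> (\<lambda>n. nrm X (s n \<omega> \<ominus> f \<omega>)) \<longlonglongrightarrow> 0"
    by (rule strongly_measurableE[OF f]) blast
  show ?thesis
  proof (rule borel_measurable_LIMSEQ_real)
    show "(\<lambda>\<omega>. nrm X (s n \<omega>)) \<in> borel_measurable \<Omega>" for n
      by (rule borel_measurable_simple_function[OF simple_function_compose1[OF s(1)]])
    fix \<omega> assume \<omega>: "\<omega> \<in> space \<Omega>"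
    have "(\<lambda>n. nrm X (s n \<omega>) - nrm X (f \<omega>)) \<longlonglongrightarrow> 0"
      using seminorm_diff_le s(2)[OF \<omega>] fc[OF \<omega>] s(3)[OF \<omega>]
      by (intro Lim_null_comparison[OF _ s(3)[OF \<omega>]]) auto
    then show "(\<lambda>n. nrm X (s n \<omega>)) \<longlonglongrightarrow> nrm X (f \<omega>)" by (simp add: LIM_zero_iff)
  qed
qed

text \<open>Lipschitz maps carry approximating simple functions to approximating simple functions.
  Sums, fixed scalar multiples and real parts are instances.\<close>

lemma strongly_measurable_compose2:
  assumes f: "strongly_measurable \<Omega> X f" and g: "strongly_measurable \<Omega> X g"
    and H: "\<And>a b. a \<in> carrier X \<Longrightarrow> b \<in> carrier X \<Longrightarrow> H a b \<in> carrier X"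
    and lip: "\<And>a b a' b'. \<lbrakk>a \<in> carrier X; b \<in> carrier X; a' \<in> carrier X; b' \<in> carrier X\<rbrakk> \<Longrightarrow>
      nrm X (H a b \<ominus> H a' b') \<le> K * (nrm X (a \<ominus> a') + nrm X (b \<ominus> b'))"
  shows "strongly_measurable \<Omega> X (\<lambda>\<omega>. H (f \<omega>) (g \<omega>))"
proof -
  have fc: "f \<omega> \<in> carrier X" and gc: "g \<omega> \<in> carrier X" if "\<omega> \<in> space \<Omega>" for \<omega>
    using f g that by (auto simp: strongly_measurable_iff)
  obtain s where s: "\<And>n. simple_function \<Omega> (s n)" "\<And>n \<omega>. \<omega> \<in> space \<Omega> \<Longrightarrow> s n \<omega> \<in> carrier X"
    "\<And>\<omega>. \<omega> \<in> space \<Omega> \<Longrightarrow> (\<lambda>n. nrm X (s n \<omega> \<ominus> f \<omega>)) \<longlonglongrightarrow> 0"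
    by (rule strongly_measurableE[OF f]) blast
  obtain t where t: "\<And>n. simple_function \<Omega> (t n)" "\<And>n \<omega>. \<omega> \<in> space \<Omega> \<Longrightarrow> t n \<omega> \<in> carrier X"
    "\<And>\<omega>. \<omega> \<in> space \<Omega> \<Longrightarrow> (\<lambda>n. nrm X (t n \<omega> \<ominus> g \<omega>)) \<longlonglongrightarrow> 0"
    by (rule strongly_measurableE[OF g]) blast
  show ?thesis
  proof (rule strongly_measurableI)
    show "simple_function \<Omega> (\<lambda>\<omega>. H (s n \<omega>) (t n \<omega>))" for n
      by (rule simple_function_compose2[OF s(1) t(1)])
    fix \<omega> assume \<omega>: "\<omega> \<in> space \<Omega>"
    have "(\<lambda>n. K * (nrm X (s n \<omega> \<ominus> f \<omega>) + nrm X (t n \<omega> \<ominus> g \<omega>))) \<longlonglongrightarrow> K * (0 + 0)"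
      by (intro tendsto_intros s(3) t(3) \<omega>)
    then have "(\<lambda>n. K * (nrm X (s n \<omega> \<ominus> f \<omega>) + nrm X (t n \<omega> \<ominus> g \<omega>))) \<longlonglongrightarrow> 0" by simp
    moreover have "\<forall>\<^sub>F n in sequentially. norm (nrm X (H (s n \<omega>) (t n \<omega>) \<ominus> H (f \<omega>) (g \<omega>)))
        \<le> K * (nrm X (s n \<omega> \<ominus> f \<omega>) + nrm X (t n \<omega> \<ominus> g \<omega>))"
      using lip[OF s(2)[OF \<omega>] t(2)[OF \<omega>] fc[OF \<omega>] gc[OF \<omega>]] H s(2)[OF \<omega>] t(2)[OF \<omega>] fc[OF \<omega>] gc[OF \<omega>]
      by (intro always_eventually) auto
    ultimately show "(\<lambda>n. nrm X (H (s n \<omega>) (t n \<omega>) \<ominus> H (f \<omega>) (g \<omega>))) \<longlonglongrightarrow> 0"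
      by (rule Lim_null_comparison[rotated])
  qed (use H fc gc s t in auto)
qed

lemma strongly_measurable_add:
  assumes "strongly_measurable \<Omega> X f" "strongly_measurable \<Omega> X g"
  shows "strongly_measurable \<Omega> X (\<lambda>\<omega>. f \<omega> \<oplus> g \<omega>)"
  by (rule strongly_measurable_compose2[OF assms, of _ 1]) (auto simp: add_minus_add nrm_add)

lemma strongly_measurable_scale:
  assumes "strongly_measurable \<Omega> X f"
  shows "strongly_measurable \<Omega> X (\<lambda>\<omega>. a \<odot> f \<omega>)"
  by (rule strongly_measurable_compose2[OF assms assms, of "\<lambda>x y. a \<odot> x" "cmod a"])
    (auto simp: nrm_smult mult_left_mono simp flip: scale_minus_right)

text \<open>A scalar that varies with the point is not covered by one Lipschitz map, but a simple
  \<open>k\<close> keeps the approximants simple. The weights are taken simple for this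
  purpose.\<close>

lemma strongly_measurable_scale_simple:
  assumes f: "strongly_measurable \<Omega> X f" and k: "simple_function \<Omega> k"
  shows "strongly_measurable \<Omega> X (\<lambda>\<omega>. k \<omega> \<odot> f \<omega>)"
proof -
  have fc: "f \<omega> \<in> carrier X" if "\<omega> \<in> space \<Omega>" for \<omega>
    using f that by (auto simp: strongly_measurable_iff)
  obtain s where s: "\<And>n. simple_function \<Omega> (s n)" "\<And>n \<omega>. \<omega> \<in> space \<Omega> \<Longrightarrow> s n \<omega> \<in> carrier X"
    "\<And>\<omega>. \<omega> \<in> space \<Omega> \<Longrightarrow> (\<lambda>n. nrm X (s n \<omega> \<ominus> f \<omega>)) \<longlonglongrightarrow> 0"
    by (rule strongly_measurableE[OF f]) blast
  show ?thesis
  proof (rule strongly_measurableI)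
    show "simple_function \<Omega> (\<lambda>\<omega>. k \<omega> \<odot> s n \<omega>)" for n
      by (rule simple_function_compose2[OF k s(1)])
    fix \<omega> assume \<omega>: "\<omega> \<in> space \<Omega>"
    have "(\<lambda>n. nrm X (k \<omega> \<odot> s n \<omega> \<ominus> k \<omega> \<odot> f \<omega>)) = (\<lambda>n. cmod (k \<omega>) * nrm X (s n \<omega> \<ominus> f \<omega>))"
      using s(2)[OF \<omega>] fc[OF \<omega>] by (simp add: nrm_smult flip: scale_minus_right)
    then show "(\<lambda>n. nrm X (k \<omega> \<odot> s n \<omega> \<ominus> k \<omega> \<odot> f \<omega>)) \<longlonglongrightarrow> 0"
      using tendsto_mult_left[OF s(3)[OF \<omega>], of "cmod (k \<omega>)"] by simp
  qed (use fc s in auto)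
qed

lemma strongly_measurable_comp:
  assumes f: "strongly_measurable \<Omega> X f" and \<phi>: "\<phi> \<in> measurable \<Omega>' \<Omega>"
  shows "strongly_measurable \<Omega>' X (\<lambda>\<omega>. f (\<phi> \<omega>))"
proof -
  obtain s where s: "\<And>n. simple_function \<Omega> (s n)" "\<And>n \<omega>. \<omega> \<in> space \<Omega> \<Longrightarrow> s n \<omega> \<in> carrier X"
    "\<And>\<omega>. \<omega> \<in> space \<Omega> \<Longrightarrow> (\<lambda>n. nrm X (s n \<omega> \<ominus> f \<omega>)) \<longlonglongrightarrow> 0"
    by (rule strongly_measurableE[OF f]) blast
  show ?thesis
    using s f measurable_space[OF \<phi>]
    by (intro strongly_measurableI[of _ _ "\<lambda>n \<omega>. s n (\<phi> \<omega>)"] simple_function_comp[OF \<phi>])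
      (auto simp: strongly_measurable_iff)
qed

end

subsection \<open>The normed space \<open>L\<^sup>p\<close>\<close>

locale Lp_space = complex_normed_space X for X :: "('v, 'm) onspace_scheme" (structure) +
  fixes \<mu> :: "'w measure" and p :: real and Z
  defines "Z \<equiv> Lp p \<mu> X"
  assumes p: "1 \<le> p"
begin

abbreviation F where "F \<equiv> Lp_functions p \<mu> X"

lemma functions_iff:
  "f \<in> carrier F \<longleftrightarrow> (\<forall>\<omega>. f \<omega> \<in> carrier X) \<and> strongly_measurable \<mu> X f \<and>
     integrable \<mu> (\<lambda>\<omega>. nrm X (f \<omega>) powr p)"
  by (simp add: Lp_functions_def)

lemma functions_simps:
  "\<zero>\<^bsub>F\<^esub> = (\<lambda>\<omega>. \<zero>)" "f \<oplus>\<^bsub>F\<^esub> g = (\<lambda>\<omega>. f \<omega> \<oplus> g \<omega>)" "a \<odot>\<^bsub>F\<^esub> f = (\<lambda>\<omega>. a \<odot> f \<omega>)"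
  "nrm F f = (\<integral>\<omega>. nrm X (f \<omega>) powr p \<partial>\<mu>) powr (1 / p)"
  by (simp_all only: Lp_functions_def mk_nspace_simps)

lemma functionsD:
  assumes "f \<in> carrier F"
  shows "f \<omega> \<in> carrier X" "strongly_measurable \<mu> X f" "integrable \<mu> (\<lambda>\<omega>. nrm X (f \<omega>) powr p)"
    "(\<lambda>\<omega>. nrm X (f \<omega>)) \<in> borel_measurable \<mu>"
  using assms strongly_measurable_nrm by (auto simp: functions_iff)

lemma functionsI:
  assumes f: "\<And>\<omega>. f \<omega> \<in> carrier X" "strongly_measurable \<mu> X f"
    and g: "integrable \<mu> g" "AE \<omega> in \<mu>. nrm X (f \<omega>) powr p \<le> g \<omega>"
  shows "f \<in> carrier F"
proof -
  have "integrable \<mu> (\<lambda>\<omega>. nrm X (f \<omega>) powr p)"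
    using strongly_measurable_nrm[OF f(2)] g
    by (intro Bochner_Integration.integrable_bound[OF g(1)]) (auto elim!: eventually_mono)
  then show ?thesis using f by (simp add: functions_iff)
qed

lemma functions_dominated:
  assumes f: "\<And>\<omega>. f \<omega> \<in> carrier X" "strongly_measurable \<mu> X f"
    and g: "g \<in> carrier F" and le: "AE \<omega> in \<mu>. nrm X (f \<omega>) \<le> K * nrm X (g \<omega>)"
  shows "f \<in> carrier F"
proof (rule functionsI[OF f])
  show "integrable \<mu> (\<lambda>\<omega>. \<bar>K\<bar> powr p * nrm X (g \<omega>) powr p)" using functionsD(3)[OF g] by simp
  show "AE \<omega> in \<mu>. nrm X (f \<omega>) powr p \<le> \<bar>K\<bar> powr p * nrm X (g \<omega>) powr p"
    using le
  proof eventually_elim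
    case (elim \<omega>)
    have "nrm X (f \<omega>) \<le> \<bar>K\<bar> * nrm X (g \<omega>)"
      using elim functionsD(1)[OF g, of \<omega>]
      by (smt (verit) mult_right_mono seminorm_nonneg)
    then have "nrm X (f \<omega>) powr p \<le> (\<bar>K\<bar> * nrm X (g \<omega>)) powr p"
      using f(1) p by (intro powr_mono2) auto
    then show ?case using functionsD(1)[OF g, of \<omega>] by (simp add: powr_mult)
  qed
qed

lemma Lp_nrm_le:
  assumes "f \<in> carrier F" "integrable \<mu> g" "AE \<omega> in \<mu>. nrm X (f \<omega>) powr p \<le> g \<omega>"
  shows "nrm F f \<le> (\<integral>\<omega>. g \<omega> \<partial>\<mu>) powr (1 / p)"
  unfolding functions_simps
  using assms functionsD(3) p by (intro powr_mono2 integral_mono_AE) auto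

lemma Lp_nrm_mono:
  assumes f: "f \<in> carrier F" and g: "g \<in> carrier F" and K: "0 \<le> K"
    and le: "AE \<omega> in \<mu>. nrm X (f \<omega>) \<le> K * nrm X (g \<omega>)"
  shows "nrm F f \<le> K * nrm F g"
proof -
  have "nrm F f \<le> (\<integral>\<omega>. K powr p * nrm X (g \<omega>) powr p \<partial>\<mu>) powr (1 / p)"
  proof (rule Lp_nrm_le[OF f])
    show "integrable \<mu> (\<lambda>\<omega>. K powr p * nrm X (g \<omega>) powr p)" using functionsD(3)[OF g] by simp
    show "AE \<omega> in \<mu>. nrm X (f \<omega>) powr p \<le> K powr p * nrm X (g \<omega>) powr p"
      using le
    proof eventually_elim
      case (elim \<omega>)
      then have "nrm X (f \<omega>) powr p \<le> (K * nrm X (g \<omega>)) powr p"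
        using functionsD(1)[OF f] p by (intro powr_mono2) auto
      then show ?case using functionsD(1)[OF g, of \<omega>] K by (simp add: powr_mult)
    qed
  qed
  also have "\<dots> = K * nrm F g"
    using K p by (simp add: functions_simps powr_mult powr_powr)
  finally show ?thesis .
qed

lemma functions_add:
  assumes f: "f \<in> carrier F" and g: "g \<in> carrier F"
  shows "(\<lambda>\<omega>. f \<omega> \<oplus> g \<omega>) \<in> carrier F" "nrm F (\<lambda>\<omega>. f \<omega> \<oplus> g \<omega>) \<le> nrm F f + nrm F g"
proof -
  note m = minkowski[OF p functionsD(3,4)[OF f] seminorm_nonneg[OF functionsD(1)[OF f]]
      functionsD(3,4)[OF g] seminorm_nonneg[OF functionsD(1)[OF g]]]
  have le: "nrm X (f \<omega> \<oplus> g \<omega>) powr p \<le> (nrm X (f \<omega>) + nrm X (g \<omega>)) powr p" for \<omega>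
    using functionsD(1)[OF f] functionsD(1)[OF g] p by (intro powr_mono2 nrm_add) auto
  show F: "(\<lambda>\<omega>. f \<omega> \<oplus> g \<omega>) \<in> carrier F"
    using functionsD(1,2)[OF f] functionsD(1,2)[OF g] le
    by (intro functionsI[OF _ _ m(1)] strongly_measurable_add) auto
  show "nrm F (\<lambda>\<omega>. f \<omega> \<oplus> g \<omega>) \<le> nrm F f + nrm F g"
    using Lp_nrm_le[OF F m(1)] le m(2) by (simp add: functions_simps)
qed

lemma functions_scale:
  assumes f: "f \<in> carrier F"
  shows "(\<lambda>\<omega>. a \<odot> f \<omega>) \<in> carrier F" "nrm F (\<lambda>\<omega>. a \<odot> f \<omega>) = cmod a * nrm F f"
proof -
  show "(\<lambda>\<omega>. a \<odot> f \<omega>) \<in> carrier F"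
    using functionsD[OF f] by (intro functions_dominated[OF _ _ f, of _ "cmod a"] strongly_measurable_scale)
      (auto simp: nrm_smult)
  show "nrm F (\<lambda>\<omega>. a \<odot> f \<omega>) = cmod a * nrm F f"
    using functionsD(1)[OF f] p by (simp add: functions_simps nrm_smult powr_mult powr_powr)
qed

lemma functions_zero: "(\<lambda>\<omega>. \<zero>) \<in> carrier F"
  using strongly_measurable_simple[OF simple_function_const, of \<mu> \<zero>] p by (simp add: functions_iff)

lemma functions_seminormed: "complex_seminormed_module F (nrm F)"
proof -
  have "Module.module complex_field F"
    by (rule complex_moduleI)
      (simp_all add: functions_simps functions_add functions_scale functions_zero functionsD(1)
        M.a_ac scale_add_left scale_add_right scale_scale)
  then show ?thesis
    unfolding complex_seminormed_module_def complex_seminormed_module_axioms_def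
    using functions_add functions_scale by (simp add: functions_simps(1-3))
qed

sublocale F: complex_seminormed_module F "nrm F" by (rule functions_seminormed)

sublocale F: seminorm_quotient F "nrm F"
proof
  fix f assume f: "f \<in> carrier F"
  have "nrm F g = nrm F f" if "g \<in> F.cls f" for g
    using that f F.seminorm_null_diff by (auto simp: F.mem_cls)
  then have "nrm F ` F.cls f = {nrm F f}" using F.cls_self[OF f] by blast
  then show "(INF g\<in>F.cls f. nrm F g) = nrm F f" by simp
qed

abbreviation Lcls :: "('w \<Rightarrow> 'v) \<Rightarrow> ('w \<Rightarrow> 'v) set" where "Lcls \<equiv> F.cls"

lemma nrm_eq_0_iff_AE:
  assumes f: "f \<in> carrier F"
  shows "nrm F f = 0 \<longleftrightarrow> (AE \<omega> in \<mu>. f \<omega> = \<zero>)"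
proof -
  have "nrm F f = 0 \<longleftrightarrow> (\<integral>\<omega>. nrm X (f \<omega>) powr p \<partial>\<mu>) = 0" by (simp add: functions_simps)
  also have "\<dots> \<longleftrightarrow> (AE \<omega> in \<mu>. nrm X (f \<omega>) powr p = 0)"
    using functionsD(3)[OF f] by (intro integral_nonneg_eq_0_iff_AE) auto
  also have "\<dots> \<longleftrightarrow> (AE \<omega> in \<mu>. f \<omega> = \<zero>)"
    using functionsD(1)[OF f] nrm_eq_0_iff by simp
  finally show ?thesis .
qed

lemma null_eq: "F.null = {f \<in> carrier F. AE \<omega> in \<mu>. f \<omega> = \<zero>}"
  using nrm_eq_0_iff_AE by (auto simp: F.null_def)

lemma Z_eq: "Z = ordered_by F.Q
    {A \<in> carrier F.Q. \<exists>f\<in>A. AE \<omega> in \<mu>. f \<omega> \<in> real_part X}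
    {A \<in> carrier F.Q. \<exists>f\<in>A. AE \<omega> in \<mu>. f \<omega> \<in> pos_cone X}"
  unfolding Z_def Lp_def Let_def null_eq ..

lemma Z_normed: "complex_normed_space Z"
  unfolding Z_eq by (rule ordered_by_normed[OF F.quotient_normed])

sublocale Z: complex_normed_space Z by (rule Z_normed)

lemma Z_carrier: "carrier Z = Lcls ` carrier F"
  unfolding Z_eq ordered_by_simps by (rule F.quotient_carrier)

lemma Z_carrierE: assumes "z \<in> carrier Z" obtains f where "f \<in> carrier F" "z = Lcls f"
  using assms by (auto simp: Z_carrier)

lemma functions_minus:
  assumes "f \<in> carrier F" "g \<in> carrier F"
  shows "f \<ominus>\<^bsub>F\<^esub> g = (\<lambda>\<omega>. f \<omega> \<ominus> g \<omega>)" "(\<lambda>\<omega>. f \<omega> \<ominus> g \<omega>) \<in> carrier F"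
proof -
  have "\<ominus>\<^bsub>F\<^esub> g = (\<lambda>\<omega>. \<ominus> g \<omega>)"
    using functionsD(1)[OF assms(2)] by (simp add: F.uminus_eq_scale[OF assms(2)] uminus_eq_scale functions_simps)
  then show "f \<ominus>\<^bsub>F\<^esub> g = (\<lambda>\<omega>. f \<omega> \<ominus> g \<omega>)" by (simp add: a_minus_def functions_simps)
  then show "(\<lambda>\<omega>. f \<omega> \<ominus> g \<omega>) \<in> carrier F" using F.M.minus_closed[OF assms] by simp
qed

lemma Z_simps:
  "\<zero>\<^bsub>Z\<^esub> = Lcls (\<lambda>\<omega>. \<zero>)"
  "\<lbrakk>f \<in> carrier F; g \<in> carrier F\<rbrakk> \<Longrightarrow> Lcls f \<oplus>\<^bsub>Z\<^esub> Lcls g = Lcls (\<lambda>\<omega>. f \<omega> \<oplus> g \<omega>)"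
  "\<lbrakk>f \<in> carrier F; g \<in> carrier F\<rbrakk> \<Longrightarrow> Lcls f \<ominus>\<^bsub>Z\<^esub> Lcls g = Lcls (\<lambda>\<omega>. f \<omega> \<ominus> g \<omega>)"
  "f \<in> carrier F \<Longrightarrow> a \<odot>\<^bsub>Z\<^esub> Lcls f = Lcls (\<lambda>\<omega>. a \<odot> f \<omega>)"
  "f \<in> carrier F \<Longrightarrow> nrm Z (Lcls f) = nrm F f"
  "f \<in> carrier F \<Longrightarrow> Lcls f \<in> carrier Z"
  unfolding Z_eq ordered_by_simps ordered_by_minus
  by (simp_all add: F.quotient_simps F.quotient_minus functions_minus functions_simps(1-3))

lemma cls_eq_iff_AE:
  assumes f: "f \<in> carrier F" and g: "g \<in> carrier F"
  shows "Lcls f = Lcls g \<longleftrightarrow> (AE \<omega> in \<mu>. f \<omega> = g \<omega>)"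
proof -
  have "f \<omega> \<ominus> g \<omega> = \<zero> \<longleftrightarrow> f \<omega> = g \<omega>" for \<omega>
    using functionsD(1)[OF f, of \<omega>] functionsD(1)[OF g, of \<omega>]
    by (metis M.l_zero M.r_neg a_minus_def minus_add_cancel)
  then show ?thesis
    using f g nrm_eq_0_iff_AE[OF functions_minus(2)[OF f g]]
    by (simp add: F.cls_eq_iff functions_minus(1))
qed

end

subsection \<open>The order of \<open>L\<^sup>p\<close>\<close>

context cone_normed_space begin

text \<open>The projection onto the real part. The imaginary part is
  \<open>re ((- \<i>) \<odot> x)\<close>, so one projection serves for both.\<close>

definition re :: "'v \<Rightarrow> 'v" where
  "re x = (SOME u. u \<in> real_part X \<and> (\<exists>v\<in>real_part X. x = u \<oplus> \<i> \<odot> v))"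

lemma re_eq:
  assumes "u \<in> real_part X" "v \<in> real_part X"
  shows "re (u \<oplus> \<i> \<odot> v) = u"
  unfolding re_def
proof (rule some_equality)
  show "u \<in> real_part X \<and> (\<exists>v'\<in>real_part X. u \<oplus> \<i> \<odot> v = u \<oplus> \<i> \<odot> v')"
    by (rule conjI[OF assms(1) bexI[OF refl assms(2)]])
  fix u' assume "u' \<in> real_part X \<and> (\<exists>v'\<in>real_part X. u \<oplus> \<i> \<odot> v = u' \<oplus> \<i> \<odot> v')"
  then obtain v' where "u' \<in> real_part X" "v' \<in> real_part X" "u \<oplus> \<i> \<odot> v = u' \<oplus> \<i> \<odot> v'" by blast
  then show "u' = u" using decomposition_unique[OF assms, of u' v'] by simp
qed

lemma re_im:
  assumes "x \<in> carrier X"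
  shows "x = re x \<oplus> \<i> \<odot> re ((- \<i>) \<odot> x)"
proof -
  obtain u v where uv: "u \<in> real_part X" "v \<in> real_part X" "x = u \<oplus> \<i> \<odot> v"
    using real_decomposition[OF assms] by blast
  have "(- \<i>) \<odot> x = (- \<i>) \<odot> u \<oplus> v" using uv by (simp add: scale_add_right scale_scale)
  also have "\<dots> = v \<oplus> \<i> \<odot> (\<ominus> u)"
    using uv by (simp add: uminus_eq_scale scale_scale M.a_comm real_uminus)
  finally have "re ((- \<i>) \<odot> x) = v" using uv by (simp add: re_eq real_uminus)
  then show ?thesis using uv by (simp add: re_eq)
qed

lemma re_real [simp]: assumes "x \<in> carrier X" shows "re x \<in> real_part X"
  using real_decomposition[OF assms] re_eq by auto

lemma re_of_real: "x \<in> real_part X \<Longrightarrow> re x = x"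
  using re_eq[OF _ real_zero, of x] by simp

lemma nrm_re_le: assumes "x \<in> carrier X" shows "nrm X (re x) \<le> nrm X x"
  using real_decomposition[OF assms] re_eq real_nrm by auto

lemma re_minus:
  assumes "x \<in> carrier X" "y \<in> carrier X"
  shows "re (x \<ominus> y) = re x \<ominus> re y"
proof -
  obtain u v u' v' where uv: "u \<in> real_part X" "v \<in> real_part X" "x = u \<oplus> \<i> \<odot> v"
    "u' \<in> real_part X" "v' \<in> real_part X" "y = u' \<oplus> \<i> \<odot> v'"
    using real_decomposition[OF assms(1)] real_decomposition[OF assms(2)] by blast
  then have "x \<ominus> y = (u \<ominus> u') \<oplus> \<i> \<odot> (v \<ominus> v')"
    by (simp add: add_minus_add scale_minus_right)
  then show ?thesis using uv by (simp add: re_eq real_minus)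
qed

lemma nrm_re_minus_le:
  "\<lbrakk>x \<in> carrier X; y \<in> carrier X\<rbrakk> \<Longrightarrow> nrm X (re x \<ominus> re y) \<le> nrm X (x \<ominus> y)"
  using nrm_re_le[of "x \<ominus> y"] by (simp add: re_minus)

lemma strongly_measurable_re:
  assumes "strongly_measurable \<Omega> X f"
  shows "strongly_measurable \<Omega> X (\<lambda>\<omega>. re (f \<omega>))"
  by (rule strongly_measurable_compose2[OF assms assms, of "\<lambda>x y. re x" 1])
    (auto simp: add_increasing2 nrm_re_minus_le)

end

text \<open>Density of simple functions with values in a prescribed set \<open>S\<close>. Pointwise
  approximants need not converge in Lp; cutting them to zero where they exceed twice the norm of
  \<open>f\<close> provides a dominating function, and \<open>\<zero> \<in> S\<close> keeps the
  values in \<open>S\<close>.\<close>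

lemma (in Lp_space) exists_simple_approximation:
  assumes f: "f \<in> carrier F" and \<delta>: "0 < \<delta>"
    and s: "\<And>n. simple_function \<mu> (s n)" "\<And>n \<omega>. \<omega> \<in> space \<mu> \<Longrightarrow> s n \<omega> \<in> S"
      "\<And>\<omega>. \<omega> \<in> space \<mu> \<Longrightarrow> (\<lambda>n. nrm X (s n \<omega> \<ominus> f \<omega>)) \<longlonglongrightarrow> 0"
    and S: "\<zero> \<in> S" "S \<subseteq> carrier X"
  obtains g where "simple_function \<mu> g" "\<And>\<omega>. g \<omega> \<in> S" "g \<in> carrier F" "nrm F (\<lambda>\<omega>. g \<omega> \<ominus> f \<omega>) < \<delta>"
proof -
  define g where "g n \<omega> = (if \<omega> \<in> space \<mu> \<and> nrm X (s n \<omega>) \<le> 2 * nrm X (f \<omega>) then s n \<omega> else \<zero>)"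
    for n \<omega>
  have fc: "f \<omega> \<in> carrier X" for \<omega> using functionsD(1)[OF f] .
  have sc: "s n \<omega> \<in> carrier X" if "\<omega> \<in> space \<mu>" for n \<omega> using s(2)[OF that] S(2) by blast
  have gS: "g n \<omega> \<in> S" for n \<omega> using s(2) S(1) by (auto simp: g_def)
  have gc: "g n \<omega> \<in> carrier X" for n \<omega> using gS S(2) by blast
  have [measurable]: "(\<lambda>\<omega>. nrm X (s n \<omega>)) \<in> borel_measurable \<mu>" for n
    by (rule borel_measurable_simple_function[OF simple_function_compose1[OF s(1)]])
  note [measurable] = functionsD(4)[OF f]
  have g_simple: "simple_function \<mu> (g n)" for n
    unfolding g_def by (intro simple_function_If s(1) simple_function_const) measurable
  have g_le: "nrm X (g n \<omega>) \<le> 2 * nrm X (f \<omega>)" for n \<omega>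
    using seminorm_nonneg[OF fc, of \<omega>] by (simp add: g_def)
  have gF: "g n \<in> carrier F" for n
    using gc g_le by (intro functions_dominated[OF _ strongly_measurable_simple[OF g_simple] f, where K = 2]) auto
  have dF: "(\<lambda>\<omega>. g n \<omega> \<ominus> f \<omega>) \<in> carrier F" for n by (rule functions_minus[OF gF f])
  have lim: "(\<lambda>n. nrm X (g n \<omega> \<ominus> f \<omega>) powr p) \<longlonglongrightarrow> 0" if \<omega>: "\<omega> \<in> space \<mu>" for \<omega>
  proof -
    have "(\<lambda>n. nrm X (g n \<omega> \<ominus> f \<omega>)) \<longlonglongrightarrow> 0"
    proof (cases "f \<omega> = \<zero>")
      case True
      then have "g n \<omega> = \<zero>" for n
      proof -
        have "nrm X (s n \<omega>) \<le> 0 \<Longrightarrow> s n \<omega> = \<zero>"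
          by (metis antisym nrm_eq_0_iff seminorm_nonneg sc[OF \<omega>])
        then show ?thesis using True by (simp add: g_def)
      qed
      then show ?thesis using True by simp
    next
      case False
      then have "0 < nrm X (f \<omega>)" using nrm_eq_0_iff[OF fc] seminorm_nonneg[OF fc] by (simp add: less_le)
      \<comment> \<open>Where \<open>f\<close> does not vanish, the approximants eventually have
        norm below twice that of \<open>f\<close>, and the cut becomes inactive.\<close>
      then have "\<forall>\<^sub>F n in sequentially. nrm X (s n \<omega> \<ominus> f \<omega>) < nrm X (f \<omega>)"
        using order_tendstoD(2)[OF s(3)[OF \<omega>]] by blast
      then have "\<forall>\<^sub>F n in sequentially. nrm X (s n \<omega> \<ominus> f \<omega>) = nrm X (g n \<omega> \<ominus> f \<omega>)"
      proof eventually_elim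
        case (elim n)
        then have "nrm X (s n \<omega>) \<le> 2 * nrm X (f \<omega>)"
          using seminorm_le_add[OF sc[OF \<omega>, of n] fc[of \<omega>]] by simp
        then show ?case using \<omega> by (simp add: g_def)
      qed
      then show ?thesis by (rule Lim_transform_eventually[OF s(3)[OF \<omega>]])
    qed
    then have "(\<lambda>n. nrm X (g n \<omega> \<ominus> f \<omega>) powr p) \<longlonglongrightarrow> 0 powr p"
      using gc fc p by (intro tendsto_powr' tendsto_const) auto
    then show ?thesis by simp
  qed
  have "(\<lambda>n. \<integral>\<omega>. nrm X (g n \<omega> \<ominus> f \<omega>) powr p \<partial>\<mu>) \<longlonglongrightarrow> (\<integral>\<omega>. 0 \<partial>\<mu>)"
  proof (rule integral_dominated_convergence)
    \<comment> \<open>The factor 3 adds the bound 2 for \<open>g n\<close> to the contribution 1 of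
      \<open>f\<close>.\<close>
    show "integrable \<mu> (\<lambda>\<omega>. 3 powr p * nrm X (f \<omega>) powr p)" using functionsD(3)[OF f] by simp
    show "AE \<omega> in \<mu>. (\<lambda>n. nrm X (g n \<omega> \<ominus> f \<omega>) powr p) \<longlonglongrightarrow> 0" using lim by (rule AE_I2)
    show "AE \<omega> in \<mu>. norm (nrm X (g n \<omega> \<ominus> f \<omega>) powr p) \<le> 3 powr p * nrm X (f \<omega>) powr p" for n
    proof (rule AE_I2)
      fix \<omega>
      have "nrm X (g n \<omega> \<ominus> f \<omega>) \<le> 3 * nrm X (f \<omega>)"
        using seminorm_minus_le[OF gc fc, of n \<omega> \<omega>] g_le[of n \<omega>] by simp
      then have "nrm X (g n \<omega> \<ominus> f \<omega>) powr p \<le> (3 * nrm X (f \<omega>)) powr p"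
        using gc fc p by (intro powr_mono2) auto
      then show "norm (nrm X (g n \<omega> \<ominus> f \<omega>) powr p) \<le> 3 powr p * nrm X (f \<omega>) powr p"
        using fc[of \<omega>] by (simp add: powr_mult)
    qed
    show "(\<lambda>\<omega>. nrm X (g n \<omega> \<ominus> f \<omega>) powr p) \<in> borel_measurable \<mu>" for n
      using functionsD(4)[OF dF[of n]] by measurable
  qed simp
  then have "(\<lambda>n. (\<integral>\<omega>. nrm X (g n \<omega> \<ominus> f \<omega>) powr p \<partial>\<mu>) powr (1 / p)) \<longlonglongrightarrow> 0 powr (1 / p)"
    using p by (intro tendsto_powr' tendsto_const) auto
  then have "(\<lambda>n. nrm F (\<lambda>\<omega>. g n \<omega> \<ominus> f \<omega>)) \<longlonglongrightarrow> 0" by (simp add: functions_simps(4))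
  then obtain n where "nrm F (\<lambda>\<omega>. g n \<omega> \<ominus> f \<omega>) < \<delta>"
    using order_tendstoD(2)[OF _ \<delta>] by (metis (no_types, lifting) eventually_sequentially order_refl)
  then show thesis using that g_simple gS gF by blast
qed

locale Lp_cone = Lp_space X \<mu> p Z + cone_normed_space X
  for X :: "('v, 'm) onspace_scheme" (structure) and \<mu> :: "'w measure" and p :: real and Z
begin

lemma representatives_AE:
  "{A \<in> carrier F.Q. \<exists>f\<in>A. AE \<omega> in \<mu>. P (f \<omega>)} = {Lcls f |f. f \<in> carrier F \<and> (AE \<omega> in \<mu>. P (f \<omega>))}"
proof (intro subset_antisym subsetI)
  fix A assume "A \<in> {A \<in> carrier F.Q. \<exists>f\<in>A. AE \<omega> in \<mu>. P (f \<omega>)}"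
  then obtain f g where fg: "g \<in> carrier F" "A = Lcls g" "f \<in> Lcls g" "AE \<omega> in \<mu>. P (f \<omega>)"
    unfolding F.quotient_carrier by blast
  then have "f \<in> carrier F" "Lcls f = A" using F.cls_cong[of g f] F.mem_cls[of g f] by blast+
  then show "A \<in> {Lcls f |f. f \<in> carrier F \<and> (AE \<omega> in \<mu>. P (f \<omega>))}" using fg(4) by blast
next
  fix A assume "A \<in> {Lcls f |f. f \<in> carrier F \<and> (AE \<omega> in \<mu>. P (f \<omega>))}"
  then obtain f where "f \<in> carrier F" "AE \<omega> in \<mu>. P (f \<omega>)" "A = Lcls f" by blast
  then show "A \<in> {A \<in> carrier F.Q. \<exists>f\<in>A. AE \<omega> in \<mu>. P (f \<omega>)}"
    using F.cls_self[of f] unfolding F.quotient_carrier by blast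
qed

lemma Z_real_part: "real_part Z = {Lcls f |f. f \<in> carrier F \<and> (AE \<omega> in \<mu>. f \<omega> \<in> real_part X)}"
  unfolding Z_eq ordered_by_simps representatives_AE[of "\<lambda>x. x \<in> real_part X"] ..

lemma Z_pos_cone: "pos_cone Z = {Lcls f |f. f \<in> carrier F \<and> (AE \<omega> in \<mu>. f \<omega> \<in> pos_cone X)}"
  unfolding Z_eq representatives_AE[of "\<lambda>x. x \<in> real_part X"] representatives_AE[of "\<lambda>x. x \<in> pos_cone X"]
proof (rule pos_cone_ordered_by[OF F.quotient_normed])
  show "\<zero>\<^bsub>F.Q\<^esub> \<in> {Lcls f |f. f \<in> carrier F \<and> (AE \<omega> in \<mu>. f \<omega> \<in> real_part X)}"
    using real_zero functions_zero unfolding F.quotient_simps(1) functions_simps(1) by fastforce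
qed (auto intro: F.quotient_simps(5) elim!: eventually_mono simp: cone_real)

lemma Z_realI: "f \<in> carrier F \<Longrightarrow> AE \<omega> in \<mu>. f \<omega> \<in> real_part X \<Longrightarrow> Lcls f \<in> real_part Z"
  by (auto simp: Z_real_part)

lemma Z_realE: assumes "z \<in> real_part Z"
  obtains f where "f \<in> carrier F" "AE \<omega> in \<mu>. f \<omega> \<in> real_part X" "z = Lcls f"
  using assms by (auto simp: Z_real_part)

lemma Z_coneI: "f \<in> carrier F \<Longrightarrow> AE \<omega> in \<mu>. f \<omega> \<in> pos_cone X \<Longrightarrow> Lcls f \<in> pos_cone Z"
  by (auto simp: Z_pos_cone)

lemma Z_coneE: assumes "z \<in> pos_cone Z"
  obtains f where "f \<in> carrier F" "AE \<omega> in \<mu>. f \<omega> \<in> pos_cone X" "z = Lcls f"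
  using assms by (auto simp: Z_pos_cone)

lemma functions_re:
  assumes "f \<in> carrier F" shows "(\<lambda>\<omega>. re (f \<omega>)) \<in> carrier F"
  using functionsD[OF assms] nrm_re_le
  by (intro functions_dominated[OF _ strongly_measurable_re assms, where K = 1]) auto

lemma Z_cones: "cone_normed_space Z"
proof unfold_locales
  show "real_part Z \<subseteq> carrier Z" by (auto simp: Z_real_part Z_simps)
  show "\<zero>\<^bsub>Z\<^esub> \<in> real_part Z" "\<zero>\<^bsub>Z\<^esub> \<in> pos_cone Z"
    using functions_zero by (auto simp: Z_simps real_zero cone_zero intro!: Z_realI Z_coneI)
  show "z \<oplus>\<^bsub>Z\<^esub> w \<in> real_part Z" if zw: "z \<in> real_part Z" "w \<in> real_part Z" for z w
  proof -
    obtain f g where fg: "f \<in> carrier F" "AE \<omega> in \<mu>. f \<omega> \<in> real_part X" "z = Lcls f"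
      "g \<in> carrier F" "AE \<omega> in \<mu>. g \<omega> \<in> real_part X" "w = Lcls g" using zw by (metis Z_realE)
    have "AE \<omega> in \<mu>. f \<omega> \<oplus> g \<omega> \<in> real_part X" using fg(2,5) by eventually_elim (rule real_add)
    then show ?thesis using fg by (simp add: Z_simps Z_realI functions_add)
  qed
  show "z \<oplus>\<^bsub>Z\<^esub> w \<in> pos_cone Z" if zw: "z \<in> pos_cone Z" "w \<in> pos_cone Z" for z w
  proof -
    obtain f g where fg: "f \<in> carrier F" "AE \<omega> in \<mu>. f \<omega> \<in> pos_cone X" "z = Lcls f"
      "g \<in> carrier F" "AE \<omega> in \<mu>. g \<omega> \<in> pos_cone X" "w = Lcls g" using zw by (metis Z_coneE)
    have "AE \<omega> in \<mu>. f \<omega> \<oplus> g \<omega> \<in> pos_cone X" using fg(2,5) by eventually_elim (rule cone_add)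
    then show ?thesis using fg by (simp add: Z_simps Z_coneI functions_add)
  qed
  show "complex_of_real a \<odot>\<^bsub>Z\<^esub> z \<in> real_part Z" if z: "z \<in> real_part Z" for z a
  proof -
    obtain f where f: "f \<in> carrier F" "AE \<omega> in \<mu>. f \<omega> \<in> real_part X" "z = Lcls f"
      using z by (metis Z_realE)
    have "AE \<omega> in \<mu>. complex_of_real a \<odot> f \<omega> \<in> real_part X" using f(2) by eventually_elim (rule real_scale)
    then show ?thesis using f by (simp add: Z_simps Z_realI functions_scale)
  qed
  show "complex_of_real a \<odot>\<^bsub>Z\<^esub> z \<in> pos_cone Z" if z: "z \<in> pos_cone Z" and a: "0 \<le> a" for z a
  proof -
    obtain f where f: "f \<in> carrier F" "AE \<omega> in \<mu>. f \<omega> \<in> pos_cone X" "z = Lcls f"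
      using z by (metis Z_coneE)
    have "AE \<omega> in \<mu>. complex_of_real a \<odot> f \<omega> \<in> pos_cone X"
      using f(2) by eventually_elim (rule cone_scale[OF _ a])
    then show ?thesis using f by (simp add: Z_simps Z_coneI functions_scale)
  qed
  show "\<exists>u\<in>real_part Z. \<exists>v\<in>real_part Z. z = u \<oplus>\<^bsub>Z\<^esub> \<i> \<odot>\<^bsub>Z\<^esub> v" if z: "z \<in> carrier Z" for z
  proof -
    obtain f where f: "f \<in> carrier F" "z = Lcls f" using z by (rule Z_carrierE)
    let ?u = "\<lambda>\<omega>. re (f \<omega>)" and ?v = "\<lambda>\<omega>. re ((- \<i>) \<odot> f \<omega>)"
    have uv: "?u \<in> carrier F" "?v \<in> carrier F" using f by (auto intro!: functions_re functions_scale)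
    have "f = (\<lambda>\<omega>. ?u \<omega> \<oplus> \<i> \<odot> ?v \<omega>)" using re_im[OF functionsD(1)[OF f(1)]] by (rule ext)
    then have "z = Lcls ?u \<oplus>\<^bsub>Z\<^esub> \<i> \<odot>\<^bsub>Z\<^esub> Lcls ?v"
      using uv f(2) by (simp add: Z_simps functions_scale)
    moreover have "Lcls ?u \<in> real_part Z" "Lcls ?v \<in> real_part Z"
      using uv functionsD(1)[OF f(1)] by (auto intro!: Z_realI)
    ultimately show ?thesis by blast
  qed
  show "max (nrm Z z) (nrm Z w) \<le> nrm Z (z \<oplus>\<^bsub>Z\<^esub> \<i> \<odot>\<^bsub>Z\<^esub> w)"
    if zw: "z \<in> real_part Z" "w \<in> real_part Z" for z w
  proof -
    obtain f g where fg: "f \<in> carrier F" "AE \<omega> in \<mu>. f \<omega> \<in> real_part X" "z = Lcls f"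
      "g \<in> carrier F" "AE \<omega> in \<mu>. g \<omega> \<in> real_part X" "w = Lcls g" using zw by (metis Z_realE)
    let ?h = "\<lambda>\<omega>. f \<omega> \<oplus> \<i> \<odot> g \<omega>"
    have h: "?h \<in> carrier F" using fg by (intro functions_add functions_scale)
    have "AE \<omega> in \<mu>. nrm X (f \<omega>) \<le> 1 * nrm X (?h \<omega>) \<and> nrm X (g \<omega>) \<le> 1 * nrm X (?h \<omega>)"
      using fg(2,5) by eventually_elim (use real_nrm in auto)
    then have "nrm F f \<le> nrm F ?h" "nrm F g \<le> nrm F ?h"
      using Lp_nrm_mono[OF fg(1) h, of 1] Lp_nrm_mono[OF fg(4) h, of 1] by auto
    then show ?thesis using fg h by (simp add: Z_simps functions_scale)
  qed
  show "nrm Z (z \<ominus>\<^bsub>Z\<^esub> w) \<le> nrm Z (z \<oplus>\<^bsub>Z\<^esub> w)" if zw: "z \<in> pos_cone Z" "w \<in> pos_cone Z" for z w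
  proof -
    obtain f g where fg: "f \<in> carrier F" "AE \<omega> in \<mu>. f \<omega> \<in> pos_cone X" "z = Lcls f"
      "g \<in> carrier F" "AE \<omega> in \<mu>. g \<omega> \<in> pos_cone X" "w = Lcls g" using zw by (metis Z_coneE)
    have "AE \<omega> in \<mu>. nrm X (f \<omega> \<ominus> g \<omega>) \<le> 1 * nrm X (f \<omega> \<oplus> g \<omega>)"
      using fg(2,5) by eventually_elim (use cone_monotone in auto)
    then have "nrm F (\<lambda>\<omega>. f \<omega> \<ominus> g \<omega>) \<le> 1 * nrm F (\<lambda>\<omega>. f \<omega> \<oplus> g \<omega>)"
      using fg by (intro Lp_nrm_mono functions_minus functions_add) auto
    then show ?thesis using fg by (simp add: Z_simps functions_add functions_minus)
  qed
  show "z \<preceq>\<^bsub>Z\<^esub> w \<longleftrightarrow> w \<ominus>\<^bsub>Z\<^esub> z \<in> pos_cone Z" if "z \<in> real_part Z" "w \<in> real_part Z" for z w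
  proof -
    have "pos_cone Z = {A \<in> carrier F.Q. \<exists>f\<in>A. AE \<omega> in \<mu>. f \<omega> \<in> pos_cone X}"
      unfolding Z_pos_cone representatives_AE[of "\<lambda>x. x \<in> pos_cone X"] ..
    then show ?thesis using that by (simp add: Z_eq)
  qed
qed

sublocale Z: cone_normed_space Z by (rule Z_cones)

text \<open>A real step function is dominated value by value.  For an arbitrary element of
  \<open>L\<^sup>p\<close> a measurable choice of dominating values would be needed.\<close>

lemma Z_riesz_approx:
  assumes riesz: "\<And>x \<epsilon>. \<lbrakk>x \<in> real_part X; 0 < \<epsilon>\<rbrakk> \<Longrightarrow>
      \<exists>y\<in>real_part X. \<ominus> y \<preceq> x \<and> x \<preceq> y \<and> nrm X y \<le> (1 + \<epsilon>) * nrm X x"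
    and z: "z \<in> real_part Z" and \<delta>: "0 < \<delta>"
  shows "\<exists>z'\<in>real_part Z. nrm Z (z' \<ominus>\<^bsub>Z\<^esub> z) < \<delta> \<and>
        (\<forall>\<epsilon>>0. \<exists>w\<in>real_part Z. \<ominus>\<^bsub>Z\<^esub> w \<preceq>\<^bsub>Z\<^esub> z' \<and> z' \<preceq>\<^bsub>Z\<^esub> w \<and> nrm Z w \<le> (1 + \<epsilon>) * nrm Z z')"
proof -
  obtain f0 where f0: "f0 \<in> carrier F" "AE \<omega> in \<mu>. f0 \<omega> \<in> real_part X" "z = Lcls f0"
    using z by (rule Z_realE)
  \<comment> \<open>Passing to \<open>re\<close> makes the values real everywhere and not only
    almost everywhere.\<close>
  define f where "f \<omega> = re (f0 \<omega>)" for \<omega>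
  have fF: "f \<in> carrier F" unfolding f_def by (rule functions_re[OF f0(1)])
  have fr: "f \<omega> \<in> real_part X" for \<omega> using functionsD(1)[OF f0(1)] by (simp add: f_def)
  have zf: "z = Lcls f"
    using f0 fF by (auto simp: cls_eq_iff_AE f_def re_of_real elim!: eventually_mono)
  obtain s where s: "\<And>n. simple_function \<mu> (s n)" "\<And>n \<omega>. \<omega> \<in> space \<mu> \<Longrightarrow> s n \<omega> \<in> carrier X"
    "\<And>\<omega>. \<omega> \<in> space \<mu> \<Longrightarrow> (\<lambda>n. nrm X (s n \<omega> \<ominus> f \<omega>)) \<longlonglongrightarrow> 0"
    by (rule strongly_measurableE[OF functionsD(2)[OF fF]]) blast
  have lim: "(\<lambda>n. nrm X (re (s n \<omega>) \<ominus> f \<omega>)) \<longlonglongrightarrow> 0" if \<omega>: "\<omega> \<in> space \<mu>" for \<omega>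
  proof (rule Lim_null_comparison[OF _ s(3)[OF \<omega>]], rule always_eventually, rule allI)
    fix n
    show "norm (nrm X (re (s n \<omega>) \<ominus> f \<omega>)) \<le> nrm X (s n \<omega> \<ominus> f \<omega>)"
      using nrm_re_minus_le[OF s(2)[OF \<omega>] real_carrier[OF fr], of n \<omega>] s(2)[OF \<omega>, of n] fr[of \<omega>]
      by (simp add: re_of_real)
  qed
  obtain g where g: "simple_function \<mu> g" "\<And>\<omega>. g \<omega> \<in> real_part X" "g \<in> carrier F"
      "nrm F (\<lambda>\<omega>. g \<omega> \<ominus> f \<omega>) < \<delta>"
    by (rule exists_simple_approximation[OF fF \<delta> simple_function_compose1[OF s(1)] re_real lim real_zero real_subset])
      (use s(2) in auto)
  have "\<exists>w\<in>real_part Z. \<ominus>\<^bsub>Z\<^esub> w \<preceq>\<^bsub>Z\<^esub> Lcls g \<and> Lcls g \<preceq>\<^bsub>Z\<^esub> w \<and> nrm Z w \<le> (1 + \<epsilon>) * nrm Z (Lcls g)"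
    if \<epsilon>: "0 < \<epsilon>" for \<epsilon>
  proof -
    \<comment> \<open>The dominating element depends only on the value, so its composition with the
      simple \<open>g\<close> is again simple.\<close>
    obtain d where d: "\<And>x. x \<in> real_part X \<Longrightarrow> d x \<in> real_part X \<and> \<ominus> (d x) \<preceq> x \<and> x \<preceq> d x \<and>
        nrm X (d x) \<le> (1 + \<epsilon>) * nrm X x"
      using riesz[OF _ \<epsilon>] by metis
    have hF: "(\<lambda>\<omega>. d (g \<omega>)) \<in> carrier F"
      using d g(2) by (intro functions_dominated[OF _ strongly_measurable_simple[OF simple_function_compose1[OF g(1)]] g(3), where K = "1 + \<epsilon>"])
        auto
    have "Lcls (\<lambda>\<omega>. d (g \<omega>)) \<in> real_part Z" "Lcls g \<in> real_part Z"
      using d g hF by (auto intro!: Z_realI)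
    moreover have "d (g \<omega>) \<ominus> g \<omega> \<in> pos_cone X" "d (g \<omega>) \<oplus> g \<omega> \<in> pos_cone X" for \<omega>
      using d[OF g(2)[of \<omega>]] vle_iff[OF g(2)] order_interval_iff[OF g(2)] by blast+
    then have "Lcls (\<lambda>\<omega>. d (g \<omega>)) \<ominus>\<^bsub>Z\<^esub> Lcls g \<in> pos_cone Z"
      "Lcls (\<lambda>\<omega>. d (g \<omega>)) \<oplus>\<^bsub>Z\<^esub> Lcls g \<in> pos_cone Z"
      using g(3) hF by (simp_all add: Z_simps Z_coneI functions_minus functions_add)
    moreover have "nrm F (\<lambda>\<omega>. d (g \<omega>)) \<le> (1 + \<epsilon>) * nrm F g"
      using d[OF g(2)] \<epsilon> by (intro Lp_nrm_mono hF g(3)) auto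
    ultimately show ?thesis
      using hF g(3) by (intro bexI[of _ "Lcls (\<lambda>\<omega>. d (g \<omega>))"]) (auto simp: Z.order_interval_iff Z.vle_iff Z_simps)
  qed
  then show ?thesis
    using g fF by (intro bexI[of _ "Lcls g"]) (auto simp: zf Z_simps functions_minus intro!: Z_realI)
qed

end

section \<open>Isometries of quotients\<close>

definition (in complex_seminormed_module) lift :: "('v \<Rightarrow> 'v) \<Rightarrow> 'v set \<Rightarrow> 'v set" where
  "lift T A = null +> T (SOME x. x \<in> A)"

text \<open>Preservation of distances makes the arbitrary representative harmless: representatives
  at distance zero have images at distance zero.\<close>

lemma (in complex_seminormed_module) lift_cls:
  assumes T: "\<And>x. x \<in> carrier X \<Longrightarrow> T x \<in> carrier X"
    "\<And>x y. x \<in> carrier X \<Longrightarrow> y \<in> carrier X \<Longrightarrow> \<nu> (T x \<ominus> T y) = \<nu> (x \<ominus> y)"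
    and x: "x \<in> carrier X"
  shows "lift T (null +> x) = null +> T x"
proof -
  let ?y = "SOME y. y \<in> null +> x"
  have "?y \<in> null +> x" using cls_self[OF x] by (rule someI)
  then have "?y \<in> carrier X" "\<nu> (?y \<ominus> x) = 0" using x by (simp_all add: mem_cls)
  then show ?thesis unfolding lift_def using T x by (simp add: cls_eq_iff)
qed

context Lp_space begin

definition pullback :: "('w \<Rightarrow> 'w) \<Rightarrow> ('w \<Rightarrow> 'v) set \<Rightarrow> ('w \<Rightarrow> 'v) set" where
  "pullback \<phi> = F.lift (\<lambda>f \<omega>. f (\<phi> \<omega>))"

context
  fixes \<phi> :: "'w \<Rightarrow> 'w"
  assumes \<phi>: "\<phi> \<in> measurable \<mu> \<mu>" and distr: "distr \<mu> \<mu> \<phi> = \<mu>"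
begin

lemma functions_pullback:
  assumes f: "f \<in> carrier F"
  shows "(\<lambda>\<omega>. f (\<phi> \<omega>)) \<in> carrier F" "nrm F (\<lambda>\<omega>. f (\<phi> \<omega>)) = nrm F f"
proof -
  have m: "(\<lambda>\<omega>. nrm X (f \<omega>) powr p) \<in> borel_measurable \<mu>" using functionsD(3)[OF f] by simp
  show "(\<lambda>\<omega>. f (\<phi> \<omega>)) \<in> carrier F"
    using functionsD(1-3)[OF f] integrable_distr[OF \<phi>, of "\<lambda>\<omega>. nrm X (f \<omega>) powr p"]
    by (simp add: functions_iff distr strongly_measurable_comp[OF _ \<phi>])
  show "nrm F (\<lambda>\<omega>. f (\<phi> \<omega>)) = nrm F f"
    using integral_distr[OF \<phi> m] by (simp add: functions_simps distr)
qed

lemma pullback_cls: "f \<in> carrier F \<Longrightarrow> pullback \<phi> (Lcls f) = Lcls (\<lambda>\<omega>. f (\<phi> \<omega>))"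
  unfolding pullback_def
proof (rule F.lift_cls)
  fix f g assume fg: "f \<in> carrier F" "g \<in> carrier F"
  show "nrm F ((\<lambda>\<omega>. f (\<phi> \<omega>)) \<ominus>\<^bsub>F\<^esub> (\<lambda>\<omega>. g (\<phi> \<omega>))) = nrm F (f \<ominus>\<^bsub>F\<^esub> g)"
    using fg functions_pullback(2)[OF functions_minus(2)[OF fg]]
    by (simp add: functions_minus functions_pullback)
qed (simp_all add: functions_pullback)

lemma pullback_isometry:
  "z \<in> carrier Z \<Longrightarrow> pullback \<phi> z \<in> carrier Z"
  "\<lbrakk>z \<in> carrier Z; w \<in> carrier Z\<rbrakk> \<Longrightarrow> pullback \<phi> (z \<oplus>\<^bsub>Z\<^esub> w) = pullback \<phi> z \<oplus>\<^bsub>Z\<^esub> pullback \<phi> w"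
  "z \<in> carrier Z \<Longrightarrow> pullback \<phi> (a \<odot>\<^bsub>Z\<^esub> z) = a \<odot>\<^bsub>Z\<^esub> pullback \<phi> z"
  "z \<in> carrier Z \<Longrightarrow> nrm Z (pullback \<phi> z) = nrm Z z"
  by (auto elim!: Z_carrierE simp: Z_simps pullback_cls functions_pullback functions_add functions_scale)

end

end

lemma (in Lp_cone) pullback_positive:
  assumes \<phi>: "\<phi> \<in> measurable \<mu> \<mu>" "distr \<mu> \<mu> \<phi> = \<mu>" and z: "z \<in> pos_cone Z"
  shows "pullback \<phi> z \<in> pos_cone Z"
proof -
  obtain f where f: "f \<in> carrier F" "AE \<omega> in \<mu>. f \<omega> \<in> pos_cone X" "z = Lcls f"
    using z by (rule Z_coneE)
  \<comment> \<open>As \<open>\<phi>\<close> preserves the measure, exceptional null sets pull back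
    to null sets.\<close>
  have "AE \<omega> in distr \<mu> \<mu> \<phi>. f \<omega> \<in> pos_cone X" using f(2) by (simp only: \<phi>(2))
  then have "AE \<omega> in \<mu>. f (\<phi> \<omega>) \<in> pos_cone X" by (rule AE_distrD[OF \<phi>(1)])
  then show ?thesis using f by (simp add: pullback_cls[OF \<phi>] functions_pullback[OF \<phi>] Z_coneI)
qed

context ultraproduct_of_normed begin

definition extension :: "('i \<Rightarrow> 'v \<Rightarrow> 'v) \<Rightarrow> ('i \<Rightarrow> 'v) set \<Rightarrow> ('i \<Rightarrow> 'v) set" where
  "extension T = B.lift (\<lambda>x j. T j (x j))"

context
  fixes T :: "'i \<Rightarrow> 'v \<Rightarrow> 'v"
  assumes closed: "\<And>j x. x \<in> carrier (E j) \<Longrightarrow> T j x \<in> carrier (E j)"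
    and additive: "\<And>j x y. x \<in> carrier (E j) \<Longrightarrow> y \<in> carrier (E j) \<Longrightarrow>
      T j (x \<oplus>\<^bsub>E j\<^esub> y) = T j x \<oplus>\<^bsub>E j\<^esub> T j y"
    and homogeneous: "\<And>j a x. x \<in> carrier (E j) \<Longrightarrow> T j (a \<odot>\<^bsub>E j\<^esub> x) = a \<odot>\<^bsub>E j\<^esub> T j x"
    and isometric: "\<And>j x. x \<in> carrier (E j) \<Longrightarrow> nrm (E j) (T j x) = nrm (E j) x"
begin

lemma families_extension:
  assumes x: "x \<in> carrier B"
  shows "(\<lambda>j. T j (x j)) \<in> carrier B" "limnorm (\<lambda>j. T j (x j)) = limnorm x"
  using families_dominated[OF x, of "\<lambda>j. T j (x j)" 1] closed isometric x
  by (simp_all add: limnorm_def)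

lemma extension_cls: "x \<in> carrier B \<Longrightarrow> extension T (cls x) = cls (\<lambda>j. T j (x j))"
  unfolding extension_def
proof (rule B.lift_cls)
  fix x y assume xy: "x \<in> carrier B" "y \<in> carrier B"
  have "T j (x j) \<ominus>\<^bsub>E j\<^esub> T j (y j) = T j (x j \<ominus>\<^bsub>E j\<^esub> y j)" for j
    using xy by (simp add: a_minus_def E.uminus_eq_scale additive homogeneous closed)
  then show "limnorm ((\<lambda>j. T j (x j)) \<ominus>\<^bsub>B\<^esub> (\<lambda>j. T j (y j))) = limnorm (x \<ominus>\<^bsub>B\<^esub> y)"
    using xy families_extension(2)[OF families_minus_closed[OF xy]]
    by (simp add: families_minus families_extension)
qed (simp_all add: families_extension)

lemma extension_isometry:
  "z \<in> carrier Y \<Longrightarrow> extension T z \<in> carrier Y"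
  "z \<in> carrier Y \<Longrightarrow> nrm Y (extension T z) = nrm Y z"
  by (auto elim!: Y_carrierE simp: Y_simps extension_cls families_extension)

lemma extension_bounded: "bounded_op Y Y (extension T)"
  unfolding bounded_op_def
proof (intro conjI ballI allI)
  show "\<exists>K. \<forall>x\<in>carrier Y. nrm Y (extension T x) \<le> K * nrm Y x"
    by (intro exI[of _ 1]) (simp add: extension_isometry)
next
  fix z w assume "z \<in> carrier Y" "w \<in> carrier Y"
  then show "extension T (z \<oplus>\<^bsub>Y\<^esub> w) = extension T z \<oplus>\<^bsub>Y\<^esub> extension T w"
    by (elim Y_carrierE) (simp add: Y_simps extension_cls families_extension families_add additive)
next
  fix a z assume "z \<in> carrier Y"
  then show "extension T (a \<odot>\<^bsub>Y\<^esub> z) = a \<odot>\<^bsub>Y\<^esub> extension T z"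
    by (elim Y_carrierE) (simp add: Y_simps extension_cls families_extension families_scale homogeneous)
qed (simp add: extension_isometry)

end

end

section \<open>Reiter's condition for amenable groups\<close>

locale haar =
  fixes \<mu> :: "'g::{topological_group_add, t2_space} measure"
  assumes haar: "left_haar_measure \<mu>"
begin

section \<open>Translations and the Haar measure\<close>

lemma sets_haar: "sets \<mu> = sets borel"
  using haar by (simp add: left_haar_measure_def)

lemma space_haar [simp]: "space \<mu> = UNIV"
  using sets_eq_imp_space_eq[OF sets_haar] by simp

lemma measurable_haar: "continuous_on UNIV f \<Longrightarrow> f \<in> borel_measurable \<mu>"
  using borel_measurable_continuous_onI measurable_cong_sets[OF sets_haar refl] by blast

lemma translation_measurable: "(\<lambda>x. t + x) \<in> measurable \<mu> \<mu>"
proof -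
  have "(\<lambda>x. t + x) \<in> borel_measurable (borel :: 'g measure)"
    by (intro borel_measurable_continuous_onI continuous_intros)
  then show ?thesis using measurable_cong_sets[OF sets_haar sets_haar] by blast
qed

lemma translation_distr: "distr \<mu> \<mu> (\<lambda>x. t + x) = \<mu>"
proof (rule measure_eqI)
  fix A assume "A \<in> sets (distr \<mu> \<mu> (\<lambda>x. t + x))"
  then have A: "A \<in> sets \<mu>" by simp
  have "(\<lambda>x. t + x) -` A \<inter> space \<mu> = (+) (- t) ` A"
  proof (intro subset_antisym subsetI)
    fix x assume "x \<in> (\<lambda>x. t + x) -` A \<inter> space \<mu>"
    then show "x \<in> (+) (- t) ` A" by (intro image_eqI[of _ _ "t + x"]) (auto simp: add.assoc[symmetric])
  qed (auto simp: add.assoc[symmetric])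
  then have "emeasure (distr \<mu> \<mu> (\<lambda>x. t + x)) A = emeasure \<mu> ((+) (- t) ` A)"
    using A by (simp add: emeasure_distr translation_measurable)
  also have "\<dots> = emeasure \<mu> A" using haar A by (simp add: left_haar_measure_def sets_haar)
  finally show "emeasure (distr \<mu> \<mu> (\<lambda>x. t + x)) A = emeasure \<mu> A" .
qed simp

lemma integrable_translation:
  fixes f :: "'g \<Rightarrow> real"
  shows "integrable \<mu> f \<Longrightarrow> integrable \<mu> (\<lambda>x. f (t + x))"
  using integrable_distr[OF translation_measurable, of t f] by (simp add: translation_distr)

lemma integral_translation:
  fixes f :: "'g \<Rightarrow> real"
  shows "f \<in> borel_measurable \<mu> \<Longrightarrow> (\<integral>x. f (t + x) \<partial>\<mu>) = (\<integral>x. f x \<partial>\<mu>)"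
  using integral_distr[OF translation_measurable, of f t] by (simp add: translation_distr)

text \<open>Inner regularity on the open set \<open>UNIV\<close>: a nonzero supremum over compact
  sets has a nonzero member, and compact sets have finite measure.\<close>

lemma exists_compact_positive_measure:
  obtains A where "compact A" "0 < emeasure \<mu> A" "emeasure \<mu> A < \<infinity>"
proof -
  have "emeasure \<mu> UNIV = (SUP K\<in>{K. compact K \<and> K \<subseteq> UNIV}. emeasure \<mu> K)"
    and "emeasure \<mu> UNIV \<noteq> 0"
    using haar by (auto simp: left_haar_measure_def)
  then have "\<exists>K. compact K \<and> emeasure \<mu> K \<noteq> 0"
    by (metis (mono_tags, lifting) SUP_eq_const mem_Collect_eq SUP_empty bot_ennreal bot.extremum compact_empty emeasure_empty)
  then show thesis using that haar by (auto simp: left_haar_measure_def zero_less_iff_neq_zero)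
qed

section \<open>Simple weights of compact support\<close>

lemma compact_measurable: "compact K \<Longrightarrow> K \<in> sets \<mu>"
  by (simp add: sets_haar compact_imp_closed)

text \<open>Simplicity allows multiplication with strongly measurable functions; compact support
  confines orbits to a set on which continuity already gives strong measurability. The total mass is
  left free, so that the weights form a convex cone.\<close>

definition weights :: "('g \<Rightarrow> real) set" where
  "weights = {h. simple_function \<mu> h \<and> (\<forall>s. 0 \<le> h s) \<and> integrable \<mu> h \<and>
     (\<exists>K. compact K \<and> (\<forall>s. s \<notin> K \<longrightarrow> h s = 0))}"

lemma weightsD:
  assumes "h \<in> weights"
  shows "simple_function \<mu> h" "0 \<le> h s" "integrable \<mu> h" "h \<in> borel_measurable \<mu>"
    "\<exists>K. compact K \<and> (\<forall>s. s \<notin> K \<longrightarrow> h s = 0)"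
  using assms by (auto simp: weights_def)

lemma weights_zero: "(\<lambda>s. 0) \<in> weights"
  by (auto simp: weights_def intro: exI[of _ "{}"])

lemma weights_add:
  assumes "h \<in> weights" "k \<in> weights" shows "(\<lambda>s. h s + k s) \<in> weights"
proof -
  obtain K L where "compact K" "\<forall>s. s \<notin> K \<longrightarrow> h s = 0" "compact L" "\<forall>s. s \<notin> L \<longrightarrow> k s = 0"
    using weightsD(5) assms by metis
  then have "\<exists>K. compact K \<and> (\<forall>s. s \<notin> K \<longrightarrow> h s + k s = 0)"
    by (intro exI[of _ "K \<union> L"]) auto
  then show ?thesis using weightsD[OF assms(1)] weightsD[OF assms(2)]
    by (auto simp: weights_def intro: simple_function_compose2)
qed

lemma weights_scale:
  assumes h: "h \<in> weights" and a: "0 \<le> a" shows "(\<lambda>s. a * h s) \<in> weights"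
proof -
  obtain K where "compact K" "\<forall>s. s \<notin> K \<longrightarrow> h s = 0" using weightsD(5) h by metis
  then have "\<exists>K. compact K \<and> (\<forall>s. s \<notin> K \<longrightarrow> a * h s = 0)" by (intro exI[of _ K]) auto
  then show ?thesis using weightsD[OF h] a
    by (auto simp: weights_def intro: simple_function_compose1)
qed

section \<open>Bumps on translates of a compact set\<close>

context
  fixes A :: "'g set"
  assumes A: "compact A" "0 < emeasure \<mu> A" "emeasure \<mu> A < \<infinity>"
begin

text \<open>\<open>bump x\<close> is the uniform density on \<open>x + A\<close>. Translating it
  only moves the base point, so invariance of a functional under translation becomes a statement
  about functions of \<open>x\<close>.\<close>

definition bump :: "'g \<Rightarrow> 'g \<Rightarrow> real" where "bump x s = indicator A (- x + s) / measure \<mu> A"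

lemma measure_A: "0 < measure \<mu> A"
  using A by (simp add: measure_def enn2real_positive_iff)

lemma indicator_A_integrable: "integrable \<mu> (indicator A :: 'g \<Rightarrow> real)"
  using A compact_measurable by (intro integrable_real_indicator) auto

lemma bump_integrable: "integrable \<mu> (bump x)"
  using integrable_translation[OF indicator_A_integrable, of "- x"] by (simp add: bump_def[abs_def])

lemma bump_integral: "(\<integral>s. bump x s \<partial>\<mu>) = 1"
  using integral_translation[of "indicator A" "- x"] indicator_A_integrable measure_A
  by (simp add: bump_def[abs_def] compact_measurable[OF A(1)] A(3))

lemma bump_weight: "bump x \<in> weights"
proof -
  have "bump x = (\<lambda>s. indicator ((+) x ` A) s / measure \<mu> A)"
  proof
    fix s
    have "- x + s \<in> A \<longleftrightarrow> s \<in> (+) x ` A"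
      by (metis (no_types, opaque_lifting) image_iff minus_add_cancel add_minus_cancel)
    then show "bump x s = indicator ((+) x ` A) s / measure \<mu> A" by (simp add: bump_def indicator_def)
  qed
  moreover have K: "compact ((+) x ` A)" using A(1) by (intro compact_continuous_image continuous_intros)
  ultimately have "simple_function \<mu> (bump x)" "\<forall>s. s \<notin> (+) x ` A \<longrightarrow> bump x s = 0"
    using compact_measurable[OF K] by (auto intro: simple_function_compose1)
  moreover have "0 \<le> bump x s" for s by (simp add: bump_def)
  ultimately show ?thesis using K bump_integrable by (auto simp: weights_def)
qed

lemma bump_translate: "bump x (- t + s) = bump (t + x) s"
proof -
  have "- (t + x) + s = - x + (- t + s)" by (simp only: minus_add add.assoc)
  then show ?thesis by (simp only: bump_def)
qed

text \<open>Continuity of translation in L1. Outer regularity puts \<open>A\<close> inside an open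
  \<open>V\<close> of nearly the same measure, and small translates of the compact \<open>A\<close>
  remain in \<open>V\<close>; hence \<open>A\<close> and its translate differ only within
  \<open>V - A\<close> and a translate of \<open>V - A\<close>.\<close>

lemma bump_continuous: "\<forall>\<^sub>F y in nhds x. (\<integral>s. \<bar>bump y s - bump x s\<bar> \<partial>\<mu>) < \<epsilon>" if \<epsilon>: "0 < \<epsilon>"
proof -
  \<comment> \<open>Two thin sets contribute at most \<open>2 * \<delta>\<close>, which after
    division by the measure of \<open>A\<close> is \<open>\<epsilon> / 2\<close>.\<close>
  define \<delta> where "\<delta> = \<epsilon> * measure \<mu> A / 4"
  have \<delta>: "0 < \<delta>" using \<epsilon> measure_A by (simp add: \<delta>_def)
  have "emeasure \<mu> A = (INF V\<in>{V. open V \<and> A \<subseteq> V}. emeasure \<mu> V)"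
    using haar compact_measurable[OF A(1)] by (simp add: left_haar_measure_def sets_haar)
  moreover have "emeasure \<mu> A < emeasure \<mu> A + ennreal \<delta>"
    using A \<delta> by (simp add: ennreal_add_left_cancel_less less_top)
  ultimately obtain V where V: "open V" "A \<subseteq> V" "emeasure \<mu> V < emeasure \<mu> A + ennreal \<delta>"
    by (metis (no_types, lifting) INF_less_iff mem_Collect_eq)
  have VA: "V - A \<in> sets \<mu>" using V(1) compact_measurable[OF A(1)] by (simp add: sets_haar)
  have "emeasure \<mu> (V - A) = emeasure \<mu> V - emeasure \<mu> A"
    using V A compact_measurable[OF A(1)] by (intro emeasure_Diff) (auto simp: sets_haar)
  also have "\<dots> \<le> ennreal \<delta>"
    using V(3) A(3) by (auto simp: ennreal_minus_le_iff intro: less_imp_le)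
  finally have eVA: "emeasure \<mu> (V - A) \<le> ennreal \<delta>" .
  then have mVA: "measure \<mu> (V - A) \<le> \<delta>"
    using \<delta> by (simp add: measure_def enn2real_leI)
  have fVA: "emeasure \<mu> (V - A) < \<infinity>" using le_less_trans[OF eVA ennreal_less_top] by simp
  \<comment> \<open>Both signs of \<open>w\<close> occur because a point may lie in \<open>A\<close>
    and leave it, or lie outside and enter it. The tube lemma makes the neighbourhood of 0 uniform
    over \<open>A\<close>.\<close>
  define W where "W = {(w, a). w + a \<in> V \<and> - w + a \<in> V}"
  have "open ((\<lambda>z. fst z + snd z) -` V \<inter> (\<lambda>z. - fst z + snd z) -` V :: ('g \<times> 'g) set)"
    by (intro open_Int open_vimage V(1) continuous_intros)
  moreover have "(\<lambda>z. fst z + snd z) -` V \<inter> (\<lambda>z. - fst z + snd z) -` V = W"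
    by (auto simp: W_def)
  ultimately have "open W" by simp
  moreover have "{0} \<times> A \<subseteq> W" using V(2) by (auto simp: W_def)
  ultimately obtain N where N: "0 \<in> N" "open N" "N \<times> A \<subseteq> W"
    using Elementary_Topology.tube_lemma[of A W 0] A(1) by auto
  have close: "(\<integral>s. \<bar>bump y s - bump x s\<bar> \<partial>\<mu>) < \<epsilon>" if w: "- x + y \<in> N" for y
  proof -
    define w where "w = - x + y"
    have inV: "w + a \<in> V" "- w + a \<in> V" if "a \<in> A" for a
      using N(3) w that by (auto simp: W_def w_def)
    have pt: "\<bar>bump y (x + s) - bump x (x + s)\<bar> \<le>
        (indicator (V - A) s + indicator (V - A) (- w + s)) / measure \<mu> A" for s
    proof -
      have "- y + (x + s) = - w + s" by (simp add: w_def minus_add add.assoc)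
      then have "bump y (x + s) = indicator A (- w + s) / measure \<mu> A"
        and "bump x (x + s) = indicator A s / measure \<mu> A"
        by (simp_all add: bump_def add.assoc[symmetric])
      moreover have "\<bar>indicator A (- w + s) - indicator A s\<bar> \<le> (indicator (V - A) s + indicator (V - A) (- w + s) :: real)"
        using inV(1)[of "- w + s"] inV(2)[of s] by (auto simp: indicator_def add.assoc[symmetric])
      ultimately show ?thesis using measure_A
        by (simp add: divide_right_mono flip: diff_divide_distrib)
    qed
    have iVA: "integrable \<mu> (indicator (V - A) :: 'g \<Rightarrow> real)"
      using VA fVA by (intro integrable_real_indicator)
    \<comment> \<open>Shifting the variable by \<open>x\<close> leaves only the displacement
      \<open>w\<close> between the base points.\<close>
    have "(\<integral>s. \<bar>bump y s - bump x s\<bar> \<partial>\<mu>) = (\<integral>s. \<bar>bump y (x + s) - bump x (x + s)\<bar> \<partial>\<mu>)"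
      by (rule integral_translation[symmetric]) (use weightsD(4)[OF bump_weight] in measurable)
    also have "\<dots> \<le> (\<integral>s. (indicator (V - A) s + indicator (V - A) (- w + s)) / measure \<mu> A \<partial>\<mu>)"
      using pt iVA integrable_translation[OF iVA, of "- w"]
      by (intro integral_mono integrable_abs Bochner_Integration.integrable_diff integrable_translation bump_integrable) auto
    also have "\<dots> = 2 * measure \<mu> (V - A) / measure \<mu> A"
      using iVA integrable_translation[OF iVA, of "- w"] integral_translation[of "indicator (V - A)" "- w"] VA fVA
      by simp
    also have "\<dots> \<le> 2 * \<delta> / measure \<mu> A" using mVA measure_A by (intro divide_right_mono) auto
    also have "\<dots> < \<epsilon>" using measure_A \<epsilon> by (simp add: \<delta>_def)
    finally show ?thesis .
  qed
  have "open ((\<lambda>y. - x + y) -` N)" by (intro open_vimage N(2) continuous_intros)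
  moreover have "x \<in> (\<lambda>y. - x + y) -` N" using N(1) by simp
  ultimately have "\<forall>\<^sub>F y in nhds x. y \<in> (\<lambda>y. - x + y) -` N" by (rule eventually_nhds_in_open)
  then show ?thesis by (rule eventually_mono) (use close in auto)
qed

text \<open>The dual of \<open>L\<^sup>1\<close> is not needed: a functional separating the convex set of all
  \<open>(\<tau>\<^sub>t h - h)\<^sub>t\<close> from 0 is tested only on bumps, where it depends continuously on the base point,
  and is therefore in the domain of the mean.\<close>

lemma no_separation:
  assumes T: "finite T" and \<epsilon>: "0 < \<epsilon>"
    and mean: "left_invariant_mean \<mu> m"
    and l_add: "\<And>u v. (\<And>t. t \<in> T \<Longrightarrow> integrable \<mu> (\<lambda>s. u (t, s))) \<Longrightarrow> (\<And>t. t \<in> T \<Longrightarrow> integrable \<mu> (\<lambda>s. v (t, s))) \<Longrightarrow>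
      l (\<lambda>z. u z + v z) = l u + l v"
    and l_neg: "\<And>u. (\<And>t. t \<in> T \<Longrightarrow> integrable \<mu> (\<lambda>s. u (t, s))) \<Longrightarrow> l (\<lambda>z. - u z) = - l u"
    and l_le: "\<And>u. (\<And>t. t \<in> T \<Longrightarrow> integrable \<mu> (\<lambda>s. u (t, s))) \<Longrightarrow> l u \<le> (\<Sum>t\<in>T. \<integral>s. \<bar>u (t, s)\<bar> \<partial>\<mu>)"
    and l_bump: "\<And>x. \<epsilon> \<le> l (\<lambda>(t, s). if t \<in> T then bump x (- t + s) - bump x s else 0)"
  shows False
proof -
  \<comment> \<open>\<open>b t x\<close> is the bump at \<open>x\<close> in the slice over
    \<open>t\<close>; testing \<open>l\<close> on it yields, for each \<open>t\<close>, a function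
    on the group.\<close>
  define b where "b t x = (\<lambda>(t', s). if t' = t then bump x s else 0)" for t x :: 'g
  define f where "f t x = l (b t x)" for t x
  have b_int: "integrable \<mu> (\<lambda>s. b t x (t', s))" for t x t'
    by (cases "t' = t") (auto simp: b_def bump_integrable)
  have diff: "l (\<lambda>z. u z - v z) = l u - l v"
    if u: "\<And>t. integrable \<mu> (\<lambda>s. u (t, s))" and v: "\<And>t. integrable \<mu> (\<lambda>s. v (t, s))" for u v
    using l_add[of u "\<lambda>z. - v z"] l_neg[of v] u v by simp
  have l_zero: "l (\<lambda>z. 0) = 0" using diff[of "\<lambda>z. 0" "\<lambda>z. 0"] by simp
  have l_sum: "l (\<lambda>z. \<Sum>t\<in>S. b t (t + x) z - b t x z) = (\<Sum>t\<in>S. f t (t + x) - f t x)"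
    if "finite S" for S x
    using that
  proof (induction S)
    case (insert r S)
    have "integrable \<mu> (\<lambda>s. \<Sum>t\<in>S. b t (t + x) (t', s) - b t x (t', s))" for t'
      using b_int by auto
    then show ?case using insert b_int
      by (simp add: f_def diff l_add)
  qed (simp add: l_zero)
  have "(\<Sum>t\<in>T. b t (t + x) z - b t x z) = (case z of (t, s) \<Rightarrow> if t \<in> T then bump x (- t + s) - bump x s else 0)"
    for x z
  proof (cases z)
    case (Pair t s)
    have "(\<Sum>t'\<in>T. b t' (t' + x) z - b t' x z) = (\<Sum>t'\<in>T. if t' = t then bump x (- t + s) - bump x s else 0)"
      by (intro sum.cong) (auto simp: Pair b_def bump_translate)
    then show ?thesis using T by (simp add: Pair)
  qed
  \<comment> \<open>The translated bumps minus the original ones sum to the element on which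
    \<open>l\<close> is at least \<open>\<epsilon>\<close>.\<close>
  then have g_ge: "\<epsilon> \<le> (\<Sum>t\<in>T. f t (t + x) - f t x)" for x
    using l_bump[of x] l_sum[OF T, of x] by simp
  have norm_b: "(\<Sum>t'\<in>T. \<integral>s. \<bar>b t x (t', s) - c * b t y (t', s)\<bar> \<partial>\<mu>) = (\<integral>s. \<bar>bump x s - c * bump y s\<bar> \<partial>\<mu>)"
    if "t \<in> T" for t x y c
  proof -
    have "(\<Sum>t'\<in>T. \<integral>s. \<bar>b t x (t', s) - c * b t y (t', s)\<bar> \<partial>\<mu>) =
        (\<Sum>t'\<in>T. if t' = t then (\<integral>s. \<bar>bump x s - c * bump y s\<bar> \<partial>\<mu>) else 0)"
      by (intro sum.cong) (auto simp: b_def)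
    then show ?thesis using that T by simp
  qed
  \<comment> \<open>Domination by the L1 norm makes \<open>f t\<close> as continuous as the bumps,
    and continuity gives the measurability that the mean asks for.\<close>
  have f_diff: "f t x - f t y \<le> (\<integral>s. \<bar>bump x s - bump y s\<bar> \<partial>\<mu>)" if "t \<in> T" for t x y
    using l_le[of "\<lambda>z. b t x z - b t y z"] norm_b[OF that, of x 1 y] diff[of "b t x" "b t y"] b_int
    by (simp add: f_def)
  have f_le: "\<bar>f t x\<bar> \<le> 1" if "t \<in> T" for t x
  proof -
    have "(\<integral>s. \<bar>bump x s\<bar> \<partial>\<mu>) = 1"
      using bump_integral weightsD(2)[OF bump_weight] by simp
    then have "l (b t x) \<le> 1" "l (\<lambda>z. - b t x z) \<le> 1"
      using l_le[of "b t x"] l_le[of "\<lambda>z. - b t x z"] norm_b[OF that, of x 0 x] b_int by simp_all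
    then show ?thesis using l_neg[of "b t x"] b_int by (simp add: f_def)
  qed
  have f_cont: "continuous_on UNIV (f t)" if t: "t \<in> T" for t
  proof -
    have "(f t \<longlongrightarrow> f t x) (at x)" for x
    proof (rule tendstoI)
      fix e :: real assume e: "0 < e"
      have "\<forall>\<^sub>F y in nhds x. dist (f t y) (f t x) < e"
        using bump_continuous[OF e, of x]
      proof eventually_elim
        case (elim y)
        have "(\<integral>s. \<bar>bump x s - bump y s\<bar> \<partial>\<mu>) = (\<integral>s. \<bar>bump y s - bump x s\<bar> \<partial>\<mu>)"
          by (simp add: abs_minus_commute)
        then show ?case using f_diff[OF t, of x y] f_diff[OF t, of y x] elim by (simp add: dist_real_def)
      qed
      then show "\<forall>\<^sub>F y in at x. dist (f t y) (f t x) < e" by (auto simp: eventually_at_filter elim: eventually_mono)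
    qed
    then show ?thesis by (simp add: continuous_on_def)
  qed
  define \<phi> where "\<phi> t x = complex_of_real (f t x)" for t x
  have \<phi>_ess: "\<phi> t \<in> ess_bounded \<mu>" "(\<lambda>x. \<phi> t (r + x)) \<in> ess_bounded \<mu>" if t: "t \<in> T" for t r
  proof -
    have "\<phi> t \<in> borel_measurable \<mu>"
      unfolding \<phi>_def[abs_def] using measurable_haar[OF f_cont[OF t]] by measurable
    moreover from this have "(\<lambda>x. \<phi> t (r + x)) \<in> borel_measurable \<mu>"
      by (rule measurable_compose[OF translation_measurable])
    moreover have "cmod (\<phi> t x) \<le> 1" for x using f_le[OF t] by (simp add: \<phi>_def)
    ultimately show "\<phi> t \<in> ess_bounded \<mu>" "(\<lambda>x. \<phi> t (r + x)) \<in> ess_bounded \<mu>"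
      by (auto simp: ess_bounded_def intro!: exI[of _ 1])
  qed
  have m_add: "m (\<lambda>x. u x + v x) = m u + m v" and m_scale: "m (\<lambda>x. a * u x) = a * m u"
    if "u \<in> ess_bounded \<mu>" "v \<in> ess_bounded \<mu>" for u v a
    using mean that by (auto simp: left_invariant_mean_def)
  have ess_add: "(\<lambda>x. u x + v x) \<in> ess_bounded \<mu>" if uv: "u \<in> ess_bounded \<mu>" "v \<in> ess_bounded \<mu>" for u v
  proof -
    obtain c d where "AE x in \<mu>. cmod (u x) \<le> c" "AE x in \<mu>. cmod (v x) \<le> d"
      using uv by (auto simp: ess_bounded_def)
    then have "AE x in \<mu>. cmod (u x + v x) \<le> c + d"
      by eventually_elim (meson add_mono norm_triangle_le)
    then show ?thesis using uv by (auto simp: ess_bounded_def)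
  qed
  have ess_scale: "(\<lambda>x. a * u x) \<in> ess_bounded \<mu>" if u: "u \<in> ess_bounded \<mu>" for u and a :: complex
  proof -
    obtain c where "AE x in \<mu>. cmod (u x) \<le> c" using u by (auto simp: ess_bounded_def)
    then have "AE x in \<mu>. cmod (a * u x) \<le> cmod a * c"
      by eventually_elim (simp add: norm_mult mult_left_mono)
    then show ?thesis using u by (auto simp: ess_bounded_def)
  qed
  have ess_const: "(\<lambda>x. a) \<in> ess_bounded \<mu>" for a
    by (auto simp: ess_bounded_def)
  have m_zero: "m (\<lambda>x. 0) = 0" using m_scale[OF ess_const ess_const, of 0 0] by simp
  have m_inv: "m (\<lambda>x. \<phi> t (t + x)) = m (\<phi> t)" if "t \<in> T" for t
  proof -
    \<comment> \<open>The invariance clause translates by \<open>- s\<close>; it is applied with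
      \<open>s = - t\<close>.\<close>
    have "m (\<lambda>x. \<phi> t (- (- t) + x)) = m (\<phi> t)"
      using mean \<phi>_ess(1)[OF that] unfolding left_invariant_mean_def by blast
    then show ?thesis by simp
  qed
  have m_sum: "(\<lambda>x. \<Sum>t\<in>S. \<phi> t (t + x) - \<phi> t x) \<in> ess_bounded \<mu> \<and> m (\<lambda>x. \<Sum>t\<in>S. \<phi> t (t + x) - \<phi> t x) = 0"
    if "S \<subseteq> T" for S
    using finite_subset[OF that T] that
  proof (induction S)
    case (insert r S)
    then have r: "\<phi> r \<in> ess_bounded \<mu>" "(\<lambda>x. \<phi> r (r + x)) \<in> ess_bounded \<mu>" and rT: "r \<in> T"
      using \<phi>_ess by auto
    have neg: "(\<lambda>x. - 1 * \<phi> r x) \<in> ess_bounded \<mu>" by (rule ess_scale[OF r(1)])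
    have d: "(\<lambda>x. \<phi> r (r + x) + - 1 * \<phi> r x) \<in> ess_bounded \<mu>" by (rule ess_add[OF r(2) neg])
    have "m (\<lambda>x. \<phi> r (r + x) + - 1 * \<phi> r x) = 0"
      using m_add[OF r(2) neg] m_scale[OF r(1) r(1), of "-1"] m_inv[OF rT] by simp
    then show ?case
      using insert ess_add[OF d, of "\<lambda>x. \<Sum>t\<in>S. \<phi> t (t + x) - \<phi> t x"]
        m_add[OF d, of "\<lambda>x. \<Sum>t\<in>S. \<phi> t (t + x) - \<phi> t x"] by simp
  qed (simp add: m_zero ess_const)
  \<comment> \<open>By invariance \<open>g\<close> has mean 0, although it is at least
    \<open>\<epsilon>\<close> everywhere.\<close>
  define g where "g x = (\<Sum>t\<in>T. f t (t + x) - f t x)" for x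
  define M where "M = 2 * real (card T)"
  have g_le: "g x \<le> M" for x
  proof -
    have "g x \<le> (\<Sum>t\<in>T. 2)"
      unfolding g_def using f_le by (intro sum_mono) (smt (verit))
    then show ?thesis by (simp add: M_def)
  qed
  have \<phi>_sum: "(\<Sum>t\<in>T. \<phi> t (t + x) - \<phi> t x) = complex_of_real (g x)" for x
    by (simp add: g_def \<phi>_def)
  have gm: "(\<lambda>x. complex_of_real (g x)) \<in> ess_bounded \<mu>" "m (\<lambda>x. complex_of_real (g x)) = 0"
    using m_sum[of T] by (simp_all add: \<phi>_sum)
  \<comment> \<open>The mean is controlled through bounds on the absolute value. Reflecting
    \<open>g\<close> in the upper bound \<open>M\<close> gives values between 0 and
    \<open>M - \<epsilon>\<close>, yet the mean is \<open>M\<close>.\<close>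
  define k where "k x = complex_of_real M * 1 + - 1 * complex_of_real (g x)" for x
  have k: "k \<in> ess_bounded \<mu>"
    unfolding k_def[abs_def] by (intro ess_add ess_scale gm ess_const)
  have "m k = complex_of_real M"
  proof -
    have "m k = m (\<lambda>x. complex_of_real M * 1) + m (\<lambda>x. - 1 * complex_of_real (g x))"
      unfolding k_def[abs_def] by (intro m_add ess_scale gm ess_const)
    also have "m (\<lambda>x. - 1 * complex_of_real (g x)) = 0" using m_scale[OF gm(1) gm(1), of "-1"] gm(2) by simp
    also have "m (\<lambda>x. complex_of_real M * 1) = complex_of_real M * m (\<lambda>x. 1)"
      by (rule m_scale[OF ess_const ess_const])
    finally show ?thesis using mean by (simp add: left_invariant_mean_def)
  qed
  moreover have "cmod (m k) \<le> M - \<epsilon>"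
  proof -
    have "cmod (k x) \<le> M - \<epsilon>" for x
    proof -
      have "k x = complex_of_real (M - g x)" by (simp add: k_def)
      then have "cmod (k x) = \<bar>M - g x\<bar>" by (simp only: norm_of_real)
      then show ?thesis using g_le[of x] g_ge[of x] by (simp add: g_def)
    qed
    then have "AE x in \<mu>. cmod (k x) \<le> M - \<epsilon>" by simp
    then show ?thesis using mean k unfolding left_invariant_mean_def by blast
  qed
  ultimately show False using \<epsilon> by simp
qed

end

text \<open>If the condition fails, homogeneity gives
  \<open>N (\<Phi> h) \<ge> \<epsilon> * a\<close> for every weight \<open>h\<close> of mass
  \<open>a\<close>. Hahn-Banach then provides a functional that is dominated by \<open>N\<close> and
  at least \<open>\<epsilon>\<close> on every \<open>\<Phi> (bump A x)\<close>, against
  \<open>no_separation\<close>.\<close>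

lemma reiter:
  assumes mean: "left_invariant_mean \<mu> m" and T: "finite T" and \<epsilon>: "0 < \<epsilon>"
  shows "\<exists>h\<in>weights. (\<integral>s. h s \<partial>\<mu>) = 1 \<and> (\<forall>t\<in>T. (\<integral>s. \<bar>h (- t + s) - h s\<bar> \<partial>\<mu>) < \<epsilon>)"
proof (rule ccontr)
  assume "\<not> ?thesis"
  then have far: "\<exists>t\<in>T. \<epsilon> \<le> (\<integral>s. \<bar>h (- t + s) - h s\<bar> \<partial>\<mu>)" if "h \<in> weights" "(\<integral>s. h s \<partial>\<mu>) = 1" for h
    using that by (meson not_le)
  obtain A where A: "compact A" "0 < emeasure \<mu> A" "emeasure \<mu> A < \<infinity>"
    by (rule exists_compact_positive_measure)
  define V where "V = {u :: 'g \<times> 'g \<Rightarrow> real. \<forall>t\<in>T. integrable \<mu> (\<lambda>s. u (t, s))}"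
  define N where "N u = (\<Sum>t\<in>T. \<integral>s. \<bar>u (t, s)\<bar> \<partial>\<mu>)" for u :: "'g \<times> 'g \<Rightarrow> real"
  define \<Phi> where "\<Phi> h = (\<lambda>(t, s). if t \<in> T then h (- t + s) - h s else 0)" for h :: "'g \<Rightarrow> real"
  interpret V: function_space V
    by unfold_locales (auto simp: V_def)
  have \<Phi>V: "\<Phi> h \<in> V" if "h \<in> weights" for h
    using weightsD(3)[OF that] integrable_translation by (auto simp: V_def \<Phi>_def)
  have N0: "0 \<le> N u" for u by (simp add: N_def sum_nonneg)
  have N_add: "N (\<lambda>z. u z + v z) \<le> N u + N v" if uv: "u \<in> V" "v \<in> V" for u v
    unfolding N_def sum.distrib[symmetric]
  proof (rule sum_mono)
    fix t assume "t \<in> T"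
    then have i: "integrable \<mu> (\<lambda>s. u (t, s))" "integrable \<mu> (\<lambda>s. v (t, s))" using uv by (auto simp: V_def)
    then have "(\<integral>s. \<bar>u (t, s) + v (t, s)\<bar> \<partial>\<mu>) \<le> (\<integral>s. \<bar>u (t, s)\<bar> + \<bar>v (t, s)\<bar> \<partial>\<mu>)"
      by (intro integral_mono) auto
    then show "(\<integral>s. \<bar>u (t, s) + v (t, s)\<bar> \<partial>\<mu>) \<le> (\<integral>s. \<bar>u (t, s)\<bar> \<partial>\<mu>) + (\<integral>s. \<bar>v (t, s)\<bar> \<partial>\<mu>)"
      using i by simp
  qed
  have N_scale: "N (\<lambda>z. a * u z) = \<bar>a\<bar> * N u" for a u
    by (simp add: N_def abs_mult sum_distrib_left)
  have \<Phi>_add: "\<Phi> (\<lambda>s. h s + k s) z = \<Phi> h z + \<Phi> k z" for h k z by (auto simp: \<Phi>_def split: prod.split)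
  have \<Phi>_scale: "\<Phi> (\<lambda>s. a * h s) z = a * \<Phi> h z" for h a z
    by (auto simp: \<Phi>_def right_diff_distrib split: prod.split)
  have N_ge: "\<epsilon> * (\<integral>s. h s \<partial>\<mu>) \<le> N (\<Phi> h)" if h: "h \<in> weights" for h
  proof (cases "(\<integral>s. h s \<partial>\<mu>) = 0")
    case False
    \<comment> \<open>Normalising to mass 1 reduces the estimate to the assumed failure.\<close>
    define a where "a = (\<integral>s. h s \<partial>\<mu>)"
    have a: "0 < a" using False weightsD(2)[OF h] by (simp add: a_def less_le)
    have "(\<lambda>s. 1 / a * h s) \<in> weights" using a by (intro weights_scale h) simp
    moreover have "(\<integral>s. 1 / a * h s \<partial>\<mu>) = 1"
      using a by (simp only: Bochner_Integration.integral_mult_right_zero) (simp add: a_def)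
    ultimately obtain t where t: "t \<in> T" "\<epsilon> \<le> (\<integral>s. \<bar>1 / a * h (- t + s) - 1 / a * h s\<bar> \<partial>\<mu>)"
      using far by blast
    have "\<bar>1 / a * h (- t + s) - 1 / a * h s\<bar> = 1 / a * \<bar>h (- t + s) - h s\<bar>" for s
      using a by (simp add: abs_mult flip: right_diff_distrib diff_divide_distrib)
    then have "\<epsilon> \<le> 1 / a * (\<integral>s. \<bar>h (- t + s) - h s\<bar> \<partial>\<mu>)"
      using t(2) by (simp only: Bochner_Integration.integral_mult_right_zero)
    then have "\<epsilon> * a \<le> (\<integral>s. \<bar>h (- t + s) - h s\<bar> \<partial>\<mu>)" using a by (simp add: field_simps)
    also have "\<dots> = (\<integral>s. \<bar>\<Phi> h (t, s)\<bar> \<partial>\<mu>)" using t(1) by (simp add: \<Phi>_def)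
    also have "\<dots> \<le> N (\<Phi> h)"
      unfolding N_def using t(1) T by (intro member_le_sum) auto
    finally show ?thesis by (simp add: a_def)
  qed (simp add: N0)
  \<comment> \<open>The minorant \<open>q\<close> combines norm and separation: \<open>h = 0\<close>
    gives \<open>q \<le> N\<close>, and at \<open>v = - \<Phi> h\<close> the value is at most
    \<open>- \<epsilon>\<close> times the mass of \<open>h\<close>.\<close>
  define g where "g v h = N (\<lambda>z. v z + \<Phi> h z) - \<epsilon> * (\<integral>s. h s \<partial>\<mu>)" for v h
  define q where "q v = (INF h\<in>weights. g v h)" for v
  \<comment> \<open>Here the negated conclusion enters: it keeps the infimum finite.\<close>
  have lower: "- N v \<le> g v h" if v: "v \<in> V" and h: "h \<in> weights" for v h
  proof -
    have "N (\<lambda>z. (v z + \<Phi> h z) + (- v z)) \<le> N (\<lambda>z. v z + \<Phi> h z) + N (\<lambda>z. - v z)"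
      by (intro N_add V.add V.neg \<Phi>V v h)
    moreover have "N (\<lambda>z. - v z) = N v" using N_scale[of "-1" v] by simp
    ultimately show ?thesis using N_ge[OF h] by (simp add: g_def)
  qed
  have q_le: "q v \<le> g v h" if "v \<in> V" "h \<in> weights" for v h
    unfolding q_def using lower that by (intro cINF_lower bdd_belowI2[of _ "- N v"]) auto
  have q_ge: "c \<le> q v" if "\<And>h. h \<in> weights \<Longrightarrow> c \<le> g v h" for c v
    unfolding q_def using that weights_zero by (intro cINF_greatest) auto
  have "sublinear_on V q"
    unfolding sublinear_on_def
  proof (intro conjI ballI allI impI)
    fix u v assume u: "u \<in> V" and v: "v \<in> V"
    \<comment> \<open>Weights form a convex cone on which \<open>\<Phi>\<close> is additive, so the
      sum of two competitors competes for the sum.\<close>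
    have le: "q (\<lambda>z. u z + v z) \<le> g u h + g v k" if h: "h \<in> weights" and k: "k \<in> weights" for h k
    proof -
      have "q (\<lambda>z. u z + v z) \<le> g (\<lambda>z. u z + v z) (\<lambda>s. h s + k s)"
        by (intro q_le V.add weights_add u v h k)
      also have "\<dots> = N (\<lambda>z. (u z + \<Phi> h z) + (v z + \<Phi> k z)) - \<epsilon> * (\<integral>s. h s + k s \<partial>\<mu>)"
        by (simp add: g_def \<Phi>_add algebra_simps)
      also have "\<dots> \<le> N (\<lambda>z. u z + \<Phi> h z) + N (\<lambda>z. v z + \<Phi> k z) - \<epsilon> * (\<integral>s. h s + k s \<partial>\<mu>)"
        by (intro diff_right_mono N_add V.add \<Phi>V u v h k)
      also have "\<dots> = g u h + g v k"
        using weightsD(3)[OF h] weightsD(3)[OF k] by (simp add: g_def algebra_simps)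
      finally show ?thesis .
    qed
    have "q (\<lambda>z. u z + v z) - g u h \<le> q v" if "h \<in> weights" for h
      by (rule q_ge) (use le[OF that] in \<open>simp add: algebra_simps\<close>)
    from this have "q (\<lambda>z. u z + v z) - q v \<le> q u"
      by (intro q_ge) (simp add: algebra_simps)
    then show "q (\<lambda>z. u z + v z) \<le> q u + q v" by simp
  next
    fix u and a :: real assume u: "u \<in> V" and a: "0 < a"
    have g_scale: "g (\<lambda>z. a * u z) (\<lambda>s. a * h s) = a * g u h" for h
      using N_scale[of a "\<lambda>z. u z + \<Phi> h z"] a by (simp add: g_def \<Phi>_scale algebra_simps)
    show "q (\<lambda>z. a * u z) = a * q u"
    proof (rule antisym)
      have "q (\<lambda>z. a * u z) / a \<le> q u"
      proof (rule q_ge)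
        fix h assume "h \<in> weights"
        then have "q (\<lambda>z. a * u z) \<le> a * g u h"
          using q_le[OF V.scale[OF u, of a] weights_scale[of h a]] a by (simp add: g_scale)
        then show "q (\<lambda>z. a * u z) / a \<le> g u h" using a by (simp add: field_simps)
      qed
      then show "q (\<lambda>z. a * u z) \<le> a * q u" using a by (simp add: field_simps)
      show "a * q u \<le> q (\<lambda>z. a * u z)"
      proof (rule q_ge)
        fix h assume h: "h \<in> weights"
        have "q u \<le> g u (\<lambda>s. 1 / a * h s)" using a by (intro q_le u weights_scale h) simp
        then have "a * q u \<le> a * g u (\<lambda>s. 1 / a * h s)" using a by simp
        also have "\<dots> = g (\<lambda>z. a * u z) h" using a by (simp flip: g_scale)
        finally show "a * q u \<le> g (\<lambda>z. a * u z) h" .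
      qed
    qed
  qed
  then obtain l where l_add: "\<And>u v. u \<in> V \<Longrightarrow> v \<in> V \<Longrightarrow> l (\<lambda>z. u z + v z) = l u + l v"
    and l_neg: "\<And>u. u \<in> V \<Longrightarrow> l (\<lambda>z. - u z) = - l u" and l_le: "\<And>u. u \<in> V \<Longrightarrow> l u \<le> q u"
    by (rule V.dominated_linear_functional) blast
  show False
  proof (rule no_separation[OF A T \<epsilon> mean, of l])
    fix u v :: "'g \<times> 'g \<Rightarrow> real"
    assume "\<And>t. t \<in> T \<Longrightarrow> integrable \<mu> (\<lambda>s. u (t, s))" "\<And>t. t \<in> T \<Longrightarrow> integrable \<mu> (\<lambda>s. v (t, s))"
    then show "l (\<lambda>z. u z + v z) = l u + l v" by (intro l_add) (auto simp: V_def)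
  next
    fix u :: "'g \<times> 'g \<Rightarrow> real" assume "\<And>t. t \<in> T \<Longrightarrow> integrable \<mu> (\<lambda>s. u (t, s))"
    then have u: "u \<in> V" by (auto simp: V_def)
    then show "l (\<lambda>z. - u z) = - l u" by (rule l_neg)
    have "\<Phi> (\<lambda>s. 0) z = 0" for z by (auto simp: \<Phi>_def split: prod.split)
    then show "l u \<le> (\<Sum>t\<in>T. \<integral>s. \<bar>u (t, s)\<bar> \<partial>\<mu>)"
      using l_le[OF u] q_le[OF u weights_zero] by (simp add: g_def N_def)
  next
    fix x
    let ?b = "bump A x"
    have b: "?b \<in> weights" by (rule bump_weight[OF A])
    have "N (\<lambda>z. 0) = 0" by (simp add: N_def)
    \<comment> \<open>The weight \<open>?b\<close> against \<open>- \<Phi> ?b\<close> cancels the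
      norm and leaves \<open>- \<epsilon>\<close>, as a bump has mass 1.\<close>
    then have "l (\<lambda>z. - \<Phi> ?b z) \<le> - \<epsilon>"
      using order_trans[OF l_le q_le[OF _ b], OF V.neg[OF \<Phi>V[OF b]] V.neg[OF \<Phi>V[OF b]]]
      by (simp add: g_def bump_integral[OF A])
    then show "\<epsilon> \<le> l (\<lambda>(t, s). if t \<in> T then ?b (- t + s) - ?b s else 0)"
      using l_neg[OF \<Phi>V[OF b]] by (simp add: \<Phi>_def)
  qed
qed

end

section \<open>The dilation\<close>

text \<open>Superadditivity of the power, applied to the roots. It carries approximate invariance
  from L1 to Lp when a weight is replaced by its \<open>p\<close>-th root.\<close>

lemma powr_root_diff_le:
  fixes a b p :: real
  assumes "0 \<le> a" "0 \<le> b" "1 \<le> p"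
  shows "\<bar>a powr (1 / p) - b powr (1 / p)\<bar> powr p \<le> \<bar>a - b\<bar>"
proof -
  have super: "(u - v) powr p \<le> u powr p - v powr p" if "0 \<le> v" "v \<le> u" for u v :: real
  proof (cases "u = 0")
    case False
    then have u: "0 < u" using that by simp
    have small: "c powr p \<le> c" if "0 \<le> c" "c \<le> 1" for c :: real
      using powr_mono'[of 1 p c] that assms(3) by (cases "c = 0") auto
    \<comment> \<open>Division by \<open>u\<close> gives two numbers in the unit interval with sum
      1, neither of which grows under the power.\<close>
    have "(u - v) powr p + v powr p = u powr p * (((u - v) / u) powr p + (v / u) powr p)"
      using u that by (simp add: powr_divide distrib_left)
    also have "\<dots> \<le> u powr p * ((u - v) / u + v / u)"
      using u that by (intro mult_left_mono add_mono small) auto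
    also have "\<dots> = u powr p" using u by (simp flip: add_divide_distrib)
    finally show ?thesis by simp
  qed (use that assms in auto)
  have root: "(c powr (1 / p)) powr p = c" if "0 \<le> c" for c
    using that assms(3) by (simp add: powr_powr)
  show ?thesis
  proof (cases "b \<le> a")
    case True
    then have "b powr (1 / p) \<le> a powr (1 / p)" using assms by (intro powr_mono2) auto
    then show ?thesis using super[of "b powr (1 / p)" "a powr (1 / p)"] True assms by (simp add: root)
  next
    case False
    then have "a powr (1 / p) \<le> b powr (1 / p)" using assms by (intro powr_mono2) auto
    then show ?thesis using super[of "a powr (1 / p)" "b powr (1 / p)"] False assms by (simp add: root)
  qed
qed

lemma dual_simps:
  "carrier (dual X) = {\<phi>. \<phi> \<in> extensional (carrier X) \<and> bounded_op X complex_space \<phi>}"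
  "\<phi> \<oplus>\<^bsub>dual X\<^esub> \<psi> = (\<lambda>x\<in>carrier X. \<phi> x + \<psi> x)"
  "a \<odot>\<^bsub>dual X\<^esub> \<phi> = (\<lambda>x\<in>carrier X. a * \<phi> x)"
  "nrm (dual X) = op_norm X complex_space"
  by (simp_all add: dual_def)

lemma (in complex_normed_space) dualD:
  assumes "\<phi> \<in> carrier (dual X)"
  shows "\<lbrakk>x \<in> carrier X; y \<in> carrier X\<rbrakk> \<Longrightarrow> \<phi> (x \<oplus> y) = \<phi> x + \<phi> y"
    and "x \<in> carrier X \<Longrightarrow> \<phi> (a \<odot> x) = a * \<phi> x"
    and "\<lbrakk>x \<in> carrier X; y \<in> carrier X\<rbrakk> \<Longrightarrow> \<phi> (x \<ominus> y) = \<phi> x - \<phi> y"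
    and "x \<in> carrier X \<Longrightarrow> cmod (\<phi> x) \<le> nrm (dual X) \<phi> * nrm X x"
    and "0 \<le> nrm (dual X) \<phi>"
proof -
  have b: "bounded_op X complex_space \<phi>" using assms by (simp add: dual_def)
  show add: "\<phi> (x \<oplus> y) = \<phi> x + \<phi> y" if "x \<in> carrier X" "y \<in> carrier X" for x y
    using bounded_opD(2)[OF b that] by (simp add: complex_space_def)
  show scale: "\<phi> (a \<odot> x) = a * \<phi> x" if "x \<in> carrier X" for x a
    using bounded_opD(3)[OF b that] by (simp add: complex_space_def)
  show "\<phi> (x \<ominus> y) = \<phi> x - \<phi> y" if "x \<in> carrier X" "y \<in> carrier X"
    using that by (simp add: a_minus_def uminus_eq_scale add scale)
  have "nrm complex_space (a \<odot>\<^bsub>complex_space\<^esub> y) = cmod a * nrm complex_space y" for a y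
    by (simp add: complex_space_def norm_mult)
  then show "cmod (\<phi> x) \<le> nrm (dual X) \<phi> * nrm X x" if "x \<in> carrier X"
    using op_norm_bound[OF b _ that] by (simp add: dual_def) (simp add: complex_space_def)
  show "0 \<le> nrm (dual X) \<phi>"
    using op_norm_nonneg[OF b] by (simp add: dual_def) (simp add: complex_space_def norm_mult)
qed

text \<open>Finitely many open sets, on each of which \<open>g\<close> stays within
  \<open>\<epsilon>\<close> of its value at the centre, cover \<open>K\<close>; this gives uniform
  approximation by simple functions. Orbits become strongly measurable on the support of a weight in
  this way.\<close>

lemma (in complex_normed_space) strongly_measurable_on_compact:
  fixes g :: "'g::t2_space \<Rightarrow> 'v"
  assumes sets: "sets \<mu> = sets borel" and K: "compact K" and g: "\<And>t. g t \<in> carrier X"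
    and cont: "\<And>t \<epsilon>. 0 < \<epsilon> \<Longrightarrow> \<forall>\<^sub>F s in nhds t. nrm X (g s \<ominus> g t) < \<epsilon>"
  shows "strongly_measurable \<mu> X (\<lambda>s. if s \<in> K then g s else \<zero>)"
proof -
  have KS: "K \<in> sets \<mu>" using K by (simp add: sets compact_imp_closed)
  have "\<exists>\<sigma>. simple_function \<mu> \<sigma> \<and> (\<forall>s. \<sigma> s \<in> carrier X) \<and> (\<forall>s\<in>K. nrm X (\<sigma> s \<ominus> g s) < \<epsilon>)"
    if \<epsilon>: "0 < \<epsilon>" for \<epsilon>
  proof -
    have "\<exists>V. open V \<and> t \<in> V \<and> (\<forall>s\<in>V. nrm X (g s \<ominus> g t) < \<epsilon>)" for t
      using cont[OF \<epsilon>, of t] by (simp add: eventually_nhds)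
    then obtain V where V: "\<And>t. open (V t)" "\<And>t. t \<in> V t"
      "\<And>t s. s \<in> V t \<Longrightarrow> nrm X (g s \<ominus> g t) < \<epsilon>" by metis
    obtain C where C: "C \<subseteq> K" "finite C" "K \<subseteq> (\<Union>c\<in>C. V c)"
      using compactE_image[OF K, of K V] V by (metis UN_iff subsetI)
    \<comment> \<open>Inserting a set overrides the step function on it, which takes the place of
      making the cover disjoint: \<open>g c\<close> is a good value on all of
      \<open>V c\<close>.\<close>
    have "\<exists>\<sigma>. simple_function \<mu> \<sigma> \<and> (\<forall>s. \<sigma> s \<in> carrier X) \<and> (\<forall>s\<in>(\<Union>c\<in>C. V c). nrm X (\<sigma> s \<ominus> g s) < \<epsilon>)"
      using C(2)
    proof induction
      case empty
      show ?case by (intro exI[of _ "\<lambda>s. \<zero>"]) auto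
    next
      case (insert c C)
      then obtain \<sigma> where \<sigma>: "simple_function \<mu> \<sigma>" "\<And>s. \<sigma> s \<in> carrier X"
        "\<And>s. s \<in> (\<Union>c\<in>C. V c) \<Longrightarrow> nrm X (\<sigma> s \<ominus> g s) < \<epsilon>" by blast
      have "V c \<inter> space \<mu> \<in> sets \<mu>" using V(1)[of c] by (simp add: sets sets_eq_imp_space_eq[OF sets])
      then have "simple_function \<mu> (\<lambda>s. if s \<in> V c then g c else \<sigma> s)"
        by (intro simple_function_If_set \<sigma>(1) simple_function_const)
      moreover have "nrm X ((if s \<in> V c then g c else \<sigma> s) \<ominus> g s) < \<epsilon>" if "s \<in> (\<Union>c\<in>insert c C. V c)" for s
        using that V(3)[of s c] \<sigma>(3)[of s] seminorm_minus_commute[OF g g, of c s] by auto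
      ultimately show ?case
        using \<sigma>(2) g by (intro exI[of _ "\<lambda>s. if s \<in> V c then g c else \<sigma> s"]) simp
    qed
    then show ?thesis using C(3) by (meson subsetD)
  qed
  then have "\<exists>\<sigma>. simple_function \<mu> \<sigma> \<and> (\<forall>s. \<sigma> s \<in> carrier X) \<and> (\<forall>s\<in>K. nrm X (\<sigma> s \<ominus> g s) < 1 / real (Suc n))" for n
    by simp
  then obtain \<sigma> where \<sigma>: "\<And>n. simple_function \<mu> (\<sigma> n)" "\<And>n s. \<sigma> n s \<in> carrier X"
    "\<And>n s. s \<in> K \<Longrightarrow> nrm X (\<sigma> n s \<ominus> g s) < 1 / real (Suc n)" by metis
  show ?thesis
  proof (rule strongly_measurableI)
    show "simple_function \<mu> (\<lambda>s. if s \<in> K then \<sigma> n s else \<zero>)" for n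
      using KS by (intro simple_function_If_set \<sigma>(1) simple_function_const) auto
    fix s
    have lim: "(\<lambda>n. 1 / real (Suc n)) \<longlonglongrightarrow> 0"
      using LIMSEQ_inverse_real_of_nat by (simp add: inverse_eq_divide)
    have "(\<lambda>n. nrm X (\<sigma> n s \<ominus> g s)) \<longlonglongrightarrow> 0" if "s \<in> K"
    proof (rule Lim_null_comparison[OF always_eventually lim], rule allI)
      fix n
      show "norm (nrm X (\<sigma> n s \<ominus> g s)) \<le> 1 / real (Suc n)"
        using less_imp_le[OF \<sigma>(3)[OF that, of n]] \<sigma>(2)[of n s] g[of s] by (simp del: of_nat_Suc)
    qed
    then show "(\<lambda>n. nrm X ((if s \<in> K then \<sigma> n s else \<zero>) \<ominus> (if s \<in> K then g s else \<zero>))) \<longlonglongrightarrow> 0"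
      by (cases "s \<in> K") auto
  qed (use \<sigma> g in auto)
qed

text \<open>With \<open>k j = (h j) powr (1 / p)\<close>, the embedding \<open>J\<close> sends \<open>x\<close> to the class of
  \<open>s \<mapsto> k j s \<odot> \<pi> (- s) x\<close>, and \<open>Q\<close> integrates \<open>\<pi> s (f s)\<close> weakly against
  \<open>(k j) powr (p - 1)\<close>, so that \<open>Q (J x) \<phi> = lim \<integral> h j \<cdot> \<phi> x\<close>.\<close>

locale dilation = haar \<mu> + Lp: Lp_space X \<mu> p Z + Ul: ultraproduct_incomplete U "\<lambda>j. Z" Y rank
  for \<mu> :: "'g::{topological_group_add, t2_space} measure" and X :: "'v onspace" (structure)
    and p :: real and Z and U :: "'i filter" and Y and rank +
  fixes \<pi> :: "'g \<Rightarrow> 'v \<Rightarrow> 'v" and h :: "'i \<Rightarrow> 'g \<Rightarrow> real"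
  assumes rep: "group_rep X \<pi>" "continuous_rep X \<pi>" "bounded_rep X \<pi>"
    and p1: "1 < p"
    and h: "\<And>j. h j \<in> weights" "\<And>j. (\<integral>s. h j s \<partial>\<mu>) = 1"
    and h_lim: "\<And>t. ((\<lambda>j. \<integral>s. \<bar>h j (- t + s) - h j s\<bar> \<partial>\<mu>) \<longlongrightarrow> 0) U"
begin

abbreviation M where "M \<equiv> rep_norm X \<pi>"

section \<open>The given representation and its uniform bound\<close>

lemma \<pi>_closed [simp]: "x \<in> carrier X \<Longrightarrow> \<pi> t x \<in> carrier X"
  and \<pi>_add: "\<lbrakk>x \<in> carrier X; y \<in> carrier X\<rbrakk> \<Longrightarrow> \<pi> t (x \<oplus> y) = \<pi> t x \<oplus> \<pi> t y"
  and \<pi>_scale: "x \<in> carrier X \<Longrightarrow> \<pi> t (a \<odot> x) = a \<odot> \<pi> t x"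
  and \<pi>_comp: "x \<in> carrier X \<Longrightarrow> \<pi> (s + t) x = \<pi> s (\<pi> t x)"
  and \<pi>_zero: "x \<in> carrier X \<Longrightarrow> \<pi> 0 x = x"
  using rep(1) by (auto simp: group_rep_def dest: bounded_opD)

lemma \<pi>_minus: "\<lbrakk>x \<in> carrier X; y \<in> carrier X\<rbrakk> \<Longrightarrow> \<pi> t (x \<ominus> y) = \<pi> t x \<ominus> \<pi> t y"
  by (simp add: a_minus_def Lp.uminus_eq_scale \<pi>_add \<pi>_scale)

lemma op_norm_\<pi>_le: "op_norm X X (\<pi> t) \<le> M"
  using rep(3) unfolding rep_norm_def bounded_rep_def by (intro cSUP_upper) auto

lemma M_nonneg: "0 \<le> M"
proof -
  have "bounded_op X X (\<pi> 0)" using rep(1) by (simp add: group_rep_def)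
  then have "0 \<le> op_norm X X (\<pi> 0)" using Lp.nrm_smult Lp.seminorm_nonneg by (rule Lp.op_norm_nonneg)
  then show ?thesis using op_norm_\<pi>_le order_trans by blast
qed

lemma nrm_\<pi>_le: assumes x: "x \<in> carrier X" shows "nrm X (\<pi> t x) \<le> M * nrm X x"
proof -
  have "bounded_op X X (\<pi> t)" using rep(1) by (simp add: group_rep_def)
  then have "nrm X (\<pi> t x) \<le> op_norm X X (\<pi> t) * nrm X x"
    using Lp.nrm_smult x by (rule Lp.op_norm_bound)
  also have "\<dots> \<le> M * nrm X x" using op_norm_\<pi>_le x by (intro mult_right_mono) auto
  finally show ?thesis .
qed

lemma \<pi>_continuous:
  assumes "x \<in> carrier X" "0 < \<epsilon>"
  shows "\<forall>\<^sub>F s in nhds t. nrm X (\<pi> s x \<ominus> \<pi> t x) < \<epsilon>"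
  using rep(2) assms by (simp add: continuous_rep_def Lp.continuous_map_ntopology_iff)

section \<open>Weighted orbits and the embedding\<close>

definition k :: "'i \<Rightarrow> 'g \<Rightarrow> real" where "k j s = h j s powr (1 / p)"

lemma k_nonneg [simp]: "0 \<le> k j s" by (simp add: k_def)

lemma k_powr: "k j s powr p = h j s"
  using p1 weightsD(2)[OF h(1)] by (simp add: k_def powr_powr)

lemma k_simple: "simple_function \<mu> (k j)"
  unfolding k_def[abs_def] by (rule simple_function_compose1[OF weightsD(1)[OF h(1)]])

lemma k_measurable: "k j \<in> borel_measurable \<mu>"
  by (rule borel_measurable_simple_function[OF k_simple])

definition orbit :: "'i \<Rightarrow> 'v \<Rightarrow> 'g \<Rightarrow> 'v" where
  "orbit j x s = complex_of_real (k j s) \<odot> \<pi> (- s) x"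

text \<open>The orbit is continuous, hence strongly measurable on a compact set outside which the
  weight vanishes. As \<open>k j s powr p = h j s\<close> has mass 1, only the factor
  \<open>M\<close> survives in the norm.\<close>

lemma orbit_functions:
  assumes x: "x \<in> carrier X"
  shows "orbit j x \<in> carrier Lp.F" "nrm Lp.F (orbit j x) \<le> M * nrm X x"
proof -
  obtain K where K: "compact K" "\<And>s. s \<notin> K \<Longrightarrow> h j s = 0"
    using weightsD(5)[OF h(1)] by metis
  have "strongly_measurable \<mu> X (\<lambda>s. if s \<in> K then \<pi> (- s) x else \<zero>)"
  proof (rule Lp.strongly_measurable_on_compact[OF sets_haar K(1)])
    fix t :: 'g and \<epsilon> :: real assume \<epsilon>: "0 < \<epsilon>"
    have "filterlim uminus (nhds (- t)) (nhds t)"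
      using tendsto_uminus_nhds by blast
    then show "\<forall>\<^sub>F s in nhds t. nrm X (\<pi> (- s) x \<ominus> \<pi> (- t) x) < \<epsilon>"
      using \<pi>_continuous[OF x \<epsilon>, of "- t"] by (auto simp: filterlim_iff)
  qed (use x in simp)
  then have "strongly_measurable \<mu> X (\<lambda>s. complex_of_real (k j s) \<odot> (if s \<in> K then \<pi> (- s) x else \<zero>))"
    by (rule Lp.strongly_measurable_scale_simple[OF _ simple_function_compose1[OF k_simple]])
  moreover have "complex_of_real (k j s) \<odot> (if s \<in> K then \<pi> (- s) x else \<zero>) = orbit j x s" for s
    using K(2)[of s] x by (auto simp: orbit_def k_def)
  ultimately have sm: "strongly_measurable \<mu> X (orbit j x)" by simp
  have int: "integrable \<mu> (\<lambda>s. h j s * (M * nrm X x) powr p)"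
    using weightsD(3)[OF h(1)] by simp
  have le: "nrm X (orbit j x s) powr p \<le> h j s * (M * nrm X x) powr p" for s
  proof -
    have "nrm X (orbit j x s) \<le> k j s * (M * nrm X x)"
      using nrm_\<pi>_le[OF x, of "- s"] x by (simp add: orbit_def Lp.nrm_smult mult_left_mono)
    then have "nrm X (orbit j x s) powr p \<le> (k j s * (M * nrm X x)) powr p"
      using p1 x by (intro powr_mono2) (auto simp: orbit_def)
    then show ?thesis using M_nonneg x by (simp add: powr_mult k_powr)
  qed
  show F: "orbit j x \<in> carrier Lp.F"
    by (rule Lp.functionsI[OF _ sm int]) (use x le in \<open>auto simp: orbit_def\<close>)
  have "nrm Lp.F (orbit j x) \<le> (\<integral>s. h j s * (M * nrm X x) powr p \<partial>\<mu>) powr (1 / p)"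
    by (rule Lp.Lp_nrm_le[OF F int]) (use le in simp)
  also have "\<dots> = M * nrm X x"
    using p1 M_nonneg x h(2)[of j] by (simp add: powr_powr)
  finally show "nrm Lp.F (orbit j x) \<le> M * nrm X x" .
qed

definition J :: "'v \<Rightarrow> ('i \<Rightarrow> ('g \<Rightarrow> 'v) set) set" where
  "J x = Ul.cls (\<lambda>j. Lp.Lcls (orbit j x))"

lemma J_families:
  assumes "x \<in> carrier X" shows "(\<lambda>j. Lp.Lcls (orbit j x)) \<in> carrier Ul.B"
  using orbit_functions[OF assms] by (intro Ul.familiesI[of _ "M * nrm X x"]) (auto simp: Lp.Z_simps)

lemma J_bound: assumes "x \<in> carrier X" shows "nrm Y (J x) \<le> M * nrm X x"
  using orbit_functions[OF assms] J_families[OF assms]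
  by (auto simp: J_def Ul.Y_simps Lp.Z_simps intro!: Ul.limnorm_leI always_eventually)

lemma J_bounded_op: "bounded_op X Y J"
  unfolding bounded_op_def
proof (intro conjI ballI allI)
  show "J \<in> carrier X \<rightarrow> carrier Y" by (auto simp: J_def Ul.Y_simps J_families)
  fix x y assume xy: "x \<in> carrier X" "y \<in> carrier X"
  have "orbit j (x \<oplus> y) = (\<lambda>s. orbit j x s \<oplus> orbit j y s)" for j
    using xy by (simp add: orbit_def \<pi>_add Lp.scale_add_right fun_eq_iff)
  then show "J (x \<oplus> y) = J x \<oplus>\<^bsub>Y\<^esub> J y"
    using xy by (simp add: J_def Ul.Y_simps J_families Lp.Z_simps orbit_functions)
next
  fix a x assume x: "x \<in> carrier X"
  have "orbit j (a \<odot> x) = (\<lambda>s. a \<odot> orbit j x s)" for j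
    using x by (simp add: orbit_def \<pi>_scale Lp.scale_scale mult.commute fun_eq_iff)
  then show "J (a \<odot> x) = a \<odot>\<^bsub>Y\<^esub> J x"
    using x by (simp add: J_def Ul.Y_simps J_families Lp.Z_simps orbit_functions)
next
  show "\<exists>K. \<forall>x\<in>carrier X. nrm Y (J x) \<le> K * nrm X x" using J_bound by blast
qed

section \<open>Translations on the ultrapower\<close>

definition rep_hat :: "'g \<Rightarrow> ('i \<Rightarrow> ('g \<Rightarrow> 'v) set) set \<Rightarrow> ('i \<Rightarrow> ('g \<Rightarrow> 'v) set) set" where
  "rep_hat t = Ul.extension (\<lambda>j. Lp.pullback (\<lambda>s. - t + s))"

lemmas translation = translation_measurable translation_distr
lemmas translation_isometry = Lp.pullback_isometry[OF translation]

lemma rep_hat_cls: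
  "x \<in> carrier Ul.B \<Longrightarrow> rep_hat t (Ul.cls x) = Ul.cls (\<lambda>j. Lp.pullback (\<lambda>s. - t + s) (x j))"
  unfolding rep_hat_def by (rule Ul.extension_cls) (simp_all add: translation_isometry)

lemma rep_hat_families:
  "x \<in> carrier Ul.B \<Longrightarrow> (\<lambda>j. Lp.pullback (\<lambda>s. - t + s) (x j)) \<in> carrier Ul.B"
  by (rule Ul.families_extension) (simp_all add: translation_isometry)

lemma rep_hat_isometric: "isometric_rep Y rep_hat"
  unfolding isometric_rep_def rep_hat_def
  by (intro allI ballI Ul.extension_isometry) (simp_all add: translation_isometry)

text \<open>The inverse in \<open>- t + s\<close> makes pullbacks compose in the order of the group,
  as noncommutativity requires.\<close>

lemma pullback_comp:
  assumes "z \<in> carrier Z"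
  shows "Lp.pullback (\<lambda>x. - (s + t) + x) z = Lp.pullback (\<lambda>x. - s + x) (Lp.pullback (\<lambda>x. - t + x) z)"
    and "Lp.pullback (\<lambda>x. - 0 + x) z = z"
proof -
  obtain f where f: "f \<in> carrier Lp.F" "z = Lp.Lcls f" using assms by (rule Lp.Z_carrierE)
  have "f (- (s + t) + x) = f (- t + (- s + x))" for x by (simp only: minus_add add.assoc)
  then show "Lp.pullback (\<lambda>x. - (s + t) + x) z = Lp.pullback (\<lambda>x. - s + x) (Lp.pullback (\<lambda>x. - t + x) z)"
    using f Lp.functions_pullback(1)[OF translation f(1)] by (simp only: Lp.pullback_cls[OF translation])
  show "Lp.pullback (\<lambda>x. - 0 + x) z = z"
    using f by (simp only: Lp.pullback_cls[OF translation]) simp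
qed

lemma rep_hat_group_rep: "group_rep Y rep_hat"
  unfolding group_rep_def
proof (intro conjI allI ballI)
  show "bounded_op Y Y (rep_hat t)" for t
    unfolding rep_hat_def by (rule Ul.extension_bounded) (simp_all add: translation_isometry)
  fix s t z assume "z \<in> carrier Y"
  then obtain x where x: "x \<in> carrier Ul.B" "z = Ul.cls x" by (rule Ul.Y_carrierE)
  show "rep_hat (s + t) z = rep_hat s (rep_hat t z)"
    using x pullback_comp(1)[OF Ul.families_carrier[OF x(1)], of s t]
    by (simp only: rep_hat_cls rep_hat_families)
next
  fix z assume "z \<in> carrier Y"
  then obtain x where x: "x \<in> carrier Ul.B" "z = Ul.cls x" by (rule Ul.Y_carrierE)
  show "rep_hat 0 z = z"
    using x pullback_comp(2)[OF Ul.families_carrier[OF x(1)]] by (simp only: rep_hat_cls)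
qed

text \<open>Translating the orbit of \<open>x\<close> by \<open>t\<close> gives the orbit of
  \<open>\<pi> t x\<close> with a shifted weight; the difference is
  \<open>k j (- t + s) - k j s\<close> times a bounded vector. By \<open>powr_root_diff_le\<close>
  its Lp norm is controlled by the L1 invariance defect of \<open>h j\<close>, which tends to zero,
  so the classes agree.\<close>

lemma rep_hat_J:
  assumes x: "x \<in> carrier X" shows "rep_hat t (J x) = J (\<pi> t x)"
proof -
  let ?y = "\<pi> t x" and ?c = "(M * nrm X (\<pi> t x)) powr p"
  have y: "?y \<in> carrier X" using x by simp
  define d where "d j = (\<lambda>s. orbit j x (- t + s) \<ominus> orbit j ?y s)" for j
  have tr: "(\<lambda>s. orbit j x (- t + s)) \<in> carrier Lp.F" for j
    by (rule Lp.functions_pullback(1)[OF translation orbit_functions(1)[OF x]])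
  have dF: "d j \<in> carrier Lp.F" for j
    unfolding d_def by (rule Lp.functions_minus(2)[OF tr orbit_functions(1)[OF y]])
  have int: "integrable \<mu> (\<lambda>s. \<bar>h j (- t + s) - h j s\<bar> * ?c)" for j
    using weightsD(3)[OF h(1), of j] integrable_translation[of "h j" "- t"] by simp
  have le: "nrm X (d j s) powr p \<le> \<bar>h j (- t + s) - h j s\<bar> * ?c" for j s
  proof -
    have "- (- t + s) = - s + t" by (simp add: minus_add)
    then have "\<pi> (- (- t + s)) x = \<pi> (- s) ?y" using x by (simp only: \<pi>_comp)
    then have "d j s = (complex_of_real (k j (- t + s)) - complex_of_real (k j s)) \<odot> \<pi> (- s) ?y"
      using y by (simp only: d_def orbit_def Lp.scale_minus_left \<pi>_closed)
    then have "d j s = complex_of_real (k j (- t + s) - k j s) \<odot> \<pi> (- s) ?y" by simp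
    then have "nrm X (d j s) = \<bar>k j (- t + s) - k j s\<bar> * nrm X (\<pi> (- s) ?y)"
      using y by (simp only: Lp.nrm_smult \<pi>_closed norm_of_real)
    also have "\<dots> \<le> \<bar>k j (- t + s) - k j s\<bar> * (M * nrm X ?y)"
      using nrm_\<pi>_le[OF y] by (intro mult_left_mono) auto
    finally have "nrm X (d j s) powr p \<le> (\<bar>k j (- t + s) - k j s\<bar> * (M * nrm X ?y)) powr p"
      using p1 Lp.functionsD(1)[OF dF] by (intro powr_mono2) auto
    also have "\<dots> = \<bar>k j (- t + s) - k j s\<bar> powr p * ?c"
      using M_nonneg y by (simp add: powr_mult)
    also have "\<dots> \<le> \<bar>h j (- t + s) - h j s\<bar> * ?c"
      unfolding k_def using weightsD(2)[OF h(1)] p1 by (intro mult_right_mono powr_root_diff_le) auto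
    finally show ?thesis .
  qed
  have "nrm Lp.F (d j) \<le> ((\<integral>s. \<bar>h j (- t + s) - h j s\<bar> \<partial>\<mu>) * ?c) powr (1 / p)" for j
    using Lp.Lp_nrm_le[OF dF int] le by simp
  moreover have "((\<lambda>j. ((\<integral>s. \<bar>h j (- t + s) - h j s\<bar> \<partial>\<mu>) * ?c) powr (1 / p)) \<longlongrightarrow> (0 * ?c) powr (1 / p)) U"
    using p1 by (intro tendsto_powr' tendsto_mult h_lim tendsto_const) auto
  ultimately have "((\<lambda>j. nrm Lp.F (d j)) \<longlongrightarrow> 0) U"
    using Lp.F.seminorm_nonneg[OF dF]
    by (intro Lim_null_comparison[of "\<lambda>j. nrm Lp.F (d j)"]) (auto intro!: always_eventually)
  moreover have "nrm Z (Lp.Lcls (\<lambda>s. orbit j x (- t + s)) \<ominus>\<^bsub>Z\<^esub> Lp.Lcls (orbit j ?y)) = nrm Lp.F (d j)" for j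
    using tr orbit_functions(1)[OF y] dF by (simp add: Lp.Z_simps d_def)
  ultimately have "Ul.cls (\<lambda>j. Lp.Lcls (\<lambda>s. orbit j x (- t + s))) = Ul.cls (\<lambda>j. Lp.Lcls (orbit j ?y))"
    using rep_hat_families[OF J_families[OF x], of t] J_families[OF y]
    by (intro Ul.cls_eqI) (simp_all add: Lp.pullback_cls[OF translation orbit_functions(1)[OF x]])
  then show ?thesis
    using rep_hat_cls[OF J_families[OF x]] by (simp add: J_def Lp.pullback_cls[OF translation orbit_functions(1)[OF x]])
qed

lemma rep_hat_J_continuous:
  assumes x: "x \<in> carrier X"
  shows "continuous_map euclidean (ntopology Y) (\<lambda>t. rep_hat t (J x))"
proof -
  have JY: "J y \<in> carrier Y" if "y \<in> carrier X" for y by (rule bounded_opD(1)[OF J_bounded_op that])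
  have "\<forall>\<^sub>F s in nhds t. nrm Y (J (\<pi> s x) \<ominus>\<^bsub>Y\<^esub> J (\<pi> t x)) < \<epsilon>" if \<epsilon>: "0 < \<epsilon>" for t \<epsilon>
  proof -
    \<comment> \<open>\<open>M + 1\<close> avoids a division by zero when
      \<open>M = 0\<close>.\<close>
    have "0 < \<epsilon> / (M + 1)" using \<epsilon> M_nonneg by simp
    then have "\<forall>\<^sub>F s in nhds t. nrm X (\<pi> s x \<ominus> \<pi> t x) < \<epsilon> / (M + 1)" by (rule \<pi>_continuous[OF x])
    then show ?thesis
    proof eventually_elim
      case (elim s)
      have "J (\<pi> s x) \<ominus>\<^bsub>Y\<^esub> J (\<pi> t x) = J (\<pi> s x \<ominus> \<pi> t x)"
        using x JY bounded_opD(2,3)[OF J_bounded_op]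
        by (simp add: a_minus_def Lp.uminus_eq_scale Ul.Y.uminus_eq_scale)
      then have "nrm Y (J (\<pi> s x) \<ominus>\<^bsub>Y\<^esub> J (\<pi> t x)) \<le> M * nrm X (\<pi> s x \<ominus> \<pi> t x)"
        using J_bound x by simp
      also have "\<dots> \<le> (M + 1) * nrm X (\<pi> s x \<ominus> \<pi> t x)" using x by (intro mult_right_mono) auto
      also have "\<dots> < \<epsilon>" using elim M_nonneg by (simp add: field_simps)
      finally show ?case .
    qed
  qed
  then show ?thesis
    using x JY by (subst Ul.Y.continuous_map_ntopology_iff) (auto simp: rep_hat_J)
qed

section \<open>Weak integrals against the dual weight\<close>

definition pairing :: "'i \<Rightarrow> ('v \<Rightarrow> complex) \<Rightarrow> ('g \<Rightarrow> 'v) \<Rightarrow> complex" where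
  "pairing j \<phi> f = (\<integral>s. complex_of_real (k j s powr (p - 1)) * \<phi> (\<pi> s (f s)) \<partial>\<mu>)"

text \<open>For a fixed vector the scalar function is continuous. A simple \<open>f\<close> glues
  finitely many such functions, and the Lipschitz bound \<open>nrm (dual X) \<phi> * M\<close>,
  uniform in \<open>s\<close>, passes to pointwise limits.\<close>

lemma weak_measurable:
  assumes \<phi>: "\<phi> \<in> carrier (dual X)" and f: "f \<in> carrier Lp.F"
  shows "(\<lambda>s. \<phi> (\<pi> s (f s))) \<in> borel_measurable \<mu>"
proof -
  note fc = Lp.functionsD(1)[OF f]
  have lip: "cmod (\<phi> (\<pi> s x) - \<phi> (\<pi> s y)) \<le> nrm (dual X) \<phi> * (M * nrm X (x \<ominus> y))"
    if "x \<in> carrier X" "y \<in> carrier X" for s x y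
  proof -
    have "cmod (\<phi> (\<pi> s (x \<ominus> y))) \<le> nrm (dual X) \<phi> * nrm X (\<pi> s (x \<ominus> y))"
      using that by (intro Lp.dualD(4)[OF \<phi>]) simp
    also have "\<dots> \<le> nrm (dual X) \<phi> * (M * nrm X (x \<ominus> y))"
      using that nrm_\<pi>_le[of "x \<ominus> y" s] Lp.dualD(5)[OF \<phi>] by (intro mult_left_mono) auto
    finally show ?thesis using that by (simp add: \<pi>_minus Lp.dualD(3)[OF \<phi>])
  qed
  have cont: "(\<lambda>s. \<phi> (\<pi> s x)) \<in> borel_measurable \<mu>" if x: "x \<in> carrier X" for x
  proof (rule measurable_haar)
    have "((\<lambda>s. \<phi> (\<pi> s x)) \<longlongrightarrow> \<phi> (\<pi> t x)) (at t)" for t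
    proof (rule tendstoI)
      fix e :: real assume e: "0 < e"
      let ?n = "nrm (dual X) \<phi>"
      have "\<forall>\<^sub>F s in nhds t. nrm X (\<pi> s x \<ominus> \<pi> t x) < e / (?n + 1)"
        using e Lp.dualD(5)[OF \<phi>] by (intro \<pi>_continuous x) simp
      then have "\<forall>\<^sub>F s in nhds t. dist (\<phi> (\<pi> s x)) (\<phi> (\<pi> t x)) < e"
      proof eventually_elim
        case (elim s)
        have "dist (\<phi> (\<pi> s x)) (\<phi> (\<pi> t x)) \<le> ?n * nrm X (\<pi> s x \<ominus> \<pi> t x)"
          using x Lp.dualD(4)[OF \<phi>, of "\<pi> s x \<ominus> \<pi> t x"] by (simp add: dist_norm Lp.dualD(3)[OF \<phi>])
        also have "\<dots> \<le> (?n + 1) * nrm X (\<pi> s x \<ominus> \<pi> t x)" using x by (intro mult_right_mono) auto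
        also have "\<dots> < e" using elim Lp.dualD(5)[OF \<phi>] by (simp add: field_simps)
        finally show ?case .
      qed
      then show "\<forall>\<^sub>F s in at t. dist (\<phi> (\<pi> s x)) (\<phi> (\<pi> t x)) < e"
        by (auto simp: eventually_at_filter elim: eventually_mono)
    qed
    then show "continuous_on UNIV (\<lambda>s. \<phi> (\<pi> s x))" by (simp add: continuous_on_def)
  qed
  obtain \<sigma> where \<sigma>: "\<And>n. simple_function \<mu> (\<sigma> n)" "\<And>n s. s \<in> space \<mu> \<Longrightarrow> \<sigma> n s \<in> carrier X"
    "\<And>s. s \<in> space \<mu> \<Longrightarrow> (\<lambda>n. nrm X (\<sigma> n s \<ominus> f s)) \<longlonglongrightarrow> 0"
    by (rule Lp.strongly_measurableE[OF Lp.functionsD(2)[OF f]]) blast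
  show ?thesis
  proof (rule borel_measurable_LIMSEQ_metric)
    fix n
    have fin: "finite (range (\<sigma> n))" using simple_functionD(1)[OF \<sigma>(1)[of n]] by simp
    show "(\<lambda>s. \<phi> (\<pi> s (\<sigma> n s))) \<in> borel_measurable \<mu>"
    proof (rule measurable_compose_countable'[of "range (\<sigma> n)" "\<lambda>x s. \<phi> (\<pi> s x)" _ _ "\<sigma> n"])
      show "\<sigma> n \<in> measurable \<mu> (count_space (range (\<sigma> n)))"
        using measurable_simple_function[OF \<sigma>(1)[of n]] by (auto simp: measurable_def)
    qed (use cont \<sigma>(2) fin in \<open>auto simp: countable_finite\<close>)
  next
    fix s
    have "(\<lambda>n. nrm (dual X) \<phi> * (M * nrm X (\<sigma> n s \<ominus> f s))) \<longlonglongrightarrow> nrm (dual X) \<phi> * (M * 0)"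
      by (intro tendsto_intros \<sigma>(3)) simp
    then have "(\<lambda>n. nrm (dual X) \<phi> * (M * nrm X (\<sigma> n s \<ominus> f s))) \<longlonglongrightarrow> 0" by simp
    then have "(\<lambda>n. \<phi> (\<pi> s (\<sigma> n s)) - \<phi> (\<pi> s (f s))) \<longlonglongrightarrow> 0"
      by (rule Lim_null_comparison[rotated]) (use lip \<sigma>(2) fc in \<open>auto intro!: always_eventually\<close>)
    then show "(\<lambda>n. \<phi> (\<pi> s (\<sigma> n s))) \<longlonglongrightarrow> \<phi> (\<pi> s (f s))" by (simp add: LIM_zero_iff)
  qed
qed

text \<open>Hoelder's inequality with \<open>k j\<close> as the normalised function and, for
  \<open>b\<close>, the norm of \<open>f\<close> times \<open>M * nrm (dual X) \<phi>\<close>; this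
  \<open>M\<close> comes from applying \<open>\<pi> s\<close>.\<close>

lemma pairing_integrable:
  assumes \<phi>: "\<phi> \<in> carrier (dual X)" and f: "f \<in> carrier Lp.F"
  shows "integrable \<mu> (\<lambda>s. complex_of_real (k j s powr (p - 1)) * \<phi> (\<pi> s (f s)))"
    and "cmod (pairing j \<phi> f) \<le> M * nrm Lp.F f * nrm (dual X) \<phi>"
proof -
  define c where "c = M * nrm (dual X) \<phi>"
  define b where "b s = c * nrm X (f s)" for s
  have c: "0 \<le> c" using M_nonneg Lp.dualD(5)[OF \<phi>] by (simp add: c_def)
  note fc = Lp.functionsD(1)[OF f]
  have b0: "0 \<le> b s" for s using c fc by (simp add: b_def)
  have bp: "b s powr p = c powr p * nrm X (f s) powr p" for s
    using c fc by (simp add: b_def powr_mult)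
  have ib: "integrable \<mu> (\<lambda>s. b s powr p)" using Lp.functionsD(3)[OF f] by (simp add: bp)
  have mb: "b \<in> borel_measurable \<mu>" unfolding b_def[abs_def] using Lp.functionsD(4)[OF f] by measurable
  have ik: "integrable \<mu> (\<lambda>s. k j s powr p)" "(\<integral>s. k j s powr p \<partial>\<mu>) = 1"
    using weightsD(3)[OF h(1)] h(2) by (simp_all add: k_powr)
  note hoelder = hoelder_normalized[OF p1 ik(1) k_measurable k_nonneg ik(2) ib mb b0]
  have le: "cmod (complex_of_real (k j s powr (p - 1)) * \<phi> (\<pi> s (f s))) \<le> k j s powr (p - 1) * b s" for s
  proof -
    have "cmod (\<phi> (\<pi> s (f s))) \<le> nrm (dual X) \<phi> * nrm X (\<pi> s (f s))"
      using fc by (intro Lp.dualD(4)[OF \<phi>]) simp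
    also have "\<dots> \<le> nrm (dual X) \<phi> * (M * nrm X (f s))"
      using fc nrm_\<pi>_le Lp.dualD(5)[OF \<phi>] by (intro mult_left_mono) auto
    finally have "cmod (\<phi> (\<pi> s (f s))) \<le> b s" by (simp add: b_def c_def mult_ac)
    then show ?thesis by (simp add: norm_mult mult_left_mono)
  qed
  show int: "integrable \<mu> (\<lambda>s. complex_of_real (k j s powr (p - 1)) * \<phi> (\<pi> s (f s)))"
  proof (rule Bochner_Integration.integrable_bound[OF hoelder(1)])
    show "(\<lambda>s. complex_of_real (k j s powr (p - 1)) * \<phi> (\<pi> s (f s))) \<in> borel_measurable \<mu>"
      using weak_measurable[OF \<phi> f] k_measurable[of j] by measurable
    show "AE s in \<mu>. norm (complex_of_real (k j s powr (p - 1)) * \<phi> (\<pi> s (f s))) \<le> norm (k j s powr (p - 1) * b s)"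
      using le b0 by simp
  qed
  have "cmod (pairing j \<phi> f) \<le> (\<integral>s. k j s powr (p - 1) * b s \<partial>\<mu>)"
    unfolding pairing_def
    using order_trans[OF integral_norm_bound integral_mono[OF integrable_norm[OF int] hoelder(1) le]] .
  also have "\<dots> \<le> (\<integral>s. b s powr p \<partial>\<mu>) powr (1 / p)" by (rule hoelder(2))
  also have "\<dots> = c * nrm Lp.F f"
    using c p1 by (simp add: bp Lp.functions_simps powr_mult powr_powr)
  finally show "cmod (pairing j \<phi> f) \<le> M * nrm Lp.F f * nrm (dual X) \<phi>" by (simp add: c_def mult_ac)
qed

lemma pairing_linear:
  assumes \<phi>: "\<phi> \<in> carrier (dual X)" and f: "f \<in> carrier Lp.F"
  shows "g \<in> carrier Lp.F \<Longrightarrow> pairing j \<phi> (\<lambda>s. f s \<oplus> g s) = pairing j \<phi> f + pairing j \<phi> g"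
    and "g \<in> carrier Lp.F \<Longrightarrow> pairing j \<phi> (\<lambda>s. f s \<ominus> g s) = pairing j \<phi> f - pairing j \<phi> g"
    and "pairing j \<phi> (\<lambda>s. a \<odot> f s) = a * pairing j \<phi> f"
  using pairing_integrable(1)[OF \<phi>] f Lp.functionsD(1)
  by (simp_all add: pairing_def \<pi>_add \<pi>_minus \<pi>_scale Lp.dualD[OF \<phi>] distrib_left right_diff_distrib
      mult.left_commute[of _ a])

lemma pairing_dual_linear:
  assumes \<phi>: "\<phi> \<in> carrier (dual X)" and f: "f \<in> carrier Lp.F"
  shows "\<psi> \<in> carrier (dual X) \<Longrightarrow> pairing j (\<phi> \<oplus>\<^bsub>dual X\<^esub> \<psi>) f = pairing j \<phi> f + pairing j \<psi> f"
    and "pairing j (a \<odot>\<^bsub>dual X\<^esub> \<phi>) f = a * pairing j \<phi> f"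
  using pairing_integrable(1)[OF _ f] \<phi> Lp.functionsD(1)[OF f]
  by (simp_all add: pairing_def dual_def distrib_left mult.left_commute[of _ a])

definition pairing_cls :: "'i \<Rightarrow> ('v \<Rightarrow> complex) \<Rightarrow> ('g \<Rightarrow> 'v) set \<Rightarrow> complex" where
  "pairing_cls j \<phi> z = pairing j \<phi> (SOME f. f \<in> z)"

text \<open>The bound in \<open>pairing_integrable\<close> annihilates null functions, so the choice
  of a representative does not matter.\<close>

lemma pairing_cls:
  assumes \<phi>: "\<phi> \<in> carrier (dual X)" and f: "f \<in> carrier Lp.F"
  shows "pairing_cls j \<phi> (Lp.Lcls f) = pairing j \<phi> f"
proof -
  let ?g = "SOME g. g \<in> Lp.Lcls f"
  have "?g \<in> Lp.Lcls f" using Lp.F.cls_self[OF f] by (rule someI[of "\<lambda>g. g \<in> Lp.Lcls f"])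
  then have g: "?g \<in> carrier Lp.F" "nrm Lp.F (?g \<ominus>\<^bsub>Lp.F\<^esub> f) = 0" using f by (simp_all add: Lp.F.mem_cls)
  have "cmod (pairing j \<phi> ?g - pairing j \<phi> f) \<le> 0"
    using pairing_integrable(2)[OF \<phi> Lp.functions_minus(2)[OF g(1) f], of j] g(2)
    by (simp add: pairing_linear(2)[OF \<phi> g(1) f] Lp.functions_minus(1)[OF g(1) f])
  then show ?thesis by (simp add: pairing_cls_def)
qed

lemma pairing_cls_bound:
  assumes \<phi>: "\<phi> \<in> carrier (dual X)" and z: "z \<in> carrier Z"
  shows "cmod (pairing_cls j \<phi> z) \<le> M * nrm Z z * nrm (dual X) \<phi>"
  using z pairing_integrable(2)[OF \<phi>] by (auto elim!: Lp.Z_carrierE simp: pairing_cls[OF \<phi>] Lp.Z_simps)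

lemma pairing_cls_linear:
  assumes \<phi>: "\<phi> \<in> carrier (dual X)" and z: "z \<in> carrier Z"
  shows "w \<in> carrier Z \<Longrightarrow> pairing_cls j \<phi> (z \<oplus>\<^bsub>Z\<^esub> w) = pairing_cls j \<phi> z + pairing_cls j \<phi> w"
    and "w \<in> carrier Z \<Longrightarrow> pairing_cls j \<phi> (z \<ominus>\<^bsub>Z\<^esub> w) = pairing_cls j \<phi> z - pairing_cls j \<phi> w"
    and "pairing_cls j \<phi> (a \<odot>\<^bsub>Z\<^esub> z) = a * pairing_cls j \<phi> z"
  using z by (auto elim!: Lp.Z_carrierE simp: pairing_cls[OF \<phi>] pairing_linear[OF \<phi>] Lp.Z_simps
      Lp.functions_add Lp.functions_minus Lp.functions_scale)

section \<open>The map into the bidual\<close>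

definition Q :: "('i \<Rightarrow> ('g \<Rightarrow> 'v) set) set \<Rightarrow> ('v \<Rightarrow> complex) \<Rightarrow> complex" where
  "Q z = (\<lambda>\<phi>\<in>carrier (dual X). Lim U (\<lambda>j. pairing_cls j \<phi> ((SOME x. x \<in> z) j)))"

text \<open>The scalars are bounded, so they converge along the ultrafilter for each
  \<open>\<phi>\<close>; another representative family changes them by at most a multiple of a norm
  tending to zero. The limit is taken functional by functional, hence its home is the
  bidual.\<close>

lemma Q_tendsto:
  assumes \<phi>: "\<phi> \<in> carrier (dual X)" and x: "x \<in> carrier Ul.B"
  shows "((\<lambda>j. pairing_cls j \<phi> (x j)) \<longlongrightarrow> Q (Ul.cls x) \<phi>) U"
proof -
  let ?y = "SOME y. y \<in> Ul.cls x" and ?n = "nrm (dual X) \<phi>"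
  have "?y \<in> Ul.cls x" using Ul.B.cls_self[OF x] by (rule someI[of "\<lambda>y. y \<in> Ul.cls x"])
  then have y: "?y \<in> carrier Ul.B" "Ul.limnorm (?y \<ominus>\<^bsub>Ul.B\<^esub> x) = 0" using x by (simp_all add: Ul.B.mem_cls)
  obtain C where C: "\<And>j. nrm Z (?y j) \<le> C" using Ul.families_bound[OF y(1)] by blast
  have "cmod (pairing_cls j \<phi> (?y j)) \<le> M * C * ?n" for j
    using pairing_cls_bound[OF \<phi> Ul.families_carrier[OF y(1), of j], of j]
      mult_right_mono[OF mult_left_mono[OF C[of j] M_nonneg] Lp.dualD(5)[OF \<phi>]] by linarith
  then have "bounded (range (\<lambda>j. pairing_cls j \<phi> (?y j)))" by (intro boundedI) auto
  then have lim: "((\<lambda>j. pairing_cls j \<phi> (?y j)) \<longlongrightarrow> Q (Ul.cls x) \<phi>) U"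
    using ultrafilter_bounded_tendsto[OF Ul.ultrafilter] \<phi> by (simp add: Q_def)
  have "((\<lambda>j. nrm Z (?y j \<ominus>\<^bsub>Z\<^esub> x j)) \<longlongrightarrow> 0) U"
    using Ul.limnorm_tendsto[OF Ul.families_minus_closed[OF y(1) x]] y(2)
    by (simp add: Ul.families_minus[OF y(1) x])
  then have "((\<lambda>j. M * nrm Z (?y j \<ominus>\<^bsub>Z\<^esub> x j) * ?n) \<longlongrightarrow> M * 0 * ?n) U"
    by (intro tendsto_intros)
  then have "((\<lambda>j. M * nrm Z (?y j \<ominus>\<^bsub>Z\<^esub> x j) * ?n) \<longlongrightarrow> 0) U" by simp
  then have "((\<lambda>j. pairing_cls j \<phi> (?y j) - pairing_cls j \<phi> (x j)) \<longlongrightarrow> 0) U"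
  proof (rule Lim_null_comparison[rotated], intro always_eventually allI)
    fix j
    have c: "?y j \<in> carrier Z" "x j \<in> carrier Z" by (rule Ul.families_carrier[OF y(1)], rule Ul.families_carrier[OF x])
    show "norm (pairing_cls j \<phi> (?y j) - pairing_cls j \<phi> (x j)) \<le> M * nrm Z (?y j \<ominus>\<^bsub>Z\<^esub> x j) * ?n"
      using pairing_cls_bound[OF \<phi> Lp.Z.M.minus_closed[OF c], of j] pairing_cls_linear(2)[OF \<phi> c, of j] by simp
  qed
  from tendsto_diff[OF lim this] show ?thesis by simp
qed

lemma Q_eqI:
  assumes "\<phi> \<in> carrier (dual X)" "x \<in> carrier Ul.B" "((\<lambda>j. pairing_cls j \<phi> (x j)) \<longlongrightarrow> l) U"
  shows "Q (Ul.cls x) \<phi> = l"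
  using tendsto_unique[OF ultrafilterD(2)[OF Ul.ultrafilter] Q_tendsto[OF assms(1,2)] assms(3)] .

lemma dual_closed:
  assumes \<phi>: "\<phi> \<in> carrier (dual X)"
  shows "\<psi> \<in> carrier (dual X) \<Longrightarrow> \<phi> \<oplus>\<^bsub>dual X\<^esub> \<psi> \<in> carrier (dual X)"
    and "a \<odot>\<^bsub>dual X\<^esub> \<phi> \<in> carrier (dual X)"
proof -
  assume \<psi>: "\<psi> \<in> carrier (dual X)"
  let ?K = "nrm (dual X) \<phi> + nrm (dual X) \<psi>"
  have "cmod (\<phi> x + \<psi> x) \<le> ?K * nrm X x" if "x \<in> carrier X" for x
    using Lp.dualD(4)[OF \<phi> that] Lp.dualD(4)[OF \<psi> that] norm_triangle_ineq[of "\<phi> x" "\<psi> x"]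
    by (simp add: distrib_right)
  then show "\<phi> \<oplus>\<^bsub>dual X\<^esub> \<psi> \<in> carrier (dual X)"
    using Lp.dualD[OF \<phi>] Lp.dualD[OF \<psi>]
    by (auto simp: dual_def bounded_op_def complex_space_def algebra_simps intro!: exI[of _ ?K])
next
  let ?K = "cmod a * nrm (dual X) \<phi>"
  have "cmod (a * \<phi> x) \<le> ?K * nrm X x" if "x \<in> carrier X" for x
    using Lp.dualD(4)[OF \<phi> that] by (simp add: norm_mult mult.assoc mult_left_mono)
  then show "a \<odot>\<^bsub>dual X\<^esub> \<phi> \<in> carrier (dual X)"
    using Lp.dualD[OF \<phi>]
    by (auto simp: dual_def bounded_op_def complex_space_def algebra_simps intro!: exI[of _ ?K])
qed

lemma Q_bound:
  assumes z: "z \<in> carrier Y" and \<phi>: "\<phi> \<in> carrier (dual X)"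
  shows "cmod (Q z \<phi>) \<le> M * nrm Y z * nrm (dual X) \<phi>"
proof -
  obtain x where x: "x \<in> carrier Ul.B" "z = Ul.cls x" using z by (rule Ul.Y_carrierE)
  have "((\<lambda>j. M * nrm Z (x j) * nrm (dual X) \<phi>) \<longlongrightarrow> M * nrm Y z * nrm (dual X) \<phi>) U"
    using Ul.limnorm_tendsto[OF x(1)] x by (intro tendsto_intros) (simp add: Ul.Y_simps)
  then show ?thesis
    using tendsto_norm[OF Q_tendsto[OF \<phi> x(1)]] pairing_cls_bound[OF \<phi> Ul.families_carrier[OF x(1)]]
      ultrafilterD(2)[OF Ul.ultrafilter] x(2)
    by (intro tendsto_le[of U]) auto
qed

lemma Q_bidual:
  assumes z: "z \<in> carrier Y"
  shows "Q z \<in> carrier (bidual X)"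
proof -
  obtain x where x: "x \<in> carrier Ul.B" "z = Ul.cls x" using z by (rule Ul.Y_carrierE)
  have rep: "\<exists>f. f \<in> carrier Lp.F \<and> x j = Lp.Lcls f" for j
    using Lp.Z_carrierE[OF Ul.families_carrier[OF x(1)]] by blast
  have "bounded_op (dual X) complex_space (Q z)"
    unfolding bounded_op_def
  proof (intro conjI ballI allI)
    fix \<phi> \<psi> assume \<phi>: "\<phi> \<in> carrier (dual X)" and \<psi>: "\<psi> \<in> carrier (dual X)"
    have "pairing_cls j (\<phi> \<oplus>\<^bsub>dual X\<^esub> \<psi>) (x j) = pairing_cls j \<phi> (x j) + pairing_cls j \<psi> (x j)" for j
      using rep[of j] \<phi> \<psi> by (auto simp: pairing_cls dual_closed pairing_dual_linear)
    then have "Q z (\<phi> \<oplus>\<^bsub>dual X\<^esub> \<psi>) = Q z \<phi> + Q z \<psi>"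
      unfolding x(2) using tendsto_add[OF Q_tendsto[OF \<phi> x(1)] Q_tendsto[OF \<psi> x(1)]]
      by (intro Q_eqI x(1) dual_closed \<phi> \<psi>) simp
    then show "Q z (\<phi> \<oplus>\<^bsub>dual X\<^esub> \<psi>) = Q z \<phi> \<oplus>\<^bsub>complex_space\<^esub> Q z \<psi>" by (simp add: complex_space_def)
  next
    fix a \<phi> assume \<phi>: "\<phi> \<in> carrier (dual X)"
    have "pairing_cls j (a \<odot>\<^bsub>dual X\<^esub> \<phi>) (x j) = a * pairing_cls j \<phi> (x j)" for j
      using rep[of j] \<phi> by (auto simp: pairing_cls dual_closed pairing_dual_linear)
    then have "Q z (a \<odot>\<^bsub>dual X\<^esub> \<phi>) = a * Q z \<phi>"
      unfolding x(2) using tendsto_mult_left[OF Q_tendsto[OF \<phi> x(1)], of a]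
      by (intro Q_eqI x(1) dual_closed \<phi>) simp
    then show "Q z (a \<odot>\<^bsub>dual X\<^esub> \<phi>) = a \<odot>\<^bsub>complex_space\<^esub> Q z \<phi>" by (simp add: complex_space_def)
  next
    show "\<exists>K. \<forall>\<phi>\<in>carrier (dual X). nrm complex_space (Q z \<phi>) \<le> K * nrm (dual X) \<phi>"
      using Q_bound[OF z] by (auto simp: complex_space_def intro!: exI[of _ "M * nrm Y z"])
  qed (simp add: complex_space_def)
  then show ?thesis by (simp add: dual_simps(1)[of "dual X"] Q_def)
qed

lemma Q_nrm_le:
  assumes z: "z \<in> carrier Y"
  shows "nrm (bidual X) (Q z) \<le> M * nrm Y z"
proof -
  \<comment> \<open>The zero functional shows that the supremum is over a nonempty set.\<close>
  have zero: "(\<lambda>x\<in>carrier X. 0) \<in> {\<phi> \<in> carrier (dual X). nrm (dual X) \<phi> \<le> 1}"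
  proof -
    have c: "(\<lambda>x\<in>carrier X. 0 :: complex) \<in> carrier (dual X)"
      by (auto simp: dual_def bounded_op_def complex_space_def intro!: exI[of _ 0])
    have "op_norm X complex_space (\<lambda>x\<in>carrier X. 0) \<le> 0"
      by (rule Lp.op_norm_le) (auto simp: complex_space_def)
    then show ?thesis using c by (simp add: dual_def)
  qed
  have "op_norm (dual X) complex_space (Q z) \<le> M * nrm Y z"
    unfolding op_norm_def
  proof (rule cSUP_least)
    fix \<phi> assume "\<phi> \<in> {\<phi> \<in> carrier (dual X). nrm (dual X) \<phi> \<le> 1}"
    then have \<phi>: "\<phi> \<in> carrier (dual X)" "nrm (dual X) \<phi> \<le> 1" by auto
    have "cmod (Q z \<phi>) \<le> M * nrm Y z * nrm (dual X) \<phi>" by (rule Q_bound[OF z \<phi>(1)])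
    also have "\<dots> \<le> M * nrm Y z" using \<phi> M_nonneg z by (intro mult_left_le) auto
    finally show "nrm complex_space (Q z \<phi>) \<le> M * nrm Y z" by (simp add: complex_space_def)
  qed (use zero in blast)
  then show ?thesis by (simp add: dual_simps(4)[of "dual X"])
qed

lemma Q_bounded_op: "bounded_op Y (bidual X) Q"
  unfolding bounded_op_def
proof (intro conjI ballI allI)
  show "Q \<in> carrier Y \<rightarrow> carrier (bidual X)" using Q_bidual by blast
  fix z w assume "z \<in> carrier Y" "w \<in> carrier Y"
  then obtain x y where x: "x \<in> carrier Ul.B" "z = Ul.cls x" and y: "y \<in> carrier Ul.B" "w = Ul.cls y"
    by (elim Ul.Y_carrierE)
  have "Q (Ul.cls (\<lambda>j. x j \<oplus>\<^bsub>Z\<^esub> y j)) \<phi> = Q z \<phi> + Q w \<phi>" if \<phi>: "\<phi> \<in> carrier (dual X)" for \<phi>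
    using tendsto_add[OF Q_tendsto[OF \<phi> x(1)] Q_tendsto[OF \<phi> y(1)]] x y
    by (intro Q_eqI \<phi> Ul.families_add) (simp_all add: pairing_cls_linear[OF \<phi>])
  then have "Q (Ul.cls (\<lambda>j. x j \<oplus>\<^bsub>Z\<^esub> y j)) = (\<lambda>\<phi>\<in>carrier (dual X). Q z \<phi> + Q w \<phi>)"
    by (intro extensionalityI[of _ "carrier (dual X)"]) (auto simp: Q_def)
  then show "Q (z \<oplus>\<^bsub>Y\<^esub> w) = Q z \<oplus>\<^bsub>bidual X\<^esub> Q w"
    using x y by (simp add: Ul.Y_simps dual_simps(2,3)[of "dual X"])
next
  fix a z assume "z \<in> carrier Y"
  then obtain x where x: "x \<in> carrier Ul.B" "z = Ul.cls x" by (elim Ul.Y_carrierE)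
  have "Q (Ul.cls (\<lambda>j. a \<odot>\<^bsub>Z\<^esub> x j)) \<phi> = a * Q z \<phi>" if \<phi>: "\<phi> \<in> carrier (dual X)" for \<phi>
    using tendsto_mult_left[OF Q_tendsto[OF \<phi> x(1)], of a] x
    by (intro Q_eqI \<phi> Ul.families_scale) (simp_all add: pairing_cls_linear[OF \<phi>])
  then have "Q (Ul.cls (\<lambda>j. a \<odot>\<^bsub>Z\<^esub> x j)) = (\<lambda>\<phi>\<in>carrier (dual X). a * Q z \<phi>)"
    by (intro extensionalityI[of _ "carrier (dual X)"]) (auto simp: Q_def)
  then show "Q (a \<odot>\<^bsub>Y\<^esub> z) = a \<odot>\<^bsub>bidual X\<^esub> Q z"
    using x by (simp add: Ul.Y_simps dual_simps(2,3)[of "dual X"])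
next
  show "\<exists>K. \<forall>z\<in>carrier Y. nrm (bidual X) (Q z) \<le> K * nrm Y z" using Q_nrm_le by blast
qed

text \<open>\<open>\<pi> s\<close> undoes \<open>\<pi> (- s)\<close>, so the integrand is
  \<open>k j s powr (p - 1) * k j s = h j s\<close> times \<open>\<phi> x\<close>. Mass 1 makes the
  pairing equal to \<open>\<phi> x\<close> at every index, before any limit.\<close>

lemma Q_J:
  assumes x: "x \<in> carrier X" shows "Q (J x) = canonical_embedding X x"
proof -
  have "Q (J x) \<phi> = \<phi> x" if \<phi>: "\<phi> \<in> carrier (dual X)" for \<phi>
  proof -
    have "pairing j \<phi> (orbit j x) = \<phi> x" for j
    proof -
      have "complex_of_real (k j s powr (p - 1)) * \<phi> (\<pi> s (orbit j x s)) = complex_of_real (h j s) * \<phi> x" for s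
      proof -
        have "\<pi> s (orbit j x s) = complex_of_real (k j s) \<odot> \<pi> (s + - s) x"
          using x by (simp only: orbit_def \<pi>_scale \<pi>_closed \<pi>_comp)
        then have "\<phi> (\<pi> s (orbit j x s)) = complex_of_real (k j s) * \<phi> x"
          using x by (simp add: Lp.dualD(2)[OF \<phi>] \<pi>_zero)
        \<comment> \<open>The exponent law divides by \<open>k j s\<close>; where this is zero, both
          sides vanish.\<close>
        moreover have "k j s powr (p - 1) * k j s = h j s"
          using k_powr[of j s] k_nonneg[of j s] by (cases "k j s = 0") (auto simp: powr_diff)
        ultimately show ?thesis by (metis (no_types, lifting) mult.assoc of_real_mult)
      qed
      then show ?thesis using h(2)[of j] by (simp add: pairing_def)
    qed
    then have "pairing_cls j \<phi> (Lp.Lcls (orbit j x)) = \<phi> x" for j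
      using pairing_cls[OF \<phi> orbit_functions(1)[OF x]] by simp
    then show ?thesis unfolding J_def by (intro Q_eqI \<phi> J_families x) simp
  qed
  then show ?thesis
    by (intro extensionalityI[of _ "carrier (dual X)"]) (auto simp: Q_def canonical_embedding_def)
qed

lemma op_norms: "op_norm X Y J * op_norm Y (bidual X) Q \<le> M\<^sup>2"
proof -
  have J: "op_norm X Y J \<le> M" "0 \<le> op_norm X Y J"
    using J_bound M_nonneg J_bounded_op Ul.Y.nrm_smult
    by (auto intro!: Lp.op_norm_le Lp.op_norm_nonneg)
  have "op_norm Y (bidual X) Q \<le> M"
    using Q_nrm_le M_nonneg by (rule Ul.Y.op_norm_le)
  then have "op_norm X Y J * op_norm Y (bidual X) Q \<le> op_norm X Y J * M"
    using J(2) by (rule mult_left_mono)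
  also have "\<dots> \<le> M * M" using J(1) M_nonneg by (rule mult_right_mono)
  finally show ?thesis by (simp add: power2_eq_square)
qed

section \<open>Completeness and order of the ultrapower\<close>

lemma Y_banach: "complex_banach_space Y"
  unfolding complex_banach_space_def complex_banach_space_axioms_def
  using Ul.Y_normed Ul.Y_complete by simp

text \<open>The ordered structures are interpreted under the assumption on \<open>X\<close> only,
  since the dilation itself is built for every normed \<open>X\<close>.\<close>

lemma Y_riesz:
  assumes "riesz_normed X"
  shows "riesz_normed Y" "positive_op Y Y (rep_hat t)"
proof -
  interpret X: riesz_normed X by fact
  interpret Lp_cone X \<mu> p Z
    by (rule Lp_cone.intro[OF Lp.Lp_space_axioms X.cone_normed_space]) (rule Lp.Z_def)
  \<comment> \<open>All factors are the same Lp, whose approximate domination is what the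
    ultraproduct of cones asks for.\<close>
  have "ultraproduct_of_cones_axioms (\<lambda>j :: 'i. Z)"
  proof (rule ultraproduct_of_cones_axioms.intro)
    show "cone_normed_space Z" by (rule Z_cones)
    fix z and \<delta> :: real assume "z \<in> real_part Z" "0 < \<delta>"
    with X.riesz show "\<exists>z'\<in>real_part Z. nrm Z (z' \<ominus>\<^bsub>Z\<^esub> z) < \<delta> \<and>
        (\<forall>\<epsilon>>0. \<exists>w\<in>real_part Z. \<ominus>\<^bsub>Z\<^esub> w \<preceq>\<^bsub>Z\<^esub> z' \<and> z' \<preceq>\<^bsub>Z\<^esub> w \<and> nrm Z w \<le> (1 + \<epsilon>) * nrm Z z')"
      by (rule Z_riesz_approx)
  qed
  then interpret UC: ultraproduct_of_cones U "\<lambda>j. Z" Y rank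
    by (rule ultraproduct_of_cones.intro[OF Ul.ultraproduct_incomplete_axioms]) (rule Ul.Y_def)
  show "riesz_normed Y" by (rule UC.Y_riesz_normed)
  show "positive_op Y Y (rep_hat t)"
    unfolding positive_op_def
  proof
    fix z assume "z \<in> pos_cone Y"
    then obtain x where x: "x \<in> carrier Ul.B" "\<And>j. x j \<in> pos_cone Z" "z = Ul.cls x"
      using UC.Y_coneE by blast
    then show "rep_hat t z \<in> pos_cone Y"
      by (simp add: rep_hat_cls UC.Y_coneI rep_hat_families pullback_positive[OF translation])
  qed
qed

end

text \<open>At a finite set \<open>T\<close> and a number \<open>n\<close> the weight is invariant
  up to \<open>1 / Suc n\<close> under \<open>T\<close>, and any given \<open>t\<close> eventually
  lies in \<open>T\<close>. The second component also supplies the rank.\<close>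

lemma (in haar) exists_reiter_net:
  assumes mean: "left_invariant_mean \<mu> m"
  obtains U :: "('g set \<times> nat) filter" and h where "ultrafilter U" "filterlim snd at_top U"
    "\<And>j. h j \<in> weights" "\<And>j. (\<integral>s. h j s \<partial>\<mu>) = 1"
    "\<And>t. ((\<lambda>j. \<integral>s. \<bar>h j (- t + s) - h j s\<bar> \<partial>\<mu>) \<longlongrightarrow> 0) U"
proof -
  define F :: "('g set \<times> nat) filter" where "F = finite_subsets_at_top UNIV \<times>\<^sub>F sequentially"
  have "F \<noteq> bot" by (simp add: F_def prod_filter_eq_bot)
  then obtain U where U: "ultrafilter U" "U \<le> F" by (rule exists_ultrafilter_le)
  have rank: "filterlim snd at_top U"
    using filterlim_snd filterlim_mono[OF _ order_refl U(2)] unfolding F_def by blast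
  have "\<exists>h. h \<in> weights \<and> (\<integral>s. h s \<partial>\<mu>) = 1 \<and>
      (finite (fst j) \<longrightarrow> (\<forall>t\<in>fst j. (\<integral>s. \<bar>h (- t + s) - h s\<bar> \<partial>\<mu>) < 1 / real (Suc (snd j))))"
    for j :: "'g set \<times> nat"
  proof -
    \<comment> \<open>The index type contains infinite sets as well; these receive the empty demand
      and are negligible for the filter.\<close>
    define T where "T = (if finite (fst j) then fst j else {})"
    have "finite T" by (simp add: T_def)
    from reiter[OF mean this, of "1 / real (Suc (snd j))"] show ?thesis by (auto simp: T_def)
  qed
  then obtain h where h: "\<And>j. h j \<in> weights" "\<And>j. (\<integral>s. h j s \<partial>\<mu>) = 1"
    "\<And>j t. finite (fst j) \<Longrightarrow> t \<in> fst j \<Longrightarrow> (\<integral>s. \<bar>h j (- t + s) - h j s\<bar> \<partial>\<mu>) < 1 / real (Suc (snd j))"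
    by metis
  have "((\<lambda>j. \<integral>s. \<bar>h j (- t + s) - h j s\<bar> \<partial>\<mu>) \<longlongrightarrow> 0) U" for t
  proof (rule Lim_null_comparison)
    show "((\<lambda>j. 1 / real (Suc (snd j))) \<longlongrightarrow> 0) U"
      using filterlim_compose[OF LIMSEQ_inverse_real_of_nat rank] by (simp add: inverse_eq_divide)
    have "\<forall>\<^sub>F T in finite_subsets_at_top (UNIV :: 'g set). finite T \<and> t \<in> T"
      unfolding eventually_finite_subsets_at_top by (intro exI[of _ "{t}"]) auto
    then have "\<forall>\<^sub>F j in F. finite (fst j) \<and> t \<in> fst j"
      unfolding F_def by (rule eventually_compose_filterlim[OF _ filterlim_fst])
    then have "\<forall>\<^sub>F j in U. finite (fst j) \<and> t \<in> fst j" using U(2) by (rule filter_leD[rotated])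
    then show "\<forall>\<^sub>F j in U. norm (\<integral>s. \<bar>h j (- t + s) - h j s\<bar> \<partial>\<mu>) \<le> 1 / real (Suc (snd j))"
      by eventually_elim (use h(3) in \<open>force intro: less_imp_le\<close>)
  qed
  then show thesis using that U(1) rank h(1,2) by blast
qed

theorem theorem6p1:
  fixes X :: "'v onspace"
    and \<pi> :: "'g::{topological_group_add, t2_space} \<Rightarrow> 'v \<Rightarrow> 'v"
    and p :: real
  assumes "complex_banach_space X"
    and "amenable_lc_group TYPE('g)"
    and "group_rep X \<pi>" and "continuous_rep X \<pi>" and "bounded_rep X \<pi>"
    and "1 < p"
  shows "\<exists>(Y :: ('g set \<times> nat \<Rightarrow> ('g \<Rightarrow> 'v) set) set onspace) \<pi>' J Q.
    Y \<in> ultra_Lp_class p X \<and> complex_banach_space Y \<and>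
    group_rep Y \<pi>' \<and> isometric_rep Y \<pi>' \<and>
    bounded_op X Y J \<and> bounded_op Y (bidual X) Q \<and>
    op_norm X Y J * op_norm Y (bidual X) Q \<le> (rep_norm X \<pi>)\<^sup>2 \<and>
    (\<forall>t. \<forall>x\<in>carrier X. canonical_embedding X (\<pi> t x) = Q (\<pi>' t (J x))) \<and>
    (\<forall>x\<in>carrier X. continuous_map euclidean (ntopology Y) (\<lambda>t. \<pi>' t (J x))) \<and>
    (riesz_normed X \<longrightarrow> riesz_normed Y \<and> (\<forall>t. positive_op Y Y (\<pi>' t)))"
proof -
  obtain \<mu> :: "'g measure" and m where haar: "left_haar_measure \<mu>" and m: "left_invariant_mean \<mu> m"
    using assms(2) by (auto simp: amenable_lc_group_def)
  interpret haar \<mu> by (rule haar.intro[OF haar])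
  obtain U :: "('g set \<times> nat) filter" and h where U: "ultrafilter U" "filterlim snd at_top U"
    and h: "\<And>j. h j \<in> weights" "\<And>j. (\<integral>s. h j s \<partial>\<mu>) = 1"
      "\<And>t. ((\<lambda>j. \<integral>s. \<bar>h j (- t + s) - h j s\<bar> \<partial>\<mu>) \<longlongrightarrow> 0) U"
    by (rule exists_reiter_net[OF m]) blast
  let ?Z = "Lp p \<mu> X" and ?Y = "ultraproduct U (\<lambda>j. Lp p \<mu> X)"
  interpret X: complex_banach_space X by (rule assms(1))
  have Lp: "Lp_space X p"
    using assms(6) by (intro Lp_space.intro Lp_space_axioms.intro X.complex_normed_space_axioms less_imp_le)
  then interpret Lp_space X \<mu> p ?Z .
  have inc: "ultraproduct_incomplete U (\<lambda>j. ?Z) snd"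
    by (intro ultraproduct_incomplete.intro ultraproduct_of_normed.intro
        ultraproduct_incomplete_axioms.intro U Z_normed)
  interpret dilation \<mu> X p ?Z U ?Y snd \<pi> h
    by (intro dilation.intro dilation_axioms.intro haar_axioms Lp inc reflexive assms h)
  show ?thesis
  proof (intro exI conjI allI ballI impI)
    show "?Y \<in> ultra_Lp_class p X"
      unfolding ultra_Lp_class_def mem_Collect_eq
      by (intro exI[of _ U] exI[of _ "\<lambda>j. \<mu>"] conjI refl U(1))
    show "canonical_embedding X (\<pi> t x) = Q (rep_hat t (J x))" if "x \<in> carrier X" for t x
      using that by (simp add: rep_hat_J Q_J)
  qed (fact Y_banach rep_hat_group_rep rep_hat_isometric J_bounded_op Q_bounded_op op_norms
      rep_hat_J_continuous Y_riesz)+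
qed

end
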